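(* Let $R$ and $S$ be standard graded polynomial rings over a field $k$, and let $\phi:R\to S$ be a graded surjective morphism of $k$-algebras such that $\mathfrak{a}:=\ker\phi$ is a complete intersection. Let $I\subset R$ be any proper homogeneous ideal such that $\mathfrak{a}$ is regular on $R/I$ (that is, a minimal homogeneous generating set of $\mathfrak{a}$, which consists of linear forms, is a regular sequence on $R/I$). Then $I$ is Golod if and only if $\phi(I)$ is Golod.
   Context: Golod: Let $Q$ be a standard graded polynomial ring over a field $k$ and $J\subset Q$ a proper homogeneous ideal. Let $K^{Q/J}$ be the Koszul complex on a minimal generating set of the graded maximal ideal of $Q/J$, viewed as a DG-algebra (exterior algebra with the Koszul differential $d$). The ring $Q/J$ (equivalently, the ideal $J$) is called Golod if $A=K^{Q/J}$ admits a trivial Massey operation: for some homogeneous $k$-basis $\mathcal{B}=\{h_\lambda\}_{\lambda\in\Lambda}$ of $H_{\geq 1}(A)$ there is a function $\mu:\coprod_{i=1}^\infty\mathcal{B}^i\to A$ (with homogeneous values) such that $\mu(h_\lambda)$ is a cycle with homology class $h_\lambda$, and $$d\mu(h_{\lambda_1},\dots,h_{\lambda_p})=\sum_{j=1}^{p-1}\overline{\mu(h_{\lambda_1},\dots,h_{\lambda_j})}\,\mu(h_{\lambda_{j+1}},\dots,h_{\lambda_p}),$$ where $\overline{a}:=(-1)^{|a|+1}a$ and $|a|$ is the homological degree of $a$. *)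

theory Defs
  imports "HOL-Library.Poly_Mapping" "HOL-Algebra.QuotRing" "Jordan_Normal_Form.VS_Connect"
begin

hide_const (open) Multiset.mult Polynomial.smult Modules.module Ring_Hom.ring_hom

section \<open>Standard graded polynomial rings\<close>

text \<open>A polynomial is a finitely supported map from monomials (finitely supported exponent
  vectors) to coefficients. The polynomial ring in the variables \<open>x\<^sub>0, \<dots>, x\<^sub>n\<^sub>-\<^sub>1\<close>, where \<open>n = 0\<close> is
  allowed, is cut out as a carrier set, and the variables have degree 1.\<close>

type_synonym 'k mpoly = "(nat \<Rightarrow>\<^sub>0 nat) \<Rightarrow>\<^sub>0 'k"

definition poly_ring :: "nat \<Rightarrow> 'k::field mpoly ring" where
  "poly_ring n =
    \<lparr>carrier = {p. \<forall>m \<in> Poly_Mapping.keys p. Poly_Mapping.keys m \<subseteq> {..<n}},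
     mult = (*), one = 1, zero = 0, add = (+)\<rparr>"

abbreviation const :: "'k::field \<Rightarrow> 'k mpoly" where
  "const c \<equiv> Poly_Mapping.single 0 c"

definition mdeg :: "(nat \<Rightarrow>\<^sub>0 nat) \<Rightarrow> nat" where
  "mdeg m = (\<Sum>i \<in> Poly_Mapping.keys m. Poly_Mapping.lookup m i)"

definition forms :: "nat \<Rightarrow> nat \<Rightarrow> 'k::field mpoly set" where
  "forms n d = {p \<in> carrier (poly_ring n). \<forall>m \<in> Poly_Mapping.keys p. mdeg m = d}"

definition homogeneous_elements :: "nat \<Rightarrow> 'k::field mpoly set" where
  "homogeneous_elements n = (\<Union>d. forms n d)"

definition homogeneous_ideal :: "nat \<Rightarrow> 'k::field mpoly set \<Rightarrow> bool" where
  "homogeneous_ideal n I \<longleftrightarrow>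
     (\<exists>F \<subseteq> homogeneous_elements n. I = Idl\<^bsub>poly_ring n\<^esub> F)"

definition graded_max_ideal :: "nat \<Rightarrow> 'k::field mpoly set" where
  "graded_max_ideal n = {p \<in> carrier (poly_ring n). Poly_Mapping.lookup p 0 = 0}"

definition graded_alg_hom :: "nat \<Rightarrow> nat \<Rightarrow> ('k::field mpoly \<Rightarrow> 'k mpoly) \<Rightarrow> bool" where
  "graded_alg_hom m n \<phi> \<longleftrightarrow>
     \<phi> \<in> ring_hom (poly_ring m) (poly_ring n) \<and>
     (\<forall>c. \<phi> (const c) = const c) \<and>
     (\<forall>d. \<phi> ` forms m d \<subseteq> forms n d)"


section \<open>Generating sets and regular sequences\<close>

text \<open>\<open>H\<close> is the set of homogeneous elements of \<open>R\<close>; minimality is irredundancy. The generators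
  are listed because they are used in a fixed order below.\<close>

definition min_hom_gens :: "('a, 'm) ring_scheme \<Rightarrow> 'a set \<Rightarrow> 'a set \<Rightarrow> 'a list \<Rightarrow> bool" where
  "min_hom_gens R H I fs \<longleftrightarrow>
     distinct fs \<and> set fs \<subseteq> H \<and> Idl\<^bsub>R\<^esub> (set fs) = I \<and>
     (\<forall>F. F \<subset> set fs \<longrightarrow> Idl\<^bsub>R\<^esub> F \<noteq> I)"

text \<open>The second conjunct says that the \<open>i\<close>-th element is a non-zero-divisor modulo its
  predecessors.\<close>

definition regular_sequence :: "('a, 'm) ring_scheme \<Rightarrow> 'a list \<Rightarrow> bool" where
  "regular_sequence R fs \<longleftrightarrow>
     set fs \<subseteq> carrier R \<and>
     (\<forall>i < length fs. \<forall>a \<in> carrier R.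
        fs ! i \<otimes>\<^bsub>R\<^esub> a \<in> Idl\<^bsub>R\<^esub> (set (take i fs)) \<longrightarrow> a \<in> Idl\<^bsub>R\<^esub> (set (take i fs))) \<and>
     Idl\<^bsub>R\<^esub> (set fs) \<noteq> carrier R"

definition complete_intersection :: "('a, 'm) ring_scheme \<Rightarrow> 'a set \<Rightarrow> bool" where
  "complete_intersection R I \<longleftrightarrow> (\<exists>fs. regular_sequence R fs \<and> I = Idl\<^bsub>R\<^esub> (set fs))"

text \<open>A sequence in \<open>R\<close> is regular on the module \<open>R/I\<close> iff its image in the ring \<open>R/I\<close> is a
  regular sequence.\<close>

definition regular_ideal_on_quotient :: "nat \<Rightarrow> 'k::field mpoly set \<Rightarrow> 'k mpoly set \<Rightarrow> bool" where
  "regular_ideal_on_quotient n A I \<longleftrightarrow>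
     (\<exists>fs. min_hom_gens (poly_ring n) (homogeneous_elements n) A fs \<and>
           regular_sequence (poly_ring n Quot I) (map (\<lambda>f. I +>\<^bsub>poly_ring n\<^esub> f) fs))"


section \<open>DG-algebras and trivial Massey operations\<close>

text \<open>\<open>hcomp A i\<close> is the component of homological degree \<open>i\<close>.\<close>

record ('k, 'a) dg_algebra = "('k, 'a) module" +
  hcomp :: "nat \<Rightarrow> 'a set"
  differential :: "'a \<Rightarrow> 'a"

definition cycles :: "('k, 'a) dg_algebra \<Rightarrow> nat \<Rightarrow> 'a set" where
  "cycles A i = {z \<in> hcomp A i. differential A z = \<zero>\<^bsub>A\<^esub>}"

definition boundaries :: "('k, 'a) dg_algebra \<Rightarrow> nat \<Rightarrow> 'a set" where
  "boundaries A i = differential A ` hcomp A (Suc i)"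

text \<open>The \<open>k\<close>-vector space \<open>H\<^sub>i(A)\<close>, whose elements are the cosets of the boundaries. The ring
  multiplication fields of a module record play no role.\<close>

definition homology :: "('k, 'a) dg_algebra \<Rightarrow> nat \<Rightarrow> ('k, 'a set) module" where
  "homology A i =
    \<lparr>carrier = (\<lambda>z. boundaries A i +>\<^bsub>A\<^esub> z) ` cycles A i,
     mult = undefined, one = undefined,
     zero = boundaries A i, add = set_add A,
     smult = (\<lambda>c h. \<Union>z\<in>h. boundaries A i +>\<^bsub>A\<^esub> (c \<odot>\<^bsub>A\<^esub> z))\<rparr>"

text \<open>A homogeneous basis of the graded space \<open>H\<^sub>\<ge>\<^sub>1(A)\<close> is a union of bases of the \<open>H\<^sub>i(A)\<close>,
  \<open>i \<ge> 1\<close>. Nonzero classes in distinct degrees are distinct as sets, since the components of \<open>A\<close>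
  intersect only in \<open>0\<close>.\<close>

definition homogeneous_homology_basis :: "('k::field, 'a) dg_algebra \<Rightarrow> 'a set set \<Rightarrow> bool" where
  "homogeneous_homology_basis A B \<longleftrightarrow>
     B \<subseteq> (\<Union>i\<in>{1..}. carrier (homology A i)) \<and>
     (\<forall>i\<ge>1. vectorspace.basis class_ring (homology A i) (B \<inter> carrier (homology A i)))"

text \<open>\<open>(-1)\<^bsup>|a|+1\<^esup> a\<close>, where \<open>|a|\<close> is the homological degree; meaningful for homogeneous \<open>a\<close> only.\<close>

definition bar :: "('k, 'a) dg_algebra \<Rightarrow> 'a \<Rightarrow> 'a" where
  "bar A a = (if \<exists>i. even i \<and> a \<in> hcomp A i then \<ominus>\<^bsub>A\<^esub> a else a)"

text \<open>The domain \<open>\<Coprod>\<^sub>p\<^sub>\<ge>\<^sub>1 B\<^sup>p\<close> of \<open>\<mu>\<close> is the set of nonempty lists over \<open>B\<close>.\<close>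

definition trivial_massey_operation ::
    "('k::field, 'a) dg_algebra \<Rightarrow> 'a set set \<Rightarrow> ('a set list \<Rightarrow> 'a) \<Rightarrow> bool" where
  "trivial_massey_operation A B \<mu> \<longleftrightarrow>
     (\<forall>hs \<in> lists B - {[]}. \<exists>i. \<mu> hs \<in> hcomp A i) \<and>
     (\<forall>i\<ge>1. \<forall>h \<in> B \<inter> carrier (homology A i).
        \<mu> [h] \<in> cycles A i \<and> boundaries A i +>\<^bsub>A\<^esub> \<mu> [h] = h) \<and>
     (\<forall>hs \<in> lists B - {[]}.
        differential A (\<mu> hs) =
          (\<Oplus>\<^bsub>A\<^esub>j \<in> {1..<length hs}. bar A (\<mu> (take j hs)) \<otimes>\<^bsub>A\<^esub> \<mu> (drop j hs)))"

definition admits_trivial_massey_operation :: "('k::field, 'a) dg_algebra \<Rightarrow> bool" where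
  "admits_trivial_massey_operation A \<longleftrightarrow>
     (\<exists>B \<mu>. homogeneous_homology_basis A B \<and> trivial_massey_operation A B \<mu>)"


section \<open>The Koszul complex\<close>

definition sgn_mult :: "('a, 'm) ring_scheme \<Rightarrow> nat \<Rightarrow> 'a \<Rightarrow> 'a" where
  "sgn_mult R k a = (if even k then a else \<ominus>\<^bsub>R\<^esub> a)"

text \<open>The exterior algebra on \<open>e\<^sub>0, \<dots>, e\<^sub>r\<^sub>-\<^sub>1\<close> over \<open>R\<close>, where \<open>r = length xs\<close>: the function \<open>a\<close> stands
  for \<open>\<Sum>\<^sub>S a(S) e\<^sub>S\<close>, with \<open>e\<^sub>S\<close> the product of the \<open>e\<^sub>i\<close>, \<open>i \<in> S\<close>, in increasing order. Thus
  \<open>e\<^sub>S e\<^sub>T = (-1)\<^bsup>|{(s, t) \<in> S \<times> T. t < s}|\<^esup> e\<^bsub>S \<union> T\<^esub>\<close> for disjoint \<open>S\<close>, \<open>T\<close>, and the differential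
  is the one with \<open>d(e\<^sub>i) = xs ! i\<close>, so that \<open>d(e\<^sub>T) = \<Sum>\<^bsub>i \<in> T\<^esub> (-1)\<^bsup>|{j \<in> T. j < i}|\<^esup> xs\<^sub>i e\<^bsub>T - {i}\<^esub>\<close>.
  The ground field acts through the structure map \<open>\<iota>\<close> of the \<open>k\<close>-algebra \<open>R\<close>.\<close>

definition koszul ::
    "('a, 'm) ring_scheme \<Rightarrow> ('k \<Rightarrow> 'a) \<Rightarrow> 'a list \<Rightarrow> ('k, nat set \<Rightarrow> 'a) dg_algebra" where
  "koszul R \<iota> xs = (let
      K = {a. (\<forall>S. a S \<in> carrier R) \<and> (\<forall>S. \<not> S \<subseteq> {..<length xs} \<longrightarrow> a S = \<zero>\<^bsub>R\<^esub>)}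
    in
    \<lparr>carrier = K,
     mult = (\<lambda>a b U. \<Oplus>\<^bsub>R\<^esub>S \<in> Pow U.
               sgn_mult R (card {(s, t). s \<in> S \<and> t \<in> U - S \<and> t < s}) (a S \<otimes>\<^bsub>R\<^esub> b (U - S))),
     one = (\<lambda>S. if S = {} then \<one>\<^bsub>R\<^esub> else \<zero>\<^bsub>R\<^esub>),
     zero = (\<lambda>S. \<zero>\<^bsub>R\<^esub>),
     add = (\<lambda>a b S. a S \<oplus>\<^bsub>R\<^esub> b S),
     smult = (\<lambda>c a S. \<iota> c \<otimes>\<^bsub>R\<^esub> a S),
     hcomp = (\<lambda>i. {a \<in> K. \<forall>S. a S \<noteq> \<zero>\<^bsub>R\<^esub> \<longrightarrow> card S = i}),
     differential = (\<lambda>a U. \<Oplus>\<^bsub>R\<^esub>i \<in> {..<length xs} - U.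
               sgn_mult R (card {j \<in> U. j < i}) (xs ! i \<otimes>\<^bsub>R\<^esub> a (insert i U)))\<rparr>)"


section \<open>Golod ideals\<close>

text \<open>For a proper homogeneous ideal \<open>J\<close> of \<open>Q = poly_ring n\<close>. The Koszul complex does not depend,
  up to isomorphism, on the minimal homogeneous generating set of the graded maximal ideal of
  \<open>Q/J\<close>.\<close>

definition golod :: "nat \<Rightarrow> 'k::field mpoly set \<Rightarrow> bool" where
  "golod n J \<longleftrightarrow>
     (\<exists>xs. min_hom_gens (poly_ring n Quot J)
             ((\<lambda>p. J +>\<^bsub>poly_ring n\<^esub> p) ` homogeneous_elements n)
             ((\<lambda>p. J +>\<^bsub>poly_ring n\<^esub> p) ` graded_max_ideal n) xs \<and>
           admits_trivial_massey_operation
             (koszul (poly_ring n Quot J) (\<lambda>c::'k. J +>\<^bsub>poly_ring n\<^esub> const c) xs))"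

end

theory Submission imports Defs "HOL-Library.Function_Algebras" begin

text \<open>
  The kernel of a graded surjection of polynomial rings is generated by linear forms. So
  \<open>\<phi> ` I\<close> is reached from \<open>I\<close> in two ways of changing the ring: adjoining to an ideal one
  linear form that is regular modulo it, as often as the kernel has minimal generators, and
  replacing an ideal that contains the kernel by its image. In both cases there is a surjection
  between the Koszul complexes before and after the change whose kernel is acyclic: for a regular
  form \<open>f\<close>, the complex \<open>K(y, f; R/I)\<close> maps onto \<open>K(y; R/(I + f))\<close> by killing the exterior
  generator of \<open>f\<close>, and in the second case the two complexes are isomorphic. The theorem therefore
  follows once Golodness is known to be invariant under surjective quasi-isomorphisms.
  
  A trivial Massey operation involves a choice of a basis of homology and of a function on words,
  and it cannot be carried along such a map. It is replaced by the condition \<open>massey_trivial\<close>,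
  which involves no choice. A defining system is a strictly upper triangular matrix \<open>X\<close> with
  entries in the augmentation ideal and \<open>d X\<^sub>i\<^sub>j = - (\<Sum>l. \<sigma>(X\<^sub>i\<^sub>l) X\<^sub>l\<^sub>j)\<close>, where
  \<open>\<sigma>(a) = (-1)^\<bar>a\<bar> a\<close>; the condition says that for every matrix that satisfies these equations
  off its corner the right hand side at the corner is a boundary. Defining systems can be pushed
  forward and, entry by entry, lifted along a surjection with acyclic kernel, so the condition is
  invariant (\<open>massey_trivial_iff\<close>).
  
  The condition yields a trivial Massey operation by recursion on the length of words
  (\<open>trivial_massey_operation_if_massey_trivial\<close>). For the converse
  (\<open>massey_trivial_if_trivial_massey_operation\<close>), the values of a trivial Massey operation first
  have to be shown to lie in the augmentation ideal; their constant terms form a noncommutative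
  power series with square zero, and such a series vanishes. A given defining system \<open>X\<close> is then
  compared with a system \<open>M\<close> whose entries are sums of values of the operation along the walks
  of a labelled graph. Such an \<open>M\<close> satisfies the equation at the corner too. The graph is built one
  superdiagonal at a time, together with a gauge transformation \<open>\<Lambda>\<close> from \<open>M\<close> to \<open>X\<close>, that is
  \<open>d \<Lambda> = X - M + X \<Lambda> - \<sigma>(\<Lambda>) M\<close>; the homology class that obstructs the next step is a linear
  combination of basis elements, and it is absorbed into \<open>M\<close> by new edges
  (\<open>exists_gauge\<close>).
  
  Koszul complexes over a quotient ring are handled through lifts: a chain is a function from finite
  sets of indices to polynomials, all operations are those over the polynomial ring, and the
  quotient enters as congruence modulo the chains with coefficients in the ideal. Minimal
  generators of the maximal ideal of \<open>R/I\<close> become bases of the linear forms modulo \<open>I\<close>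
  (\<open>golod_iff\<close>), and the choice of the basis is immaterial because a change of basis
  induces an isomorphism of Koszul complexes (\<open>koszul_basis_independent\<close>).
\<close>

section \<open>Differential graded algebras modulo an ideal\<close>

text \<open>
  A differential graded algebra \<open>C/N\<close>, presented by a subalgebra \<open>C\<close> of an ambient algebra in
  which the identities hold exactly and by a dg ideal \<open>N\<close> of \<open>C\<close>. Computations with elements
  then need no side conditions, and the quotient only enters through congruences. The grading is
  replaced by the involution \<open>sg\<close>, which stands for \<open>a \<mapsto> (-1)^\<bar>a\<bar> a\<close>: elements that are not
  homogeneous have to be admitted, since a matrix entry of a defining system can be a sum of
  elements of several degrees.
\<close>

locale dg_subquotient = vector_space scale
  for scale :: "'k::field \<Rightarrow> 'x::ab_group_add \<Rightarrow> 'x" +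
  fixes mul :: "'x \<Rightarrow> 'x \<Rightarrow> 'x" (infixl "\<star>" 70)
    and d sg :: "'x \<Rightarrow> 'x"
    and aug :: "'x \<Rightarrow> 'k"
    and C N :: "'x set"
  assumes mul_add_left: "(a + b) \<star> c = a \<star> c + b \<star> c"
    and mul_add_right: "a \<star> (b + c) = a \<star> b + a \<star> c"
    and mul_assoc: "(a \<star> b) \<star> c = a \<star> (b \<star> c)"
    and mul_scale_left: "scale r a \<star> b = scale r (a \<star> b)"
    and mul_scale_right: "a \<star> scale r b = scale r (a \<star> b)"
    and d_add: "d (a + b) = d a + d b"
    and d_scale: "d (scale r a) = scale r (d a)"
    and d_d: "d (d a) = 0"
    and sg_add: "sg (a + b) = sg a + sg b"
    and sg_scale: "sg (scale r a) = scale r (sg a)"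
    and sg_sg: "sg (sg a) = a"
    and sg_mul: "sg (a \<star> b) = sg a \<star> sg b"
    and d_sg: "d (sg a) = - sg (d a)"
    and leibniz: "d (a \<star> b) = d a \<star> b + sg a \<star> d b"
    and aug_add: "aug (a + b) = aug a + aug b"
    and aug_scale: "aug (scale r a) = r * aug a"
    and aug_mul: "aug (a \<star> b) = aug a * aug b"
    and aug_sg: "aug (sg a) = aug a"
    and aug_d: "aug (d a) = 0"
    and subspace_C: "subspace C"
    and mul_C: "a \<in> C \<Longrightarrow> b \<in> C \<Longrightarrow> a \<star> b \<in> C"
    and d_C: "a \<in> C \<Longrightarrow> d a \<in> C"
    and sg_C: "a \<in> C \<Longrightarrow> sg a \<in> C"
    and subspace_N: "subspace N"
    and N_subset: "N \<subseteq> C"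
    and mul_N_left: "a \<in> N \<Longrightarrow> b \<in> C \<Longrightarrow> a \<star> b \<in> N"
    and mul_N_right: "a \<in> C \<Longrightarrow> b \<in> N \<Longrightarrow> a \<star> b \<in> N"
    and d_N: "a \<in> N \<Longrightarrow> d a \<in> N"
    and sg_N: "a \<in> N \<Longrightarrow> sg a \<in> N"
    and aug_N: "a \<in> N \<Longrightarrow> aug a = 0"
begin

lemma additive_ops: "Modules.additive d" "Modules.additive sg"
  "Modules.additive aug"
  "Modules.additive (\<lambda>a. a \<star> b)" "Modules.additive (\<lambda>b. a \<star> b)"
  by (simp_all add: Modules.additive_def d_add sg_add aug_add mul_add_left mul_add_right)

lemmas d_simps [simp] = additive.zero [OF additive_ops(1)] additive.minus [OF additive_ops(1)]
  and sg_simps [simp] = additive.zero [OF additive_ops(2)] additive.minus [OF additive_ops(2)]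
  and aug_simps [simp] = additive.zero [OF additive_ops(3)] additive.minus [OF additive_ops(3)]
  and mul_simps [simp] = additive.zero [OF additive_ops(4)] additive.minus [OF additive_ops(4)]
    additive.zero [OF additive_ops(5)] additive.minus [OF additive_ops(5)]
lemmas d_diff = additive.diff [OF additive_ops(1)]
  and sg_diff = additive.diff [OF additive_ops(2)]
  and aug_diff = additive.diff [OF additive_ops(3)]
  and mul_diff_left = additive.diff [OF additive_ops(4)]
  and mul_diff_right = additive.diff [OF additive_ops(5)]
lemmas d_sum = additive.sum [OF additive_ops(1)]
  and sg_sum = additive.sum [OF additive_ops(2)]
  and aug_sum = additive.sum [OF additive_ops(3)]
  and mul_sum_left = additive.sum [OF additive_ops(4)]
  and mul_sum_right = additive.sum [OF additive_ops(5)]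

declare d_d [simp] sg_sg [simp]

lemmas C_zero = subspace_0 [OF subspace_C]
  and C_add = subspace_add [OF subspace_C]
  and C_diff = subspace_diff [OF subspace_C]
  and C_neg = subspace_neg [OF subspace_C]
  and C_sum = subspace_sum [OF subspace_C]
  and C_scale = subspace_scale [OF subspace_C]
lemmas N_zero = subspace_0 [OF subspace_N]
  and N_add = subspace_add [OF subspace_N]
  and N_diff = subspace_diff [OF subspace_N]
  and N_neg = subspace_neg [OF subspace_N]
  and N_sum = subspace_sum [OF subspace_N]
  and N_scale = subspace_scale [OF subspace_N]
lemmas C_closed = C_zero C_add C_diff C_neg C_sum C_scale mul_C d_C sg_C

definition augmentation_ideal :: "'x set" where
  "augmentation_ideal = {a \<in> C. aug a = 0}"

definition eqv :: "'x \<Rightarrow> 'x \<Rightarrow> bool" (infix "\<approx>" 50) where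
  "a \<approx> b \<longleftrightarrow> a - b \<in> N"

lemma eqv_refl [simp]: "a \<approx> a"
  by (simp add: eqv_def N_zero)

lemma eqv_sym: "a \<approx> b \<Longrightarrow> b \<approx> a"
  unfolding eqv_def using N_neg by fastforce

lemma eqv_trans [trans]: "a \<approx> b \<Longrightarrow> b \<approx> c \<Longrightarrow> a \<approx> c"
  unfolding eqv_def using N_add by fastforce

lemma eq_eqv_trans [trans]: "a = b \<Longrightarrow> b \<approx> c \<Longrightarrow> a \<approx> c"
  and eqv_eq_trans [trans]: "a \<approx> b \<Longrightarrow> b = c \<Longrightarrow> a \<approx> c"
  by simp_all

lemma eqv_add: "a \<approx> a' \<Longrightarrow> b \<approx> b' \<Longrightarrow> a + b \<approx> a' + b'"
  unfolding eqv_def using N_add by (metis add_diff_add)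

lemma eqv_neg: "a \<approx> a' \<Longrightarrow> - a \<approx> - a'"
  unfolding eqv_def using N_neg by (metis minus_diff_minus)

lemma eqv_diff: "a \<approx> a' \<Longrightarrow> b \<approx> b' \<Longrightarrow> a - b \<approx> a' - b'"
  using eqv_add [of a a' "- b" "- b'"] eqv_neg by simp

lemma eqv_sum: "(\<And>i. i \<in> S \<Longrightarrow> f i \<approx> g i) \<Longrightarrow> sum f S \<approx> sum g S"
  unfolding eqv_def using N_sum by (metis (mono_tags, lifting) sum_subtractf)

lemma eqv_scale: "a \<approx> a' \<Longrightarrow> scale r a \<approx> scale r a'"
  unfolding eqv_def using N_scale by (metis scale_right_diff_distrib)

lemma eqv_d: "a \<approx> a' \<Longrightarrow> d a \<approx> d a'"
  unfolding eqv_def using d_N by (metis d_diff)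

lemma eqv_sg: "a \<approx> a' \<Longrightarrow> sg a \<approx> sg a'"
  unfolding eqv_def using sg_N by (metis sg_diff)

lemma eqv_mul_left: "a \<approx> a' \<Longrightarrow> b \<in> C \<Longrightarrow> a \<star> b \<approx> a' \<star> b"
  unfolding eqv_def using mul_N_left by (metis mul_diff_left)

lemma eqv_mul_right: "b \<approx> b' \<Longrightarrow> a \<in> C \<Longrightarrow> a \<star> b \<approx> a \<star> b'"
  unfolding eqv_def using mul_N_right by (metis mul_diff_right)

lemma eqv_C: "a \<approx> b \<Longrightarrow> b \<in> C \<Longrightarrow> a \<in> C"
  unfolding eqv_def using N_subset C_add by (metis diff_add_cancel subsetD)

lemma eqv_aug: "a \<approx> b \<Longrightarrow> aug a = aug b"
  unfolding eqv_def using aug_N aug_diff by (metis eq_iff_diff_eq_0)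

lemma eqv_0_iff: "a \<approx> 0 \<longleftrightarrow> a \<in> N"
  by (simp add: eqv_def)

section \<open>Strictly triangular matrices\<close>

definition mm :: "(nat \<Rightarrow> nat \<Rightarrow> 'x) \<Rightarrow> (nat \<Rightarrow> nat \<Rightarrow> 'x) \<Rightarrow> nat \<Rightarrow> nat \<Rightarrow> 'x" where
  "mm X Y i j = (\<Sum>l\<in>{i<..<j}. X i l \<star> Y l j)"

definition map_mat :: "('x \<Rightarrow> 'x) \<Rightarrow> (nat \<Rightarrow> nat \<Rightarrow> 'x) \<Rightarrow> nat \<Rightarrow> nat \<Rightarrow> 'x" where
  "map_mat f X i j = f (X i j)"

lemma mm_add_left: "mm (X + Y) Z i j = mm X Z i j + mm Y Z i j"
  by (simp add: mm_def mul_add_left sum.distrib)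

lemma mm_add_right: "mm X (Y + Z) i j = mm X Y i j + mm X Z i j"
  by (simp add: mm_def mul_add_right sum.distrib)

lemma mm_diff_left: "mm (X - Y) Z i j = mm X Z i j - mm Y Z i j"
  by (simp add: mm_def mul_diff_left sum_subtractf)

lemma mm_diff_right: "mm X (Y - Z) i j = mm X Y i j - mm X Z i j"
  by (simp add: mm_def mul_diff_right sum_subtractf)

lemma mm_neg_left: "mm (- X) Z i j = - mm X Z i j"
  by (simp add: mm_def fun_Compl_def sum_negf)

lemma mm_neg_right: "mm X (- Z) i j = - mm X Z i j"
  by (simp add: mm_def fun_Compl_def sum_negf)

lemma mm_assoc: "mm (mm X Y) Z i j = mm X (mm Y Z) i j"
proof -
  have "mm (mm X Y) Z i j = (\<Sum>l\<in>{i<..<j}. \<Sum>h\<in>{i<..<l}. X i h \<star> Y h l \<star> Z l j)"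
    by (simp add: mm_def mul_sum_left)
  also have "\<dots> = (\<Sum>(l, h)\<in>Sigma {i<..<j} (\<lambda>l. {i<..<l}). X i h \<star> Y h l \<star> Z l j)"
    by (rule sum.Sigma) auto
  also have "\<dots> = (\<Sum>(h, l)\<in>Sigma {i<..<j} (\<lambda>h. {h<..<j}). X i h \<star> (Y h l \<star> Z l j))"
    by (rule sum.reindex_bij_witness [where i = prod.swap and j = prod.swap])
      (auto simp: mul_assoc)
  also have "\<dots> = (\<Sum>h\<in>{i<..<j}. \<Sum>l\<in>{h<..<j}. X i h \<star> (Y h l \<star> Z l j))"
    by (rule sum.Sigma [symmetric]) auto
  also have "\<dots> = mm X (mm Y Z) i j"
    by (simp add: mm_def mul_sum_right)
  finally show ?thesis .
qed

lemma d_mm: "d (mm X Y i j) = mm (map_mat d X) Y i j + mm (map_mat sg X) (map_mat d Y) i j"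
  by (simp add: mm_def map_mat_def d_sum leibniz sum.distrib)

lemma sg_mm: "sg (mm X Y i j) = mm (map_mat sg X) (map_mat sg Y) i j"
  by (simp add: mm_def map_mat_def sg_sum sg_mul)

lemma mm_cong_left:
  assumes "\<And>l. i < l \<Longrightarrow> l < j \<Longrightarrow> X i l \<approx> X' i l" "\<And>l. i < l \<Longrightarrow> l < j \<Longrightarrow> Y l j \<in> C"
  shows "mm X Y i j \<approx> mm X' Y i j"
  unfolding mm_def using assms by (auto intro!: eqv_sum eqv_mul_left)

lemma mm_cong_right:
  assumes "\<And>l. i < l \<Longrightarrow> l < j \<Longrightarrow> Y l j \<approx> Y' l j" "\<And>l. i < l \<Longrightarrow> l < j \<Longrightarrow> X i l \<in> C"
  shows "mm X Y i j \<approx> mm X Y' i j"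
  unfolding mm_def using assms by (auto intro!: eqv_sum eqv_mul_right)

lemma mm_C:
  assumes "\<And>l. i < l \<Longrightarrow> l < j \<Longrightarrow> X i l \<in> C" "\<And>l. i < l \<Longrightarrow> l < j \<Longrightarrow> Y l j \<in> C"
  shows "mm X Y i j \<in> C"
  unfolding mm_def using assms by (auto intro!: C_sum mul_C)

lemma mm_aug:
  assumes "\<And>l. i < l \<Longrightarrow> l < j \<Longrightarrow> aug (X i l) = 0 \<or> aug (Y l j) = 0"
  shows "aug (mm X Y i j) = 0"
  unfolding mm_def using assms by (auto intro!: sum.neutral simp: aug_sum aug_mul)

text \<open>
  The equation \<open>d X + \<sigma>(X) X = 0\<close> of Maurer and Cartan, one entry at a time; \<open>mc_defect\<close> is its
  quadratic term. The products \<open>mm\<close> leave out the two end points, so an entry of the quadratic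
  term only involves entries strictly closer to the diagonal.
\<close>

definition mc_defect :: "(nat \<Rightarrow> nat \<Rightarrow> 'x) \<Rightarrow> nat \<Rightarrow> nat \<Rightarrow> 'x" where
  "mc_defect X = mm (map_mat sg X) X"

definition flat_at :: "(nat \<Rightarrow> nat \<Rightarrow> 'x) \<Rightarrow> nat \<Rightarrow> nat \<Rightarrow> bool" where
  "flat_at X i j \<longleftrightarrow> X i j \<in> augmentation_ideal \<and> d (X i j) \<approx> - mc_defect X i j"

lemma map_mat_sg_sg [simp]: "map_mat sg (map_mat sg X) = X"
  by (simp add: map_mat_def fun_eq_iff)

lemma map_mat_simps:
  "map_mat d (map_mat sg X) = - map_mat sg (map_mat d X)"
  "map_mat sg (X + Y) = map_mat sg X + map_mat sg Y"
  "map_mat sg (X - Y) = map_mat sg X - map_mat sg Y"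
  "map_mat sg (- X) = - map_mat sg X"
  "map_mat sg (mm X Y) = mm (map_mat sg X) (map_mat sg Y)"
  by (simp_all add: map_mat_def fun_eq_iff d_sg sg_add sg_diff sg_mm fun_Compl_def
      flip: map_mat_def [abs_def])

text \<open>
  The quadratic term at the corner is a cycle: differentiating it and inserting the equations for the
  other entries gives the two bracketings of a threefold product, with opposite signs.
\<close>

lemma d_mc_defect:
  assumes "\<And>l. i < l \<Longrightarrow> l < j \<Longrightarrow> flat_at X i l \<and> flat_at X l j"
  shows "d (mc_defect X i j) \<in> N"
proof -
  have X: "X i l \<in> C" "X l j \<in> C" "d (X i l) \<approx> - mc_defect X i l" "d (X l j) \<approx> - mc_defect X l j"
    if "i < l" "l < j" for l
    using assms [OF that] by (auto simp: flat_at_def augmentation_ideal_def)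
  have "d (mc_defect X i j) =
      - mm (map_mat sg (map_mat d X)) X i j + mm X (map_mat d X) i j"
    by (simp add: mc_defect_def d_mm map_mat_simps mm_neg_left)
  also have "\<dots> \<approx> - mm (map_mat sg (- mc_defect X)) X i j + mm X (- mc_defect X) i j"
    by (intro eqv_add eqv_neg mm_cong_left mm_cong_right X; simp add: map_mat_def fun_Compl_def)
      (metis X(3) eqv_sg sg_simps(2), use X(4) in auto)
  also have "\<dots> = 0"
    by (simp add: map_mat_simps mc_defect_def mm_neg_left mm_neg_right mm_assoc)
  finally show ?thesis by (simp add: eqv_0_iff)
qed

section \<open>Gauge transformations\<close>

text \<open>
  With \<open>U = 1 + L\<close> the equation \<open>d L = X - M + gauge_rhs X M L\<close> reads
  \<open>d L = X U - \<sigma>(U) M\<close>: the unipotent matrix \<open>U\<close> is a gauge transformation from \<open>M\<close> to \<open>X\<close>.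
\<close>

definition gauge_rhs where
  "gauge_rhs X M L i j = mm X L i j - mm (map_mat sg L) M i j"

text \<open>
  Gauge equivalence below the corner forces the two quadratic terms at the corner to be homologous,
  by the differential of the right hand side of the gauge equation. The terms that are cubic in
  \<open>X\<close>, \<open>L\<close>, \<open>M\<close> cancel in pairs.
\<close>

lemma d_gauge_rhs:
  assumes X: "\<And>l. i < l \<Longrightarrow> l < j \<Longrightarrow> flat_at X i l"
    and XC: "\<And>l h. i \<le> l \<Longrightarrow> l < h \<Longrightarrow> h \<le> j \<Longrightarrow> (l, h) \<noteq> (i, j) \<Longrightarrow> X l h \<in> C \<and> M l h \<in> C \<and> L l h \<in> C"
    and M: "\<And>l. i < l \<Longrightarrow> l < j \<Longrightarrow> flat_at M l j"
    and L: "\<And>l h. i \<le> l \<Longrightarrow> l < h \<Longrightarrow> h \<le> j \<Longrightarrow> (l, h) \<noteq> (i, j)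
      \<Longrightarrow> d (L l h) \<approx> X l h - M l h + gauge_rhs X M L l h"
  shows "d (gauge_rhs X M L i j) \<approx> mc_defect X i j - mc_defect M i j"
proof -
  have c: "X i l \<in> C" "M i l \<in> C" "L i l \<in> C" "X l j \<in> C" "M l j \<in> C" "L l j \<in> C"
    if "i < l" "l < j" for l
    using XC [of i l] XC [of l j] that by auto
  have dX: "d (X i l) \<approx> (- mc_defect X) i l" if "i < l" "l < j" for l
    using X [OF that] by (simp add: flat_at_def fun_Compl_def)
  have dM: "d (M l j) \<approx> (- mc_defect M) l j" if "i < l" "l < j" for l
    using M [OF that] by (simp add: flat_at_def fun_Compl_def)
  let ?G = "X - M + gauge_rhs X M L"
  have dL: "d (L i l) \<approx> ?G i l" "d (L l j) \<approx> ?G l j" if "i < l" "l < j" for l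
    using L [of i l] L [of l j] that by auto
  have "d (gauge_rhs X M L i j) = mm (map_mat d X) L i j + mm (map_mat sg X) (map_mat d L) i j
      + mm (map_mat sg (map_mat d L)) M i j - mm L (map_mat d M) i j"
    by (simp add: gauge_rhs_def d_diff d_mm map_mat_simps mm_neg_left)
  also have "\<dots> \<approx> mm (- mc_defect X) L i j + mm (map_mat sg X) ?G i j
      + mm (map_mat sg ?G) M i j - mm L (- mc_defect M) i j"
  proof (intro eqv_add eqv_diff)
    show "mm (map_mat d X) L i j \<approx> mm (- mc_defect X) L i j"
      by (rule mm_cong_left) (use c dX in \<open>auto simp only: map_mat_def\<close>)
    show "mm (map_mat sg X) (map_mat d L) i j \<approx> mm (map_mat sg X) ?G i j"
      by (rule mm_cong_right) (use c dL sg_C in \<open>auto simp only: map_mat_def\<close>)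
    show "mm (map_mat sg (map_mat d L)) M i j \<approx> mm (map_mat sg ?G) M i j"
      by (rule mm_cong_left) (use c dL eqv_sg in \<open>auto simp only: map_mat_def\<close>)
    show "mm L (map_mat d M) i j \<approx> mm L (- mc_defect M) i j"
      by (rule mm_cong_right) (use c dM in \<open>auto simp only: map_mat_def\<close>)
  qed
  also have "\<dots> = mc_defect X i j - mc_defect M i j"
  proof -
    have G: "gauge_rhs X M L = mm X L - mm (map_mat sg L) M"
      by (simp add: gauge_rhs_def fun_eq_iff)
    show ?thesis
      apply (simp only: G mc_defect_def map_mat_simps mm_add_left mm_add_right mm_diff_left mm_diff_right
        mm_neg_left mm_neg_right mm_assoc map_mat_sg_sg)
      by simp
  qed
  finally show ?thesis .
qed

end

section \<open>Walks in a graph\<close>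

fun walk :: "(nat \<times> nat \<times> 'l) set \<Rightarrow> nat \<Rightarrow> (nat \<times> nat \<times> 'l) list \<Rightarrow> nat \<Rightarrow> bool" where
  "walk E i [] j \<longleftrightarrow> i = j"
| "walk E i (e # p) j \<longleftrightarrow> e \<in> E \<and> fst e = i \<and> walk E (fst (snd e)) p j"

definition increasing_edges :: "(nat \<times> nat \<times> 'l) set \<Rightarrow> bool" where
  "increasing_edges E \<longleftrightarrow> (\<forall>(s, t, l) \<in> E. s < t)"

definition walks :: "(nat \<times> nat \<times> 'l) set \<Rightarrow> nat \<Rightarrow> nat \<Rightarrow> (nat \<times> nat \<times> 'l) list set" where
  "walks E i j = {p. p \<noteq> [] \<and> walk E i p j}"

lemma walk_append: "walk E i (p @ q) j \<longleftrightarrow> (\<exists>l. walk E i p l \<and> walk E l q j)"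
  by (induction p arbitrary: i) auto

lemma walk_target: "walk E i p j \<Longrightarrow> j = (if p = [] then i else fst (snd (last p)))"
  by (induction p arbitrary: i) (auto split: if_splits)

lemma walk_length: "increasing_edges E \<Longrightarrow> walk E i p j \<Longrightarrow> i + length p \<le> j"
  by (induction p arbitrary: i) (fastforce simp: increasing_edges_def)+

lemma walk_subset: "walk E i p j \<Longrightarrow> set p \<subseteq> E"
  by (induction p arbitrary: i) auto

lemma walk_mono: "walk E i p j \<Longrightarrow> set p \<subseteq> E' \<Longrightarrow> walk E' i p j"
  by (induction p arbitrary: i) auto

lemma walk_edge_bounds:
  assumes "increasing_edges E" "walk E i p j" "(s, t, l) \<in> set p"
  shows "i \<le> s" "t \<le> j"
proof -
  obtain p1 p2 where p: "p = p1 @ (s, t, l) # p2"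
    using assms(3) by (meson split_list)
  have "walk E i p1 s" "walk E t p2 j"
    using assms(2) by (auto simp: p walk_append)
  thus "i \<le> s" "t \<le> j"
    using walk_length [OF assms(1)] by fastforce+
qed

text \<open>
  In an acyclic graph numbered along its edges, an edge from the start to the end of a walk is the
  whole walk. Hence the new edges of length \<open>n + 1\<close> that an induction adds change the sum over the
  walks from \<open>i\<close> to \<open>j = i + n + 1\<close> only by themselves.
\<close>

lemma walk_long_edge:
  assumes "increasing_edges E" "walk E i p j" "(i, j, l) \<in> set p"
  shows "p = [(i, j, l)]"
proof -
  obtain p1 p2 where p: "p = p1 @ (i, j, l) # p2"
    using assms(3) by (meson split_list)
  have "walk E i p1 i" "walk E j p2 j"
    using assms(2) by (auto simp: p walk_append)
  hence "i + length p1 \<le> i" "j + length p2 \<le> j"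
    using walk_length [OF assms(1)] by blast+
  thus ?thesis by (simp add: p)
qed

lemma finite_walks:
  assumes "increasing_edges E" "finite E"
  shows "finite (walks E i j)"
proof (rule finite_subset)
  show "walks E i j \<subseteq> {p. set p \<subseteq> E \<and> length p \<le> j}"
    using walk_length [OF assms(1)] walk_subset by (fastforce simp: walks_def)
qed (rule finite_lists_length_le [OF assms(2)])

text \<open>
  Cutting a walk at a proper position is the same as choosing an inner vertex and a walk on either
  side of it. This turns the sum over the cuts of a word in a Massey operation into a product of
  matrices.
\<close>

lemma sum_walks_split:
  fixes g :: "(nat \<times> nat \<times> 'l) list \<Rightarrow> (nat \<times> nat \<times> 'l) list \<Rightarrow> 'x::comm_monoid_add"
  assumes E: "increasing_edges E" "finite E"
  shows "(\<Sum>p\<in>walks E i j. \<Sum>k\<in>{1..<length p}. g (take k p) (drop k p)) =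
    (\<Sum>l\<in>{i<..<j}. \<Sum>p\<in>walks E i l. \<Sum>q\<in>walks E l j. g p q)"
proof -
  note fin = finite_walks [OF E]
  have "(\<Sum>l\<in>{i<..<j}. \<Sum>p\<in>walks E i l. \<Sum>q\<in>walks E l j. g p q) =
      (\<Sum>l\<in>{i<..<j}. \<Sum>(p, q)\<in>walks E i l \<times> walks E l j. g p q)"
    by (simp add: sum.cartesian_product)
  also have "\<dots> = (\<Sum>(l, p, q)\<in>Sigma {i<..<j} (\<lambda>l. walks E i l \<times> walks E l j). g p q)"
    using fin by (subst sum.Sigma) (auto simp: case_prod_unfold)
  also have "\<dots> = (\<Sum>(p, k)\<in>Sigma (walks E i j) (\<lambda>p. {1..<length p}). g (take k p) (drop k p))"
  proof (rule sum.reindex_bij_witness [where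
        i = "\<lambda>(p, k). (fst (snd (last (take k p))), take k p, drop k p)" and
        j = "\<lambda>(l, p, q). (p @ q, length p)"], goal_cases)
    case (1 a)
    then show ?case using walk_target by (fastforce simp: walks_def)
  next
    case (2 a)
    then show ?case
      by (auto simp: walks_def walk_append Suc_le_eq)
  next
    case (3 b)
    then show ?case by auto
  next
    case (4 b)
    obtain p k where b: "b = (p, k)" by force
    have p: "walk E i p j" "1 \<le> k" "k < length p"
      using 4 by (auto simp: b walks_def)
    hence ne: "take k p \<noteq> []" "drop k p \<noteq> []" by auto
    obtain l where l: "walk E i (take k p) l" "walk E l (drop k p) j"
      using p(1) walk_append [of E i "take k p" "drop k p" j] by auto
    have "l = fst (snd (last (take k p)))"
      using walk_target [OF l(1)] ne by simp
    moreover have "i < l" "l < j"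
      using walk_length [OF E(1) l(1)] walk_length [OF E(1) l(2)] p by auto
    ultimately show ?case using l ne by (auto simp: b walks_def)
  qed auto
  also have "\<dots> = (\<Sum>p\<in>walks E i j. \<Sum>k\<in>{1..<length p}. g (take k p) (drop k p))"
    using fin by (subst sum.Sigma) auto
  finally show ?thesis ..
qed

section \<open>Massey systems kill all Massey products\<close>

context dg_subquotient
begin

definition massey_system :: "'h set \<Rightarrow> ('h list \<Rightarrow> 'x) \<Rightarrow> bool" where
  "massey_system B \<mu> \<longleftrightarrow> (\<forall>w \<in> lists B - {[]}. \<mu> w \<in> augmentation_ideal \<and>
     d (\<mu> w) \<approx> - (\<Sum>k\<in>{1..<length w}. sg (\<mu> (take k w)) \<star> \<mu> (drop k w)))"

text \<open>
  All Massey products of all defining systems vanish. A system has indices from \<open>a\<close>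
  to \<open>b\<close>, and its Massey product \<open>mc_defect X a b\<close> is formed from the entries off the corner
  \<open>(a, b)\<close>.
\<close>

definition massey_trivial :: bool where
  "massey_trivial \<longleftrightarrow> (\<forall>a b X.
     (\<forall>i j. a \<le> i \<longrightarrow> i < j \<longrightarrow> j \<le> b \<longrightarrow> (i, j) \<noteq> (a, b) \<longrightarrow> flat_at X i j) \<longrightarrow>
     (\<exists>y\<in>C. mc_defect X a b \<approx> d y))"

definition walk_value :: "('h list \<Rightarrow> 'x) \<Rightarrow> (nat \<times> nat \<times> 'k \<times> 'h) list \<Rightarrow> 'x" where
  "walk_value \<mu> p = scale (prod_list (map (fst \<circ> snd \<circ> snd) p)) (\<mu> (map (snd \<circ> snd \<circ> snd) p))"

text \<open>
  The value of a multilinear extension of \<open>\<mu>\<close>: a matrix whose entries are linear combinations of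
  letters is a graph with labelled edges, and the edges from \<open>s\<close> to \<open>t\<close> carry the summands
  \<open>c h\<close> of the entry at \<open>(s, t)\<close>.
\<close>

definition walk_matrix :: "('h list \<Rightarrow> 'x) \<Rightarrow> (nat \<times> nat \<times> 'k \<times> 'h) set \<Rightarrow> nat \<Rightarrow> nat \<Rightarrow> 'x" where
  "walk_matrix \<mu> E i j = (\<Sum>p\<in>walks E i j. walk_value \<mu> p)"

lemma aug_ideal_subspace: "subspace augmentation_ideal"
  unfolding subspace_def augmentation_ideal_def by (auto simp: C_closed aug_add aug_scale)

text \<open>
  Linear combinations of letters along walks turn the equations of a Massey operation into the
  equations of a defining system, for all pairs of indices and in particular at the corner.
\<close>

lemma flat_walk_matrix:
  assumes \<mu>: "massey_system B \<mu>" and E: "increasing_edges E" "finite E"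
    and lab: "\<And>s t c h. (s, t, c, h) \<in> E \<Longrightarrow> h \<in> B"
  shows "flat_at (walk_matrix \<mu> E) i j"
proof -
  let ?w = "map (snd \<circ> snd \<circ> snd)"
  have w: "?w p \<in> lists B - {[]}" if "p \<in> walks E i j" for p i j
    using that walk_subset [of E i p j] lab by (fastforce simp: walks_def)
  have mem: "walk_matrix \<mu> E i j \<in> augmentation_ideal"
    unfolding walk_matrix_def walk_value_def
    by (intro subspace_sum [OF aug_ideal_subspace] subspace_scale [OF aug_ideal_subspace])
      (use \<mu> w in \<open>auto simp: massey_system_def\<close>)
  have "d (walk_matrix \<mu> E i j) =
      (\<Sum>p\<in>walks E i j. scale (prod_list (map (fst \<circ> snd \<circ> snd) p)) (d (\<mu> (?w p))))"
    by (simp add: walk_matrix_def walk_value_def d_sum d_scale)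
  also have "\<dots> \<approx> (\<Sum>p\<in>walks E i j. scale (prod_list (map (fst \<circ> snd \<circ> snd) p))
      (- (\<Sum>k\<in>{1..<length (?w p)}. sg (\<mu> (take k (?w p))) \<star> \<mu> (drop k (?w p)))))"
    by (intro eqv_sum eqv_scale \<mu> [unfolded massey_system_def, THEN bspec, THEN conjunct2] w)
  also have "\<dots> = - (\<Sum>p\<in>walks E i j. \<Sum>k\<in>{1..<length p}.
      sg (walk_value \<mu> (take k p)) \<star> walk_value \<mu> (drop k p))"
  proof -
    have pr: "prod_list (map f p) = prod_list (map f (drop k p)) * prod_list (map f (take k p))"
      for f :: "nat \<times> nat \<times> 'k \<times> 'h \<Rightarrow> 'k" and k p
      by (metis append_take_drop_id map_append mult.commute prod_list.append)
    have "scale (prod_list (map (fst \<circ> snd \<circ> snd) p)) (sg (\<mu> (take k (?w p))) \<star> \<mu> (drop k (?w p))) =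
        sg (walk_value \<mu> (take k p)) \<star> walk_value \<mu> (drop k p)" for p k
      by (simp add: walk_value_def sg_scale mul_scale_left mul_scale_right take_map drop_map
          pr [of _ p k])
    thus ?thesis
      by (simp add: scale_sum_right sum_negf)
  qed
  also have "\<dots> = - (\<Sum>l\<in>{i<..<j}. \<Sum>p\<in>walks E i l. \<Sum>q\<in>walks E l j.
      sg (walk_value \<mu> p) \<star> walk_value \<mu> q)"
    by (subst sum_walks_split [OF E]) simp
  also have "\<dots> = - mc_defect (walk_matrix \<mu> E) i j"
    by (simp add: mc_defect_def mm_def map_mat_def walk_matrix_def sg_sum mul_sum_left)
      (simp add: mul_sum_right)
  finally show ?thesis using mem by (simp add: flat_at_def)
qed

text \<open>
  The induction is on the distance \<open>n\<close> from the diagonal. At distance \<open>n + 1\<close> the difference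
  \<open>z = X - M + gauge_rhs X M L\<close> is a cycle by \<open>d_gauge_rhs\<close>, so it is congruent to a boundary plus
  a linear combination of values \<open>\<mu> [h]\<close>. One new edge for every summand of this combination moves it
  into \<open>M\<close>, and the boundary provides the new entries of \<open>L\<close>. Entries at smaller distance are not
  affected, as no walk between their indices can use a longer edge.
\<close>

lemma exists_gauge:
  assumes \<mu>: "massey_system B \<mu>"
    and span: "\<And>z. z \<in> augmentation_ideal \<Longrightarrow> d z \<in> N \<Longrightarrow>
      \<exists>u\<in>span ((\<lambda>h. \<mu> [h]) ` B). \<exists>y\<in>C. z \<approx> u + d y"
    and X: "\<And>i j. a \<le> i \<Longrightarrow> i < j \<Longrightarrow> j \<le> b \<Longrightarrow> (i, j) \<noteq> (a, b) \<Longrightarrow> flat_at X i j"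
    and n: "n < b - a"
  shows "\<exists>E L. finite E \<and> (\<forall>(s, t, c, h) \<in> E. s < t \<and> t - s \<le> n \<and> h \<in> B) \<and> (\<forall>i j. L i j \<in> C) \<and>
    (\<forall>i j. a \<le> i \<longrightarrow> i < j \<longrightarrow> j \<le> b \<longrightarrow> j - i \<le> n \<longrightarrow>
       d (L i j) \<approx> X i j - walk_matrix \<mu> E i j + gauge_rhs X (walk_matrix \<mu> E) L i j)"
  using n
proof (induction n)
  case 0
  show ?case
    by (rule exI [of _ "{}"], rule exI [of _ "\<lambda>i j. 0"]) (auto simp: C_zero)
next
  case (Suc n)
  then obtain E L where E: "finite E" "\<And>s t c h. (s, t, c, h) \<in> E \<Longrightarrow> s < t \<and> t - s \<le> n \<and> h \<in> B"
    and L: "\<And>i j. L i j \<in> C"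
    and dL: "\<And>i j. a \<le> i \<Longrightarrow> i < j \<Longrightarrow> j \<le> b \<Longrightarrow> j - i \<le> n \<Longrightarrow>
       d (L i j) \<approx> X i j - walk_matrix \<mu> E i j + gauge_rhs X (walk_matrix \<mu> E) L i j"
    by fastforce
  have incE: "increasing_edges E"
    using E(2) by (fastforce simp: increasing_edges_def)
  let ?M = "walk_matrix \<mu> E"
  have flatM: "flat_at ?M i j" for i j
    using E by (intro flat_walk_matrix [OF \<mu> incE]) auto
  define P where "P = {(i, j). a \<le> i \<and> i < j \<and> j \<le> b \<and> j - i = Suc n}"
  have finP: "finite P"
    by (rule finite_subset [of _ "{..b} \<times> {..b}"]) (auto simp: P_def)
  have "\<forall>ij\<in>P. \<exists>F c y. finite F \<and> F \<subseteq> B \<and> y \<in> C \<and>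
      X (fst ij) (snd ij) - ?M (fst ij) (snd ij) + gauge_rhs X ?M L (fst ij) (snd ij)
       \<approx> (\<Sum>h\<in>F. scale (c h) (\<mu> [h])) + d y"
  proof
    fix ij assume "ij \<in> P"
    then obtain i j where ij: "ij = (i, j)" "a \<le> i" "i < j" "j \<le> b" "j - i = Suc n"
      by (auto simp: P_def)
    have ne: "(l, h) \<noteq> (a, b)" if "i \<le> l" "l < h" "h \<le> j" for l h
      using that ij Suc.prems by auto
    have fX: "flat_at X l h" if "i \<le> l" "l < h" "h \<le> j" for l h
      using X [of l h] ne that ij by auto
    have XC: "X l h \<in> C \<and> ?M l h \<in> C \<and> L l h \<in> C" if "i \<le> l" "l < h" "h \<le> j" for l h
      using fX [OF that] flatM [of l h] L by (auto simp: flat_at_def augmentation_ideal_def)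
    let ?Y = "X i j - ?M i j + gauge_rhs X ?M L i j"
    have "d (gauge_rhs X ?M L i j) \<approx> mc_defect X i j - mc_defect ?M i j"
    proof (rule d_gauge_rhs)
      fix l h assume *: "i \<le> l" "l < h" "h \<le> j" "(l, h) \<noteq> (i, j)"
      show "X l h \<in> C \<and> ?M l h \<in> C \<and> L l h \<in> C" using XC * by blast
      have "h - l \<le> n" using * ij(5) by (cases "l = i") auto
      thus "d (L l h) \<approx> X l h - ?M l h + gauge_rhs X ?M L l h"
        using dL [of l h] * ij by auto
    qed (use fX flatM in auto)
    hence "d ?Y \<approx> - mc_defect X i j - - mc_defect ?M i j + (mc_defect X i j - mc_defect ?M i j)"
      unfolding d_add d_diff
      by (intro eqv_add eqv_diff) (use fX [of i j] flatM [of i j] ij in \<open>auto simp: flat_at_def\<close>)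
    hence dY: "d ?Y \<in> N" by (simp add: eqv_0_iff)
    have gC: "gauge_rhs X ?M L i j \<in> C"
      unfolding gauge_rhs_def map_mat_def
      by (intro C_diff mm_C sg_C) (use XC in auto)
    have "aug (mm X L i j) = 0" "aug (mm (map_mat sg L) ?M i j) = 0"
      by (rule mm_aug, use fX flatM in \<open>simp add: flat_at_def augmentation_ideal_def\<close>)+
    hence "aug (gauge_rhs X ?M L i j) = 0"
      by (simp add: gauge_rhs_def aug_diff)
    hence "?Y \<in> augmentation_ideal"
      using gC fX [of i j] flatM [of i j] ij
      by (auto simp: flat_at_def augmentation_ideal_def C_closed aug_add aug_diff)
    from span [OF this dY] obtain u y where u: "u \<in> span ((\<lambda>h. \<mu> [h]) ` B)" "y \<in> C" "?Y \<approx> u + d y"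
      by blast
    then obtain T r where T: "finite T" "T \<subseteq> (\<lambda>h. \<mu> [h]) ` B" "u = (\<Sum>v\<in>T. scale (r v) v)"
      by (auto simp: span_explicit)
    then obtain F where F: "F \<subseteq> B" "inj_on (\<lambda>h. \<mu> [h]) F" "T = (\<lambda>h. \<mu> [h]) ` F"
      by (auto simp: subset_image_inj)
    have "finite F" using T(1) F by (simp add: finite_image_iff)
    moreover have "u = (\<Sum>h\<in>F. scale (r (\<mu> [h])) (\<mu> [h]))"
      by (simp add: T(3) F(3) sum.reindex [OF F(2)])
    ultimately show "\<exists>F c y. finite F \<and> F \<subseteq> B \<and> y \<in> C \<and>
      X (fst ij) (snd ij) - ?M (fst ij) (snd ij) + gauge_rhs X ?M L (fst ij) (snd ij)
       \<approx> (\<Sum>h\<in>F. scale (c h) (\<mu> [h])) + d y"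
      using F(1) u(2, 3) by (intro exI [of _ F] exI [of _ "\<lambda>h. r (\<mu> [h])"] exI [of _ y]) (simp add: ij)
  qed
  then obtain f where f: "\<forall>ij\<in>P. case f ij of (F, c, y) \<Rightarrow> finite F \<and> F \<subseteq> B \<and> y \<in> C \<and>
      X (fst ij) (snd ij) - ?M (fst ij) (snd ij) + gauge_rhs X ?M L (fst ij) (snd ij)
       \<approx> (\<Sum>h\<in>F. scale (c h) (\<mu> [h])) + d y"
    by (atomize_elim, intro bchoice) simp
  define F where "F ij = fst (f ij)" for ij
  define c where "c ij = fst (snd (f ij))" for ij
  define y where "y ij = snd (snd (f ij))" for ij
  have F: "\<And>i j. (i, j) \<in> P \<Longrightarrow> finite (F (i, j)) \<and> F (i, j) \<subseteq> B \<and> y (i, j) \<in> C \<and>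
      X i j - ?M i j + gauge_rhs X ?M L i j
       \<approx> (\<Sum>h\<in>F (i, j). scale (c (i, j) h) (\<mu> [h])) + d (y (i, j))"
    using f by (auto simp: F_def c_def y_def case_prod_unfold)
  define E' where "E' = E \<union> (\<Union>(i, j)\<in>P. (\<lambda>h. (i, j, c (i, j) h, h)) ` F (i, j))"
  define L' where "L' i j = (if (i, j) \<in> P then y (i, j) else L i j)" for i j
  let ?M' = "walk_matrix \<mu> E'"
  have finE': "finite E'"
    using E(1) finP F by (auto simp: E'_def)
  have E': "s < t \<and> t - s \<le> Suc n \<and> h \<in> B" if "(s, t, c, h) \<in> E'" for s t c h
    using that E(2) [of s t c h] F by (fastforce simp: E'_def P_def)
  have incE': "increasing_edges E'"
    using E' by (fastforce simp: increasing_edges_def)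
  have new_edge: "t - s = Suc n" if "(s, t, l) \<in> E' - E" for s t l
    using that by (auto simp: E'_def P_def)
  have W: "walks E' i j = walks E i j" if "j - i \<le> n" for i j
  proof -
    have "set p \<subseteq> E" if "walk E' i p j" for p
    proof
      fix e assume e: "e \<in> set p"
      obtain s t l where e': "e = (s, t, l)" by (cases e) auto
      have "i \<le> s" "t \<le> j" using walk_edge_bounds [OF incE' that] e e' by auto
      moreover have "e \<in> E'" using walk_subset that e by blast
      ultimately show "e \<in> E" using new_edge [of s t l] \<open>j - i \<le> n\<close> e'
        by (cases "(s, t, l) \<in> E") auto
    qed
    hence "walk E' i p j \<longleftrightarrow> walk E i p j" for p
      using walk_mono [of E' i p j E] walk_mono [of E i p j E'] walk_subset [of E i p j]
      by (auto simp: E'_def)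
    thus ?thesis by (simp add: walks_def)
  qed
  have M: "?M' i j = ?M i j" if "j - i \<le> n" for i j
    using W [OF that] by (simp add: walk_matrix_def)
  have M_new: "?M' i j = ?M i j + (\<Sum>h\<in>F (i, j). scale (c (i, j) h) (\<mu> [h]))" if ij: "(i, j) \<in> P" for i j
  proof -
    let ?f = "\<lambda>h. [(i, j, c (i, j) h, h)]"
    have "walks E' i j = walks E i j \<union> ?f ` F (i, j)"
    proof (intro equalityI subsetI)
      fix p assume p: "p \<in> walks E' i j"
      hence wp: "walk E' i p j" "p \<noteq> []" by (auto simp: walks_def)
      show "p \<in> walks E i j \<union> ?f ` F (i, j)"
      proof (cases "set p \<subseteq> E")
        case True
        thus ?thesis using wp by (auto simp: walks_def intro: walk_mono)
      next
        case False
        then obtain s t l where e: "(s, t, l) \<in> set p" "(s, t, l) \<notin> E" by auto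
        hence "(s, t, l) \<in> E' - E" using walk_subset [OF wp(1)] by auto
        moreover have "i \<le> s" "t \<le> j" using walk_edge_bounds [OF incE' wp(1) e(1)] by auto
        ultimately have "s = i" "t = j" using new_edge [of s t l] ij by (auto simp: P_def)
        hence "p = [(i, j, l)]" "(i, j, l) \<in> E' - E"
          using walk_long_edge [OF incE' wp(1)] e \<open>(s, t, l) \<in> E' - E\<close> by auto
        thus ?thesis by (auto simp: E'_def)
      qed
    next
      fix p assume "p \<in> walks E i j \<union> ?f ` F (i, j)"
      thus "p \<in> walks E' i j"
        using ij walk_mono [of E i p j E'] walk_subset [of E i p j]
        by (fastforce simp: walks_def E'_def)
    qed
    moreover have "walks E i j \<inter> ?f ` F (i, j) = {}"
      using E(2) ij by (fastforce simp: walks_def P_def)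
    moreover have "finite (F (i, j))" using F [OF ij] by simp
    moreover have "inj_on ?f (F (i, j))" by (auto simp: inj_on_def)
    ultimately show ?thesis
      by (simp add: walk_matrix_def sum.union_disjoint finite_walks [OF incE E(1)] sum.reindex walk_value_def)
  qed
  have P: "(i, j) \<notin> P" if "j - i \<le> n" for i j
    using that by (auto simp: P_def)
  have gauge: "gauge_rhs X ?M' L' i j = gauge_rhs X ?M L i j" if "j - i \<le> Suc n" for i j
    unfolding gauge_rhs_def mm_def map_mat_def L'_def
    by (intro arg_cong2 [where f = "(-)"] sum.cong refl) (use that P M in auto)
  show ?case
  proof (intro exI [of _ E'] exI [of _ L'] conjI allI impI)
    fix i j assume ij: "a \<le> i" "i < j" "j \<le> b" "j - i \<le> Suc n"
    show "d (L' i j) \<approx> X i j - ?M' i j + gauge_rhs X ?M' L' i j"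
    proof (cases "j - i \<le> n")
      case True
      thus ?thesis using dL [of i j] ij gauge [of j i] M [of j i] P by (simp add: L'_def)
    next
      case False
      hence P: "(i, j) \<in> P" using ij by (auto simp: P_def)
      from F [OF this] have "X i j - ?M i j + gauge_rhs X ?M L i j
       - (\<Sum>h\<in>F (i, j). scale (c (i, j) h) (\<mu> [h])) \<approx> d (y (i, j))"
        by (simp add: eqv_def algebra_simps)
      thus ?thesis using P gauge [OF ij(4)] M_new [OF P]
        by (simp add: L'_def eqv_sym algebra_simps)
    qed
  next
    show "L' i j \<in> C" for i j using L F by (auto simp: L'_def)
    show "\<forall>(s, t, c, h) \<in> E'. s < t \<and> t - s \<le> Suc n \<and> h \<in> B" using E' by blast
  qed (rule finE')
qed

text \<open>
  The gauge transformation exists at all positions off the corner. By \<open>d_gauge_rhs\<close> the quadratic term of \<open>X\<close> at the corner is homologous to the one of \<open>M\<close>,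
  which is a boundary because \<open>M\<close> also has a corner entry.
\<close>

theorem massey_trivial_if_massey_system:
  assumes \<mu>: "massey_system B \<mu>"
    and span: "\<And>z. z \<in> augmentation_ideal \<Longrightarrow> d z \<in> N \<Longrightarrow>
      \<exists>u\<in>span ((\<lambda>h. \<mu> [h]) ` B). \<exists>y\<in>C. z \<approx> u + d y"
  shows massey_trivial
  unfolding massey_trivial_def
proof (intro allI impI)
  fix a b X
  assume X: "\<forall>i j. a \<le> i \<longrightarrow> i < j \<longrightarrow> j \<le> b \<longrightarrow> (i, j) \<noteq> (a, b) \<longrightarrow> flat_at X i j"
  show "\<exists>y\<in>C. mc_defect X a b \<approx> d y"
  proof (cases "a < b")
    case False
    hence "mc_defect X a b = 0" by (simp add: mc_defect_def mm_def)
    thus ?thesis using C_zero by (auto intro!: bexI [of _ 0])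
  next
    case True
    hence "b - a - 1 < b - a" by simp
    from exists_gauge [OF \<mu> span _ this, where X = X] X obtain E L where
      E: "finite E" "\<And>s t c h. (s, t, c, h) \<in> E \<Longrightarrow> s < t \<and> h \<in> B" and L: "\<And>i j. L i j \<in> C"
      and dL: "\<And>i j. a \<le> i \<Longrightarrow> i < j \<Longrightarrow> j \<le> b \<Longrightarrow> j - i \<le> b - a - 1 \<Longrightarrow>
       d (L i j) \<approx> X i j - walk_matrix \<mu> E i j + gauge_rhs X (walk_matrix \<mu> E) L i j"
      by fastforce
    have incE: "increasing_edges E"
      using E(2) by (fastforce simp: increasing_edges_def)
    let ?M = "walk_matrix \<mu> E"
    have flatM: "flat_at ?M i j" for i j
      using E by (intro flat_walk_matrix [OF \<mu> incE]) auto
    have XC: "X l h \<in> C \<and> ?M l h \<in> C \<and> L l h \<in> C"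
      if "a \<le> l" "l < h" "h \<le> b" "(l, h) \<noteq> (a, b)" for l h
      using X that flatM [of l h] L by (auto simp: flat_at_def augmentation_ideal_def)
    have "d (gauge_rhs X ?M L a b) \<approx> mc_defect X a b - mc_defect ?M a b"
    proof (rule d_gauge_rhs)
      fix l h assume *: "a \<le> l" "l < h" "h \<le> b" "(l, h) \<noteq> (a, b)"
      show "X l h \<in> C \<and> ?M l h \<in> C \<and> L l h \<in> C" using XC * by blast
      have "h - l \<le> b - a - 1" using * by (cases "l = a") auto
      thus "d (L l h) \<approx> X l h - ?M l h + gauge_rhs X ?M L l h"
        using dL [of l h] * by auto
    qed (use X flatM in auto)
    hence "d (gauge_rhs X ?M L a b - ?M a b) \<approx> mc_defect X a b - mc_defect ?M a b - - mc_defect ?M a b"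
      unfolding d_diff by (intro eqv_diff) (use flatM [of a b] in \<open>auto simp: flat_at_def\<close>)
    hence "mc_defect X a b \<approx> d (gauge_rhs X ?M L a b - ?M a b)"
      by (simp add: eqv_sym)
    moreover have "gauge_rhs X ?M L a b - ?M a b \<in> C"
      unfolding gauge_rhs_def map_mat_def
      by (intro C_diff mm_C sg_C) (use XC flatM [of a b] in \<open>auto simp: flat_at_def augmentation_ideal_def\<close>)
    ultimately show ?thesis by blast
  qed
qed

end

section \<open>Surjections with acyclic kernel\<close>

locale dg_surjection =
  S: dg_subquotient scale mul d sg aug C N + T: dg_subquotient scale' mul' d' sg' aug' C' N'
  for scale :: "'k::field \<Rightarrow> 'x::ab_group_add \<Rightarrow> 'x" and mul d sg aug C N
    and scale' :: "'k \<Rightarrow> 'y::ab_group_add \<Rightarrow> 'y" and mul' d' sg' aug' C' N' +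
  fixes \<pi> :: "'x \<Rightarrow> 'y"
  assumes add: "a \<in> C \<Longrightarrow> b \<in> C \<Longrightarrow> \<pi> (a + b) = \<pi> a + \<pi> b"
    and in_C: "a \<in> C \<Longrightarrow> \<pi> a \<in> C'"
    and in_N: "a \<in> N \<Longrightarrow> \<pi> a \<in> N'"
    and mul: "a \<in> C \<Longrightarrow> b \<in> C \<Longrightarrow> T.eqv (\<pi> (mul a b)) (mul' (\<pi> a) (\<pi> b))"
    and sg: "a \<in> C \<Longrightarrow> \<pi> (sg a) = sg' (\<pi> a)"
    and diff: "a \<in> C \<Longrightarrow> T.eqv (\<pi> (d a)) (d' (\<pi> a))"
    and aug: "a \<in> C \<Longrightarrow> aug' (\<pi> a) = aug a"
    and surj: "e \<in> C' \<Longrightarrow> \<exists>a\<in>C. T.eqv (\<pi> a) e"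
    and kernel_acyclic: "a \<in> C \<Longrightarrow> \<pi> a \<in> N' \<Longrightarrow> d a \<in> N \<Longrightarrow> \<exists>y\<in>C. \<pi> y \<in> N' \<and> S.eqv a (d y)"
begin

lemma zero: "\<pi> 0 = 0"
  using add [of 0 0] S.C_zero by simp

lemma minus: "a \<in> C \<Longrightarrow> \<pi> (- a) = - \<pi> a"
  using add [of a "- a"] S.C_neg by (simp add: zero eq_neg_iff_add_eq_0 add.commute)

lemma minus2: "a \<in> C \<Longrightarrow> b \<in> C \<Longrightarrow> \<pi> (a - b) = \<pi> a - \<pi> b"
  using add [of a "- b"] minus S.C_neg by simp

lemma sum: "(\<And>i. i \<in> A \<Longrightarrow> f i \<in> C) \<Longrightarrow> \<pi> (\<Sum>i\<in>A. f i) = (\<Sum>i\<in>A. \<pi> (f i))"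
  by (induction A rule: infinite_finite_induct) (auto simp: zero add S.C_sum)

lemma respects: "S.eqv a b \<Longrightarrow> b \<in> C \<Longrightarrow> T.eqv (\<pi> a) (\<pi> b)"
  using in_N S.eqv_C minus2 unfolding S.eqv_def T.eqv_def by (metis S.C_add S.N_subset diff_add_cancel subsetD)

lemma mc_defect:
  assumes "\<And>l. i < l \<Longrightarrow> l < j \<Longrightarrow> X i l \<in> C \<and> X l j \<in> C"
    and "\<And>l. i < l \<Longrightarrow> l < j \<Longrightarrow> T.eqv (\<pi> (X i l)) (Y i l) \<and> T.eqv (\<pi> (X l j)) (Y l j)"
    and "\<And>l. i < l \<Longrightarrow> l < j \<Longrightarrow> Y i l \<in> C'"
  shows "T.eqv (\<pi> (S.mc_defect X i j)) (T.mc_defect Y i j)"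
proof -
  have "\<pi> (S.mc_defect X i j) = (\<Sum>l\<in>{i<..<j}. \<pi> (mul (sg (X i l)) (X l j)))"
    unfolding S.mc_defect_def S.mm_def S.map_mat_def
    by (rule sum) (use assms(1) S.C_closed in auto)
  moreover have "T.eqv (\<pi> (mul (sg (X i l)) (X l j))) (mul' (sg' (Y i l)) (Y l j))"
    if "l \<in> {i<..<j}" for l
  proof -
    have l: "i < l" "l < j" using that by auto
    note a = assms(1) [OF l] assms(2) [OF l] assms(3) [OF l]
    have "T.eqv (\<pi> (mul (sg (X i l)) (X l j))) (mul' (\<pi> (sg (X i l))) (\<pi> (X l j)))"
      using a by (intro mul S.sg_C) auto
    also have "T.eqv \<dots> (mul' (sg' (Y i l)) (\<pi> (X l j)))"
      using a in_C by (intro T.eqv_mul_left) (auto simp: sg T.eqv_sg)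
    also have "T.eqv \<dots> (mul' (sg' (Y i l)) (Y l j))"
      using a by (intro T.eqv_mul_right T.sg_C) auto
    finally show ?thesis .
  qed
  ultimately show ?thesis
    unfolding T.mc_defect_def T.mm_def T.map_mat_def by (auto intro!: T.eqv_sum)
qed

lemma mc_defect_C:
  assumes "\<And>l. i < l \<Longrightarrow> l < j \<Longrightarrow> X i l \<in> C \<and> X l j \<in> C"
  shows "S.mc_defect X i j \<in> C"
  unfolding S.mc_defect_def S.map_mat_def
  by (rule S.mm_C) (use assms S.sg_C in auto)

text \<open>
  Any lift of the cycle has its differential in the kernel, and the kernel is acyclic: an
  element of the kernel corrects the lift to a cycle.
\<close>

lemma lift_cycle:
  assumes "z' \<in> C'" "d' z' \<in> N'"
  shows "\<exists>z\<in>C. d z \<in> N \<and> T.eqv (\<pi> z) z'"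
proof -
  obtain a where a: "a \<in> C" "T.eqv (\<pi> a) z'" using surj assms(1) by blast
  have "T.eqv (\<pi> (d a)) (d' (\<pi> a))" using diff a(1) .
  also have "T.eqv \<dots> (d' z')" using T.eqv_d a(2) .
  also have "T.eqv \<dots> 0" using assms(2) by (simp add: T.eqv_0_iff)
  finally have "\<pi> (d a) \<in> N'" by (simp add: T.eqv_0_iff)
  from kernel_acyclic [OF S.d_C [OF a(1)] this] obtain y where y: "y \<in> C" "\<pi> y \<in> N'" "S.eqv (d a) (d y)"
    by (auto simp: S.N_zero)
  have "d (a - y) \<in> N" using y(3) by (simp add: S.eqv_def S.d_diff)
  moreover have "T.eqv (\<pi> a - \<pi> y) (z' - 0)"
    using a y by (intro T.eqv_diff) (auto simp: T.eqv_0_iff)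
  ultimately show ?thesis
    using a y by (intro bexI [of _ "a - y"]) (auto simp: minus2 S.C_diff)
qed

text \<open>
  The entries are lifted by increasing distance from the diagonal. Here the hypothesis on the source
  is used: it provides some entry \<open>u\<close> with the right differential. Its image differs from
  the prescribed entry by a cycle, which lifts to a cycle by \<open>lift_cycle\<close> and corrects \<open>u\<close>.
\<close>

lemma lift_system:
  assumes S: S.massey_trivial
    and Y: "\<And>i j. a \<le> i \<Longrightarrow> i < j \<Longrightarrow> j \<le> b \<Longrightarrow> (i, j) \<noteq> (a, b) \<Longrightarrow> T.flat_at Y i j"
    and n: "n < b - a"
  shows "\<exists>X. \<forall>i j. a \<le> i \<longrightarrow> i < j \<longrightarrow> j \<le> b \<longrightarrow> j - i \<le> n \<longrightarrow> S.flat_at X i j \<and> T.eqv (\<pi> (X i j)) (Y i j)"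
  using n
proof (induction n)
  case (Suc n)
  then obtain X where X: "\<And>i j. a \<le> i \<Longrightarrow> i < j \<Longrightarrow> j \<le> b \<Longrightarrow> j - i \<le> n \<Longrightarrow> S.flat_at X i j \<and> T.eqv (\<pi> (X i j)) (Y i j)"
    by (metis Suc_lessD)
  have ex: "\<exists>x. x \<in> S.augmentation_ideal \<and> S.eqv (d x) (- S.mc_defect X i j) \<and> T.eqv (\<pi> x) (Y i j)"
    if ij: "a \<le> i" "i < j" "j \<le> b" "j - i = Suc n" for i j
  proof -
    have fX: "S.flat_at X l h" "T.eqv (\<pi> (X l h)) (Y l h)" if "i \<le> l" "l < h" "h \<le> j" "(l, h) \<noteq> (i, j)" for l h
    proof -
      have "h - l \<le> n" using that ij(4) by (cases "l = i") auto
      thus "S.flat_at X l h" "T.eqv (\<pi> (X l h)) (Y l h)" using X [of l h] that ij by auto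
    qed
    have fY: "T.flat_at Y l h" if "i \<le> l" "l < h" "h \<le> j" for l h
      by (intro Y) (use that ij Suc.prems in auto)
    have YC: "Y l h \<in> C'" if "i \<le> l" "l < h" "h \<le> j" for l h
      using fY [OF that] by (simp add: T.flat_at_def T.augmentation_ideal_def)
    have XC: "X i l \<in> C \<and> X l j \<in> C" if "i < l" "l < j" for l
      using fX [of i l] fX [of l j] that by (auto simp: S.flat_at_def S.augmentation_ideal_def)
    obtain u where u: "u \<in> C" "S.eqv (S.mc_defect X i j) (d u)"
      using S [unfolded S.massey_trivial_def] fX(1) by blast
    have "T.eqv (d' (\<pi> (- u))) (\<pi> (d (- u)))"
      using diff [of "- u"] u S.C_neg T.eqv_sym by blast
    also have "T.eqv \<dots> (\<pi> (- S.mc_defect X i j))"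
      using u(2) S.eqv_neg S.eqv_sym mc_defect_C [of i j X] XC by (intro respects) (auto simp: S.C_neg)
    also have "\<dots> = - \<pi> (S.mc_defect X i j)"
      using mc_defect_C [of i j X] XC by (intro minus) auto
    also have "T.eqv \<dots> (- T.mc_defect Y i j)"
      by (intro T.eqv_neg mc_defect) (use XC YC fX in auto)
    also have "T.eqv \<dots> (d' (Y i j))"
      using fY [of i j] ij T.eqv_sym by (auto simp: T.flat_at_def)
    finally have "d' (\<pi> (- u) - Y i j) \<in> N'"
      by (simp add: T.eqv_def T.d_diff)
    from lift_cycle [OF _ this] obtain z where z: "z \<in> C" "d z \<in> N" "T.eqv (\<pi> z) (\<pi> (- u) - Y i j)"
      using u YC ij in_C S.C_neg T.C_diff by blast
    have "S.eqv (d (- u - z)) (- S.mc_defect X i j - 0)"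
      unfolding S.d_diff by (intro S.eqv_diff) (use u(2) z(2) S.eqv_neg S.eqv_sym in \<open>auto simp: S.eqv_0_iff\<close>)
    moreover have "T.eqv (\<pi> (- u) - \<pi> z) (\<pi> (- u) - (\<pi> (- u) - Y i j))"
      using z by (intro T.eqv_diff) auto
    hence *: "T.eqv (\<pi> (- u - z)) (Y i j)"
      using u z S.C_neg by (simp add: minus2)
    moreover have "aug (- u - z) = 0"
      using aug [of "- u - z"] u z S.C_diff S.C_neg T.eqv_aug [OF *] fY [of i j] ij
      by (simp add: T.flat_at_def T.augmentation_ideal_def)
    ultimately show ?thesis
      using u z S.C_diff S.C_neg by (intro exI [of _ "- u - z"]) (auto simp: S.augmentation_ideal_def)
  qed
  then obtain x where x: "\<And>i j. a \<le> i \<Longrightarrow> i < j \<Longrightarrow> j \<le> b \<Longrightarrow> j - i = Suc n \<Longrightarrow>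
      x i j \<in> S.augmentation_ideal \<and> S.eqv (d (x i j)) (- S.mc_defect X i j) \<and> T.eqv (\<pi> (x i j)) (Y i j)"
    by metis
  define X' where "X' i j = (if j - i = Suc n then x i j else X i j)" for i j
  have mc: "S.mc_defect X' i j = S.mc_defect X i j" if "j - i \<le> Suc n" for i j
    unfolding S.mc_defect_def S.mm_def S.map_mat_def
    by (intro sum.cong refl) (use that in \<open>auto simp: X'_def\<close>)
  show ?case
  proof (rule exI [of _ X'], intro allI impI)
    fix i j assume ij: "a \<le> i" "i < j" "j \<le> b" "j - i \<le> Suc n"
    show "S.flat_at X' i j \<and> T.eqv (\<pi> (X' i j)) (Y i j)"
      using x [OF ij(1-3)] X [OF ij(1-3)] mc [OF ij(4)] ij(4)
      by (cases "j - i = Suc n") (auto simp: S.flat_at_def X'_def)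
  qed
qed auto

text \<open>
  A system in the source is pushed forward. If \<open>y\<close> lifts an element that bounds the Massey product
  of its image, then the Massey product minus \<open>d y\<close> is a cycle in the acyclic kernel. A system in
  the target is lifted by \<open>lift_system\<close>, and a bounding
  element is mapped down.
\<close>

theorem massey_trivial_iff: "S.massey_trivial \<longleftrightarrow> T.massey_trivial"
proof
  assume T: T.massey_trivial
  show S.massey_trivial
    unfolding S.massey_trivial_def
  proof (intro allI impI)
    fix a b X
    assume X: "\<forall>i j. a \<le> i \<longrightarrow> i < j \<longrightarrow> j \<le> b \<longrightarrow> (i, j) \<noteq> (a, b) \<longrightarrow> S.flat_at X i j"
    let ?Y = "\<lambda>i j. \<pi> (X i j)"
    have XC: "X i j \<in> C" if "a \<le> i" "i < j" "j \<le> b" "(i, j) \<noteq> (a, b)" for i j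
      using X that by (simp add: S.flat_at_def S.augmentation_ideal_def)
    have mc: "T.eqv (\<pi> (S.mc_defect X i j)) (T.mc_defect ?Y i j)" "S.mc_defect X i j \<in> C"
      if "a \<le> i" "i < j" "j \<le> b" for i j
      using that XC in_C by (auto intro!: mc_defect mc_defect_C)
    have "T.flat_at ?Y i j" if ij: "a \<le> i" "i < j" "j \<le> b" "(i, j) \<noteq> (a, b)" for i j
    proof -
      have "T.eqv (d' (?Y i j)) (\<pi> (d (X i j)))"
        using XC [OF ij] diff T.eqv_sym by blast
      also have "T.eqv \<dots> (\<pi> (- S.mc_defect X i j))"
        using X ij mc by (intro respects) (auto simp: S.flat_at_def S.C_neg)
      also have "\<dots> = - \<pi> (S.mc_defect X i j)"
        using mc ij by (intro minus) auto
      also have "T.eqv \<dots> (- T.mc_defect ?Y i j)"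
        using mc ij by (intro T.eqv_neg) auto
      finally show ?thesis
        using X ij in_C aug by (auto simp: T.flat_at_def S.flat_at_def T.augmentation_ideal_def S.augmentation_ideal_def)
    qed
    with T obtain y' where y': "y' \<in> C'" "T.eqv (T.mc_defect ?Y a b) (d' y')"
      unfolding T.massey_trivial_def by blast
    obtain y where y: "y \<in> C" "T.eqv (\<pi> y) y'" using surj y'(1) by blast
    show "\<exists>y\<in>C. S.eqv (S.mc_defect X a b) (d y)"
    proof (cases "a < b")
      case True
      have "T.eqv (\<pi> (S.mc_defect X a b)) (T.mc_defect ?Y a b)"
        using mc True by auto
      also note y'(2)
      also have "T.eqv (d' y') (d' (\<pi> y))" using y T.eqv_d T.eqv_sym by blast
      also have "T.eqv \<dots> (\<pi> (d y))" using y diff T.eqv_sym by blast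
      finally have k: "\<pi> (S.mc_defect X a b - d y) \<in> N'"
        using mc True y S.d_C by (simp add: T.eqv_def minus2)
      have cyc: "d (S.mc_defect X a b - d y) \<in> N"
        using S.d_mc_defect [of a b X] X True by (simp add: S.d_diff)
      have "S.mc_defect X a b - d y \<in> C"
        using mc(2) [of a b] True y by (intro S.C_diff S.d_C) auto
      from kernel_acyclic [OF this k cyc]
      obtain u where u: "u \<in> C" "S.eqv (S.mc_defect X a b - d y) (d u)"
        by blast
      have "S.eqv (S.mc_defect X a b) (d (y + u))"
        using u(2) by (simp add: S.eqv_def S.d_add algebra_simps)
      thus ?thesis using u y S.C_add by blast
    qed (auto simp: S.mc_defect_def S.mm_def intro!: bexI [of _ 0] S.C_zero)
  qed
next
  assume S: S.massey_trivial
  show T.massey_trivial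
    unfolding T.massey_trivial_def
  proof (intro allI impI)
    fix a b Y
    assume Y: "\<forall>i j. a \<le> i \<longrightarrow> i < j \<longrightarrow> j \<le> b \<longrightarrow> (i, j) \<noteq> (a, b) \<longrightarrow> T.flat_at Y i j"
    show "\<exists>y\<in>C'. T.eqv (T.mc_defect Y a b) (d' y)"
    proof (cases "a < b")
      case True
      hence "b - a - 1 < b - a" by simp
      from lift_system [OF S _ this, of Y] Y obtain X where
        X0: "\<And>i j. a \<le> i \<Longrightarrow> i < j \<Longrightarrow> j \<le> b \<Longrightarrow> j - i \<le> b - a - 1 \<Longrightarrow> S.flat_at X i j \<and> T.eqv (\<pi> (X i j)) (Y i j)"
        by blast
      have X: "S.flat_at X i j \<and> T.eqv (\<pi> (X i j)) (Y i j)"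
        if "a \<le> i" "i < j" "j \<le> b" "(i, j) \<noteq> (a, b)" for i j
      proof -
        have "j - i \<le> b - a - 1" using that by (cases "i = a") auto
        thus ?thesis using X0 that by blast
      qed
      hence XC: "X i l \<in> C" if "a \<le> i" "i < l" "l \<le> b" "(i, l) \<noteq> (a, b)" for i l
        using that by (auto simp: S.flat_at_def S.augmentation_ideal_def)
      obtain u where u: "u \<in> C" "S.eqv (S.mc_defect X a b) (d u)"
        using S [unfolded S.massey_trivial_def] X by blast
      have "T.eqv (T.mc_defect Y a b) (\<pi> (S.mc_defect X a b))"
        by (intro T.eqv_sym [OF mc_defect])
          (use X XC Y in \<open>auto simp: T.flat_at_def T.augmentation_ideal_def\<close>)
      also have "T.eqv \<dots> (\<pi> (d u))" using u by (intro respects S.d_C)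
      also have "T.eqv \<dots> (d' (\<pi> u))" using u diff by blast
      finally show ?thesis using u in_C by blast
    qed (auto simp: T.mc_defect_def T.mm_def intro!: bexI [of _ 0] T.C_zero)
  qed
qed

end

section \<open>Presentations of graded algebras and their homology\<close>

text \<open>
  A graded dg algebra \<open>A\<close>, given by records and cosets, as the quotient \<open>C/N\<close>. The projection \<open>comp i\<close>
  gives the component of degree \<open>i\<close> on lifts. The last assumption says that \<open>H\<^sub>0(A)\<close> is the field of
  scalars; this is what makes a cycle in the augmentation ideal homologous to one in positive
  degrees.
\<close>

locale dg_presentation = dg_subquotient scale mul d sg aug C N
  for scale :: "'k::field \<Rightarrow> 'x::ab_group_add \<Rightarrow> 'x" and mul (infixl "\<star>" 70) and d sg aug C N +
  fixes A :: "('k, 'y) dg_algebra" and \<kappa> :: "'x \<Rightarrow> 'y" and comp :: "nat \<Rightarrow> 'x \<Rightarrow> 'x" and r :: nat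
  assumes image: "\<kappa> ` C = carrier A"
    and eq_iff: "a \<in> C \<Longrightarrow> b \<in> C \<Longrightarrow> \<kappa> a = \<kappa> b \<longleftrightarrow> a - b \<in> N"
    and add: "a \<in> C \<Longrightarrow> b \<in> C \<Longrightarrow> \<kappa> (a + b) = \<kappa> a \<oplus>\<^bsub>A\<^esub> \<kappa> b"
    and zero: "\<kappa> 0 = \<zero>\<^bsub>A\<^esub>"
    and mult: "a \<in> C \<Longrightarrow> b \<in> C \<Longrightarrow> \<kappa> (a \<star> b) = \<kappa> a \<otimes>\<^bsub>A\<^esub> \<kappa> b"
    and smult: "a \<in> C \<Longrightarrow> \<kappa> (scale c a) = c \<odot>\<^bsub>A\<^esub> \<kappa> a"
    and diff: "a \<in> C \<Longrightarrow> \<kappa> (d a) = differential A (\<kappa> a)"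
    and hcomp: "hcomp A i = \<kappa> ` {a \<in> C. comp i a = a}"
    and comp_add: "comp i (a + b) = comp i a + comp i b"
    and comp_scale: "comp i (scale c a) = scale c (comp i a)"
    and comp_C: "a \<in> C \<Longrightarrow> comp i a \<in> C"
    and comp_N: "a \<in> N \<Longrightarrow> comp i a \<in> N"
    and comp_comp: "comp i (comp j a) = (if i = j then comp i a else 0)"
    and comp_sum: "a \<in> C \<Longrightarrow> a = (\<Sum>i\<le>r. comp i a)"
    and comp_d: "a \<in> C \<Longrightarrow> comp i (d a) = d (comp (Suc i) a)"
    and d_comp_0: "a \<in> C \<Longrightarrow> d (comp 0 a) = 0"
    and sg_comp: "sg (comp i a) = (if even i then comp i a else - comp i a)"
    and comp_mul: "comp (i + j) (comp i a \<star> comp j b) = comp i a \<star> comp j b"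
    and aug_comp: "i \<ge> 1 \<Longrightarrow> aug (comp i a) = 0"
    and degree_0_acyclic: "a \<in> C \<Longrightarrow> comp 0 a = a \<Longrightarrow> aug a = 0 \<Longrightarrow> \<exists>y\<in>C. a \<approx> d y"
begin

lemma additive_comp: "Modules.additive (comp i)"
  by (simp add: Modules.additive_def comp_add)

lemmas comp_zero [simp] = additive.zero [OF additive_comp]
  and comp_minus [simp] = additive.minus [OF additive_comp]
lemmas comp_diff = additive.diff [OF additive_comp]
  and comp_sum_distrib = additive.sum [OF additive_comp]

lemma carrierE:
  assumes "x \<in> carrier A" obtains a where "a \<in> C" "x = \<kappa> a"
  using assms image by blast

lemma abelian_group_A: "abelian_group A"
proof (rule abelian_groupI)
  fix x y z assume "x \<in> carrier A" "y \<in> carrier A" "z \<in> carrier A"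
  then obtain a b c where abc: "a \<in> C" "x = \<kappa> a" "b \<in> C" "y = \<kappa> b" "c \<in> C" "z = \<kappa> c"
    by (metis carrierE)
  show "(x \<oplus>\<^bsub>A\<^esub> y) \<oplus>\<^bsub>A\<^esub> z = x \<oplus>\<^bsub>A\<^esub> (y \<oplus>\<^bsub>A\<^esub> z)"
    using abc by (simp add: add [symmetric] C_add add.assoc)
next
  fix x y assume "x \<in> carrier A" "y \<in> carrier A"
  then obtain a b where abc: "a \<in> C" "x = \<kappa> a" "b \<in> C" "y = \<kappa> b"
    by (metis carrierE)
  show "x \<oplus>\<^bsub>A\<^esub> y \<in> carrier A" "x \<oplus>\<^bsub>A\<^esub> y = y \<oplus>\<^bsub>A\<^esub> x"
    using abc image by (auto simp: add [symmetric] C_add add.commute)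
next
  fix x assume "x \<in> carrier A"
  then obtain a where a: "a \<in> C" "x = \<kappa> a" by (metis carrierE)
  show "\<zero>\<^bsub>A\<^esub> \<oplus>\<^bsub>A\<^esub> x = x"
    using a by (simp add: zero [symmetric] add [symmetric] C_zero)
  show "\<exists>y\<in>carrier A. y \<oplus>\<^bsub>A\<^esub> x = \<zero>\<^bsub>A\<^esub>"
    using a image by (intro bexI [of _ "\<kappa> (- a)"]) (auto simp: zero [symmetric] add [symmetric] C_neg)
next
  show "\<zero>\<^bsub>A\<^esub> \<in> carrier A" using image C_zero zero by force
qed

lemma minus: "a \<in> C \<Longrightarrow> \<kappa> (- a) = \<ominus>\<^bsub>A\<^esub> \<kappa> a"
  using image C_neg
  by (intro abelian_group.minus_equality [OF abelian_group_A, symmetric])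
    (auto simp: zero [symmetric] add [symmetric])

lemma \<kappa>_sum:
  assumes "finite F" "\<And>i. i \<in> F \<Longrightarrow> f i \<in> C"
  shows "\<kappa> (\<Sum>i\<in>F. f i) = (\<Oplus>\<^bsub>A\<^esub>i\<in>F. \<kappa> (f i))"
proof -
  interpret A: abelian_group A by (rule abelian_group_A)
  show ?thesis using assms
  proof (induction F rule: finite_induct)
    case empty
    show ?case by (simp add: zero)
  next
    case (insert i F)
    have "(\<lambda>i. \<kappa> (f i)) \<in> F \<rightarrow> carrier A" "\<kappa> (f i) \<in> carrier A"
      using insert.prems image by auto
    with insert show ?case by (simp add: add C_sum)
  qed
qed

definition hcycles :: "nat \<Rightarrow> 'x set" where
  "hcycles i = {a \<in> C. comp i a = a \<and> d a \<in> N}"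

definition hclass :: "nat \<Rightarrow> 'x \<Rightarrow> 'y set" where
  "hclass i a = boundaries A i +>\<^bsub>A\<^esub> \<kappa> a"

lemma subspace_hcycles: "subspace (hcycles i)"
  unfolding subspace_def hcycles_def
  by (auto simp: C_closed comp_add comp_scale d_add d_scale N_zero N_add N_scale)

lemma hcycles_C: "a \<in> hcycles i \<Longrightarrow> a \<in> C"
  by (simp add: hcycles_def)

lemma cycles_eq: "cycles A i = \<kappa> ` hcycles i"
proof -
  have "differential A (\<kappa> a) = \<zero>\<^bsub>A\<^esub> \<longleftrightarrow> d a \<in> N" if "a \<in> C" for a
    using eq_iff [of "d a" 0] that by (simp add: diff zero C_closed)
  thus ?thesis by (auto simp: cycles_def hcycles_def hcomp)
qed

lemma hclass_eq: "a \<in> C \<Longrightarrow> hclass i a = (\<lambda>y. \<kappa> (d y + a)) ` {y \<in> C. comp (Suc i) y = y}"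
  unfolding hclass_def a_r_coset_def' boundaries_def hcomp
  by (auto simp: image_iff diff [symmetric] add [symmetric] C_closed)

lemma hclass_self: "a \<in> C \<Longrightarrow> \<kappa> a \<in> hclass i a"
  unfolding hclass_eq by (intro image_eqI [of _ _ 0]) (auto simp: C_zero)

lemma hclass_eqI:
  assumes "a \<in> C" "b \<in> C" "y \<in> C" "comp (Suc i) y = y" "a \<approx> b + d y"
  shows "hclass i a = hclass i b"
proof -
  have *: "hclass i a \<subseteq> hclass i b"
    if ab: "a \<in> C" "b \<in> C" "y \<in> C" "comp (Suc i) y = y" "a \<approx> b + d y" for a b y
  proof
    fix x assume "x \<in> hclass i a"
    then obtain y' where y': "y' \<in> C" "comp (Suc i) y' = y'" "x = \<kappa> (d y' + a)"
      by (auto simp: hclass_eq ab)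
    have "d y' + a - (d (y' + y) + b) \<in> N"
      using ab(5) by (simp add: eqv_def d_add algebra_simps)
    hence "x = \<kappa> (d (y' + y) + b)"
      using ab y' eq_iff C_closed by simp
    thus "x \<in> hclass i b" using ab y' by (auto simp: hclass_eq comp_add C_add)
  qed
  have "b \<approx> a + d (- y)"
    using eqv_sym [OF assms(5)] by (simp add: eqv_def algebra_simps)
  thus ?thesis
    using * [OF assms] * [of b a "- y"] assms C_neg by auto
qed

lemma hclass_eq_iff:
  assumes "a \<in> hcycles i" "b \<in> hcycles i"
  shows "hclass i a = hclass i b \<longleftrightarrow> (\<exists>y\<in>C. a \<approx> b + d y)"
proof
  assume "hclass i a = hclass i b"
  hence "\<kappa> a \<in> hclass i b" using hclass_self assms hcycles_C by metis
  then obtain y where y: "y \<in> C" "\<kappa> a = \<kappa> (d y + b)"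
    using assms hcycles_C by (auto simp: hclass_eq)
  hence "a \<approx> b + d y"
    using eq_iff [of a "d y + b"] assms hcycles_C C_closed by (simp add: eqv_def add.commute)
  thus "\<exists>y\<in>C. a \<approx> b + d y" using y by blast
next
  assume "\<exists>y\<in>C. a \<approx> b + d y"
  then obtain y where y: "y \<in> C" "a - (b + d y) \<in> N" by (auto simp: eqv_def)
  have "comp i (a - (b + d y)) = a - (b + d (comp (Suc i) y))"
    using assms y by (simp add: comp_diff comp_add comp_d hcycles_def)
  hence "a \<approx> b + d (comp (Suc i) y)"
    using comp_N [OF y(2), of i] by (simp add: eqv_def)
  thus "hclass i a = hclass i b"
    using assms y by (intro hclass_eqI [of _ _ "comp (Suc i) y"]) (auto simp: hcycles_def comp_C comp_comp)
qed

lemma homology_carrier: "carrier (homology A i) = hclass i ` hcycles i"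
  by (simp add: homology_def cycles_eq image_image hclass_def)

lemma homology_zero: "\<zero>\<^bsub>homology A i\<^esub> = hclass i 0"
proof -
  have "boundaries A i = hclass i 0"
    by (auto simp: hclass_eq C_zero boundaries_def hcomp diff image_image intro!: image_eqI)
  thus ?thesis by (simp add: homology_def)
qed

lemma homology_add:
  assumes "a \<in> C" "b \<in> C"
  shows "hclass i a \<oplus>\<^bsub>homology A i\<^esub> hclass i b = hclass i (a + b)"
proof -
  have "hclass i a <+>\<^bsub>A\<^esub> hclass i b = hclass i (a + b)"
  proof (intro equalityI subsetI)
    fix x assume "x \<in> hclass i a <+>\<^bsub>A\<^esub> hclass i b"
    then obtain y z where yz: "y \<in> C" "comp (Suc i) y = y" "z \<in> C" "comp (Suc i) z = z"
      "x = \<kappa> (d y + a) \<oplus>\<^bsub>A\<^esub> \<kappa> (d z + b)"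
      using assms by (auto simp: set_add_def' hclass_eq)
    hence "x = \<kappa> (d (y + z) + (a + b))"
      using assms by (simp add: add [symmetric] C_closed d_add algebra_simps)
    thus "x \<in> hclass i (a + b)"
      using yz assms by (auto simp: hclass_eq C_add comp_add)
  next
    fix x assume "x \<in> hclass i (a + b)"
    then obtain y where y: "y \<in> C" "comp (Suc i) y = y" "x = \<kappa> (d y + (a + b))"
      using assms by (auto simp: hclass_eq C_add)
    hence "x = \<kappa> (d y + a) \<oplus>\<^bsub>A\<^esub> \<kappa> b"
      using assms by (simp add: add [symmetric] C_closed add.assoc)
    moreover have "\<kappa> (d y + a) \<in> hclass i a" using y assms by (auto simp: hclass_eq)
    ultimately show "x \<in> hclass i a <+>\<^bsub>A\<^esub> hclass i b"
      using hclass_self [OF assms(2)] by (auto simp: set_add_def')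
  qed
  thus ?thesis by (simp add: homology_def)
qed

lemma homology_smult:
  assumes "a \<in> C"
  shows "c \<odot>\<^bsub>homology A i\<^esub> hclass i a = hclass i (scale c a)"
proof -
  have "boundaries A i +>\<^bsub>A\<^esub> (c \<odot>\<^bsub>A\<^esub> z) = hclass i (scale c a)" if z: "z \<in> hclass i a" for z
  proof -
    obtain y where y: "y \<in> C" "comp (Suc i) y = y" "z = \<kappa> (d y + a)"
      using z assms by (auto simp: hclass_eq)
    have "boundaries A i +>\<^bsub>A\<^esub> (c \<odot>\<^bsub>A\<^esub> z) = hclass i (scale c (d y + a))"
      using y assms by (simp add: hclass_def smult C_closed)
    also have "\<dots> = hclass i (scale c a)"
      by (rule hclass_eqI [of _ _ "scale c y"])
        (use y assms in \<open>auto simp: C_closed comp_scale d_scale scale_right_distrib add.commute\<close>)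
    finally show ?thesis .
  qed
  thus ?thesis using hclass_self [OF assms] by (auto simp: homology_def)
qed

lemma vectorspace_homology: "vectorspace class_ring (homology A i)"
proof -
  let ?H = "homology A i"
  note sub = subspace_hcycles [of i]
  have cl: "a \<in> hcycles i \<Longrightarrow> b \<in> hcycles i \<Longrightarrow> a + b \<in> hcycles i"
    "a \<in> hcycles i \<Longrightarrow> scale c a \<in> hcycles i" "a \<in> hcycles i \<Longrightarrow> - a \<in> hcycles i"
    "0 \<in> hcycles i" for a b c
    using subspace_add [OF sub] subspace_scale [OF sub] subspace_neg [OF sub] subspace_0 [OF sub] by blast+
  have "abelian_group ?H"
  proof (rule abelian_groupI)
    fix x assume "x \<in> carrier ?H"
    then obtain a where a: "a \<in> hcycles i" "x = hclass i a" by (auto simp: homology_carrier)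
    show "\<exists>y\<in>carrier ?H. y \<oplus>\<^bsub>?H\<^esub> x = \<zero>\<^bsub>?H\<^esub>"
      using a cl by (intro bexI [of _ "hclass i (- a)"])
        (auto simp: homology_carrier homology_zero homology_add hcycles_C C_neg)
  qed (auto simp: homology_carrier homology_zero homology_add hcycles_C C_closed algebra_simps
      intro!: imageI cl)
  hence "module class_ring ?H"
    by (intro moduleI class_cring.is_cring)
      (auto simp: homology_carrier homology_add homology_smult hcycles_C C_closed algebra_simps
        scale_right_distrib scale_left_distrib intro!: imageI cl)
  thus ?thesis
    by (simp add: vectorspace_def class_field)
qed

lemma homology_lincomb:
  assumes "finite F" "\<And>h. h \<in> F \<Longrightarrow> g h \<in> hcycles i"
  shows "(\<Oplus>\<^bsub>homology A i\<^esub>h\<in>F. c h \<odot>\<^bsub>homology A i\<^esub> hclass i (g h)) = hclass i (\<Sum>h\<in>F. scale (c h) (g h))"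
  using assms
proof (induction F rule: finite_induct)
  interpret H: vectorspace class_ring "homology A i" by (rule vectorspace_homology)
  case empty
  show ?case by (simp add: homology_zero)
next
  interpret H: vectorspace class_ring "homology A i" by (rule vectorspace_homology)
  case (insert h F)
  have car: "c l \<odot>\<^bsub>homology A i\<^esub> hclass i (g l) \<in> carrier (homology A i)" if "l \<in> insert h F" for l
    using insert.prems that by (intro H.smult_closed) (auto simp: homology_carrier)
  have "(\<Oplus>\<^bsub>homology A i\<^esub>h\<in>insert h F. c h \<odot>\<^bsub>homology A i\<^esub> hclass i (g h)) =
      c h \<odot>\<^bsub>homology A i\<^esub> hclass i (g h) \<oplus>\<^bsub>homology A i\<^esub> hclass i (\<Sum>h\<in>F. scale (c h) (g h))"
    using insert car by (subst H.finsum_insert) auto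
  also have "\<dots> = hclass i (\<Sum>h\<in>insert h F. scale (c h) (g h))"
  proof -
    have "(\<Sum>h\<in>F. scale (c h) (g h)) \<in> C"
      by (intro C_sum C_scale hcycles_C [OF insert.prems]) simp
    moreover have "g h \<in> C"
      by (rule hcycles_C [OF insert.prems]) simp
    ultimately show ?thesis using insert.hyps by (simp add: homology_smult homology_add C_scale)
  qed
  finally show ?case .
qed

text \<open>
  Linear combinations over a finite subset, with its vectors as their own indices. In this form a basis
  of homology can be compared with sets of cycles.
\<close>

lemma basis_iff:
  "vectorspace.basis class_ring (homology A i) X \<longleftrightarrow>
    X \<subseteq> carrier (homology A i) \<and>
    (\<forall>h\<in>carrier (homology A i). \<exists>F c. finite F \<and> F \<subseteq> X \<and> h = (\<Oplus>\<^bsub>homology A i\<^esub>v\<in>F. c v \<odot>\<^bsub>homology A i\<^esub> v)) \<and>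
    (\<forall>F c. finite F \<longrightarrow> F \<subseteq> X \<longrightarrow> (\<Oplus>\<^bsub>homology A i\<^esub>v\<in>F. c v \<odot>\<^bsub>homology A i\<^esub> v) = \<zero>\<^bsub>homology A i\<^esub> \<longrightarrow>
      (\<forall>v\<in>F. c v = 0))"
proof -
  interpret H: vectorspace class_ring "homology A i" by (rule vectorspace_homology)
  have dep: "H.lin_dep X \<longleftrightarrow> (\<exists>F c v. finite F \<and> F \<subseteq> X \<and>
      (\<Oplus>\<^bsub>homology A i\<^esub>v\<in>F. c v \<odot>\<^bsub>homology A i\<^esub> v) = \<zero>\<^bsub>homology A i\<^esub> \<and> v \<in> F \<and> c v \<noteq> 0)"
    by (simp add: H.lin_dep_def H.lincomb_def)
  have span: "h \<in> H.span X \<longleftrightarrow> (\<exists>F c. finite F \<and> F \<subseteq> X \<and>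
      h = (\<Oplus>\<^bsub>homology A i\<^esub>v\<in>F. c v \<odot>\<^bsub>homology A i\<^esub> v))" for h
    by (auto simp: H.span_def H.lincomb_def)
  have sub: "X \<subseteq> carrier (homology A i) \<Longrightarrow> H.span X \<subseteq> carrier (homology A i)"
    by (rule H.span_is_subset2)
  hence eq: "X \<subseteq> carrier (homology A i) \<Longrightarrow>
      H.span X = carrier (homology A i) \<longleftrightarrow> (\<forall>h\<in>carrier (homology A i). h \<in> H.span X)"
    by blast
  have indpt: "\<not> H.lin_dep X \<longleftrightarrow> (\<forall>F c. finite F \<longrightarrow> F \<subseteq> X \<longrightarrow>
      (\<Oplus>\<^bsub>homology A i\<^esub>v\<in>F. c v \<odot>\<^bsub>homology A i\<^esub> v) = \<zero>\<^bsub>homology A i\<^esub> \<longrightarrow> (\<forall>v\<in>F. c v = 0))"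
    unfolding dep by fast
  have gen: "(\<forall>h\<in>carrier (homology A i). h \<in> H.span X) \<longleftrightarrow>
      (\<forall>h\<in>carrier (homology A i). \<exists>F c. finite F \<and> F \<subseteq> X \<and>
        h = (\<Oplus>\<^bsub>homology A i\<^esub>v\<in>F. c v \<odot>\<^bsub>homology A i\<^esub> v))"
    by (intro ball_cong refl span)
  show ?thesis
    unfolding H.basis_def indpt gen [symmetric]
    by (cases "X \<subseteq> carrier (homology A i)") (simp_all only: eq simp_thms conj_commute)
qed

end

section \<open>Vanishing from a trivial Massey operation\<close>

context dg_presentation
begin

text \<open>
  The operation \<open>bar\<close> only inspects whether its argument is homogeneous of some even degree. The
  zero element is homogeneous of every degree, so for odd \<open>i\<close> the case that \<open>\<kappa> a = 0\<close> needs
  attention; there the sign does not matter.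
\<close>

lemma bar_lift:
  assumes "a \<in> C" "comp i a = a"
  shows "bar A (\<kappa> a) = \<kappa> (- sg a)"
proof (cases "even i")
  case True
  hence "sg a = a" using sg_comp [of i a] assms by simp
  moreover have "\<exists>i. even i \<and> \<kappa> a \<in> hcomp A i" using True assms hcomp by blast
  ultimately show ?thesis using assms minus by (simp add: bar_def)
next
  case odd: False
  hence sg: "- sg a = a" using sg_comp [of i a] assms by simp
  show ?thesis
  proof (cases "\<exists>j. even j \<and> \<kappa> a \<in> hcomp A j")
    case True
    then obtain j b where b: "even j" "b \<in> C" "comp j b = b" "\<kappa> a = \<kappa> b"
      by (auto simp: hcomp)
    have "i \<noteq> j" using odd b(1) by blast
    hence "comp i (a - b) = a"
      using assms b comp_comp [of i j b] by (simp add: comp_diff)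
    hence "a \<in> N" using comp_N [of "a - b" i] eq_iff assms b by simp
    hence z: "\<kappa> a = \<kappa> 0" using eq_iff [of a 0] assms C_zero by simp
    have "\<ominus>\<^bsub>A\<^esub> \<kappa> 0 = \<kappa> 0" using minus [OF C_zero] by simp
    thus ?thesis using sg z by (simp add: bar_def)
  next
    case False
    thus ?thesis using sg by (auto simp: bar_def)
  qed
qed

lemma massey_sum_lift:
  assumes f: "\<And>u. u \<in> lists B - {[]} \<Longrightarrow> f u \<in> C \<and> (\<exists>i. comp i (f u) = f u)"
    and w: "w \<in> lists B - {[]}"
  shows "(\<Oplus>\<^bsub>A\<^esub>j\<in>{1..<length w}. bar A (\<kappa> (f (take j w))) \<otimes>\<^bsub>A\<^esub> \<kappa> (f (drop j w))) =
    \<kappa> (- (\<Sum>j\<in>{1..<length w}. sg (f (take j w)) \<star> f (drop j w)))"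
proof -
  interpret A: abelian_group A by (rule abelian_group_A)
  have sub: "take j w \<in> lists B - {[]}" "drop j w \<in> lists B - {[]}" if "j \<in> {1..<length w}" for j
    using that w by (auto dest: in_set_takeD in_set_dropD simp: in_lists_conv_set)
  have fC: "f (take j w) \<in> C" "f (drop j w) \<in> C" if "j \<in> {1..<length w}" for j
    using f sub [OF that] by blast+
  have *: "bar A (\<kappa> (f (take j w))) \<otimes>\<^bsub>A\<^esub> \<kappa> (f (drop j w)) = \<kappa> (- (sg (f (take j w)) \<star> f (drop j w)))"
    if j: "j \<in> {1..<length w}" for j
  proof -
    obtain i where "comp i (f (take j w)) = f (take j w)" using f sub(1) [OF j] by blast
    hence "bar A (\<kappa> (f (take j w))) = \<kappa> (- sg (f (take j w)))"
      using fC(1) [OF j] by (intro bar_lift)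
    thus ?thesis using fC [OF j] mult [of "- sg (f (take j w))" "f (drop j w)"] by (simp add: C_closed)
  qed
  have cl: "- (sg (f (take j w)) \<star> f (drop j w)) \<in> C" if "j \<in> {1..<length w}" for j
    using fC [OF that] by (simp add: C_closed)
  have "(\<Oplus>\<^bsub>A\<^esub>j\<in>{1..<length w}. bar A (\<kappa> (f (take j w))) \<otimes>\<^bsub>A\<^esub> \<kappa> (f (drop j w))) =
      (\<Oplus>\<^bsub>A\<^esub>j\<in>{1..<length w}. \<kappa> (- (sg (f (take j w)) \<star> f (drop j w))))"
    by (rule A.finsum_cong') (use * cl image in auto)
  also have "\<dots> = \<kappa> (\<Sum>j\<in>{1..<length w}. - (sg (f (take j w)) \<star> f (drop j w)))"
    using cl by (subst \<kappa>_sum) auto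
  finally show ?thesis by (simp add: sum_negf)
qed

text \<open>
  The ring of noncommutative power series has no zero divisors. By induction on the length of
  \<open>u\<close>, all terms of the square at the word \<open>u @ u\<close> vanish except for \<open>s u * s u\<close>, because
  in every other cut one of the two pieces is shorter than \<open>u\<close>.
\<close>

lemma convolution_square_eq_0:
  fixes s :: "'h list \<Rightarrow> 'k"
  assumes "\<And>w. w \<in> lists B \<Longrightarrow> (\<Sum>j\<in>{1..<length w}. s (take j w) * s (drop j w)) = 0"
    and "w \<in> lists B" "w \<noteq> []"
  shows "s w = 0"
  using assms(2, 3)
proof (induction w rule: length_induct)
  case (1 u)
  let ?w = "u @ u"
  have IH: "s v = 0" if "length v < length u" "v \<in> lists B" "v \<noteq> []" for v
    using 1 that by blast
  have mem: "take j ?w \<in> lists B" "drop j ?w \<in> lists B" for j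
    using 1 by (auto simp: in_lists_conv_set dest: in_set_takeD in_set_dropD)
  have "s (take j ?w) * s (drop j ?w) = (if j = length u then s u * s u else 0)"
    if "j \<in> {1..<length ?w}" for j
  proof -
    consider "j < length u" | "j = length u" | "j > length u" by linarith
    thus ?thesis
    proof cases
      case 1
      hence "s (take j ?w) = 0" using that mem by (intro IH) auto
      thus ?thesis using 1 by simp
    next
      case 3
      hence "s (drop j ?w) = 0" using that mem by (intro IH) (auto simp del: drop_append)
      thus ?thesis using 3 by simp
    qed auto
  qed
  hence "(\<Sum>j\<in>{1..<length ?w}. s (take j ?w) * s (drop j ?w)) =
      (\<Sum>j\<in>{1..<length ?w}. if j = length u then s u * s u else 0)"
    by (rule sum.cong [OF refl])
  also have "\<dots> = s u * s u" using 1 by (simp add: Suc_le_eq)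
  finally show ?case using assms(1) [of ?w] 1 by simp
qed

text \<open>
  The values of the operation need not have the degree that one expects, so they may have a
  constant term. The function \<open>s\<close> of constant terms satisfies \<open>convolution_square_eq_0\<close>,
  since the augmentation is multiplicative and kills boundaries. Lifts of the values therefore form a
  Massey system, and their values on single letters generate homology in positive degrees.
\<close>

theorem massey_trivial_if_trivial_massey_operation:
  assumes "admits_trivial_massey_operation A"
  shows massey_trivial
proof -
  from assms obtain B \<mu> where basis: "homogeneous_homology_basis A B"
    and tmo: "trivial_massey_operation A B \<mu>"
    unfolding admits_trivial_massey_operation_def by blast
  have "\<forall>w\<in>lists B - {[]}. \<exists>a. a \<in> C \<and> \<kappa> a = \<mu> w \<and> (\<exists>i. comp i a = a)"
  proof
    fix w assume "w \<in> lists B - {[]}"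
    then obtain i where "\<mu> w \<in> hcomp A i"
      using tmo unfolding trivial_massey_operation_def by blast
    thus "\<exists>a. a \<in> C \<and> \<kappa> a = \<mu> w \<and> (\<exists>i. comp i a = a)"
      by (auto simp: hcomp)
  qed
  then obtain f where f: "\<And>w. w \<in> lists B - {[]} \<Longrightarrow> f w \<in> C \<and> \<kappa> (f w) = \<mu> w \<and> (\<exists>i. comp i (f w) = f w)"
    by metis
  let ?S = "\<lambda>w. \<Sum>j\<in>{1..<length w}. sg (f (take j w)) \<star> f (drop j w)"
  have sub: "take j w \<in> lists B - {[]}" "drop j w \<in> lists B - {[]}"
    if "j \<in> {1..<length w}" "w \<in> lists B" for j w
    using that by (auto dest: in_set_takeD in_set_dropD simp: in_lists_conv_set)
  have SC: "- ?S w \<in> C" if "w \<in> lists B" for w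
    using f sub [OF _ that] by (intro C_neg C_sum mul_C sg_C) auto
  have df: "d (f w) \<approx> - ?S w" if w: "w \<in> lists B - {[]}" for w
  proof -
    interpret A: abelian_group A by (rule abelian_group_A)
    have "\<kappa> (d (f w)) = differential A (\<mu> w)" using f [OF w] diff by metis
    also have "\<dots> = (\<Oplus>\<^bsub>A\<^esub>j\<in>{1..<length w}. bar A (\<mu> (take j w)) \<otimes>\<^bsub>A\<^esub> \<mu> (drop j w))"
      using tmo w unfolding trivial_massey_operation_def by blast
    also have "\<dots> = (\<Oplus>\<^bsub>A\<^esub>j\<in>{1..<length w}. bar A (\<kappa> (f (take j w))) \<otimes>\<^bsub>A\<^esub> \<kappa> (f (drop j w)))"
    proof (rule A.finsum_cong' [OF refl])
      fix j assume j: "j \<in> {1..<length w}"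
      hence *: "take j w \<in> lists B - {[]}" "drop j w \<in> lists B - {[]}" using sub w by auto
      show "bar A (\<mu> (take j w)) \<otimes>\<^bsub>A\<^esub> \<mu> (drop j w) =
          bar A (\<kappa> (f (take j w))) \<otimes>\<^bsub>A\<^esub> \<kappa> (f (drop j w))"
        using f [OF *(1)] f [OF *(2)] by simp
    next
      show "(\<lambda>j. bar A (\<kappa> (f (take j w))) \<otimes>\<^bsub>A\<^esub> \<kappa> (f (drop j w))) \<in> {1..<length w} \<rightarrow> carrier A"
      proof
        fix j assume j: "j \<in> {1..<length w}"
        hence *: "take j w \<in> lists B - {[]}" "drop j w \<in> lists B - {[]}" using sub w by auto
        obtain i where "comp i (f (take j w)) = f (take j w)" using f *(1) by blast
        hence "bar A (\<kappa> (f (take j w))) = \<kappa> (- sg (f (take j w)))" using f [OF *(1)] by (intro bar_lift) auto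
        moreover have "- sg (f (take j w)) \<in> C" "f (drop j w) \<in> C" using f * C_neg sg_C by auto
        ultimately show "bar A (\<kappa> (f (take j w))) \<otimes>\<^bsub>A\<^esub> \<kappa> (f (drop j w)) \<in> carrier A"
          using image mult mul_C by (metis image_eqI)
      qed
    qed
    also have "\<dots> = \<kappa> (- ?S w)" 
      by (rule massey_sum_lift [where f = f and B = B, OF _ w]) (use f in blast)
    finally show ?thesis
      using eq_iff [of "d (f w)" "- ?S w"] f [OF w] SC w by (simp add: eqv_def d_C)
  qed
  have aug0: "aug (f w) = 0" if "w \<in> lists B" "w \<noteq> []" for w
  proof (rule convolution_square_eq_0 [where s = "\<lambda>w. aug (f w)", OF _ that])
    fix w assume w: "w \<in> lists B"
    show "(\<Sum>j\<in>{1..<length w}. aug (f (take j w)) * aug (f (drop j w))) = 0"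
    proof (cases "w = []")
      case False
      hence "aug (- ?S w) = 0" using eqv_aug [OF df [of w]] w aug_d by auto
      thus ?thesis by (simp add: aug_sum aug_mul aug_sg)
    qed auto
  qed
  have \<mu>: "massey_system B f"
    unfolding massey_system_def using f df aug0 by (auto simp: augmentation_ideal_def)
  show ?thesis
  proof (rule massey_trivial_if_massey_system [OF \<mu>])
    fix z assume z: "z \<in> augmentation_ideal" "d z \<in> N"
    define G where "G = {z \<in> C. \<exists>u\<in>span ((\<lambda>h. f [h]) ` B). \<exists>y\<in>C. z \<approx> u + d y}"
    have GI: "a \<in> G" if "a \<in> C" "u \<in> span ((\<lambda>h. f [h]) ` B)" "y \<in> C" "a \<approx> u + d y" for a u y
      using that unfolding G_def by blast
    have G_add: "a + b \<in> G" if ab: "a \<in> G" "b \<in> G" for a b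
    proof -
      obtain u y u' y' where "u \<in> span ((\<lambda>h. f [h]) ` B)" "y \<in> C" "a \<approx> u + d y"
        "u' \<in> span ((\<lambda>h. f [h]) ` B)" "y' \<in> C" "b \<approx> u' + d y'" "a \<in> C" "b \<in> C"
        using ab unfolding G_def by blast
      moreover from this have "a + b \<approx> (u + u') + d (y + y')"
        using eqv_add [of a "u + d y" b "u' + d y'"] by (simp add: d_add algebra_simps)
      ultimately show ?thesis
        using C_add span_add by (intro GI [of "a + b" "u + u'" "y + y'"]) auto
    qed
    have G0: "0 \<in> G" by (auto simp: G_def C_zero span_zero intro!: bexI [of _ 0])
    have zC: "z \<in> C" "aug z = 0" using z by (auto simp: augmentation_ideal_def)
    have "comp i z \<in> G" for i
    proof (cases "i = 0")
      case True
      have "aug z = (\<Sum>i\<le>r. aug (comp i z))" using comp_sum [OF zC(1)] aug_sum by metis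
      also have "\<dots> = (\<Sum>i\<le>r. if i = 0 then aug (comp 0 z) else 0)"
        by (intro sum.cong) (auto simp: aug_comp)
      also have "\<dots> = aug (comp 0 z)" by simp
      finally have "aug (comp 0 z) = 0" using zC by simp
      then obtain y where "y \<in> C" "comp 0 z \<approx> d y"
        using degree_0_acyclic [of "comp 0 z"] zC comp_C comp_comp by auto
      thus ?thesis using True zC comp_C span_zero by (intro GI [of _ 0 y]) auto
    next
      case False
      have "d (comp i z) \<in> N" using comp_N [OF z(2), of "i - 1"] comp_d [OF zC(1), of "i - 1"] False by simp
      hence cz: "comp i z \<in> hcycles i" using zC comp_C comp_comp by (auto simp: hcycles_def)
      have "vectorspace.basis class_ring (homology A i) (B \<inter> carrier (homology A i))"
        using basis False by (auto simp: homogeneous_homology_basis_def)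
      note this [unfolded basis_iff, THEN conjunct2, THEN conjunct1]
      moreover have "hclass i (comp i z) \<in> carrier (homology A i)"
        using cz by (simp add: homology_carrier)
      ultimately have "\<exists>F c. finite F \<and> F \<subseteq> B \<inter> carrier (homology A i) \<and>
          hclass i (comp i z) = (\<Oplus>\<^bsub>homology A i\<^esub>h\<in>F. c h \<odot>\<^bsub>homology A i\<^esub> h)"
        by (rule bspec)
      then obtain F c where F: "finite F" "F \<subseteq> B \<inter> carrier (homology A i)"
        "hclass i (comp i z) = (\<Oplus>\<^bsub>homology A i\<^esub>h\<in>F. c h \<odot>\<^bsub>homology A i\<^esub> h)"
        by (elim exE conjE)
      have rep: "comp i (f [h]) \<in> hcycles i \<and> hclass i (comp i (f [h])) = h \<and> comp i (f [h]) \<approx> f [h]"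
        if "h \<in> F" for h
      proof -
        have h: "h \<in> B" "h \<in> carrier (homology A i)" using that F by auto
        have fh: "f [h] \<in> C" "\<kappa> (f [h]) = \<mu> [h]" using f [of "[h]"] h by auto
        have cyc: "\<mu> [h] \<in> cycles A i" "boundaries A i +>\<^bsub>A\<^esub> \<mu> [h] = h"
          using tmo h False unfolding trivial_massey_operation_def by (auto simp: Suc_le_eq)
        obtain b where b: "b \<in> hcycles i" "\<mu> [h] = \<kappa> b" using cyc(1) cycles_eq by auto
        have bC: "b \<in> C" "comp i b = b" "d b \<in> N" using b by (auto simp: hcycles_def)
        have 1: "f [h] - b \<in> N" using eq_iff [OF fh(1) bC(1)] fh b by simp
        have 2: "comp i (f [h]) - b \<in> N" using comp_N [OF 1, of i] bC by (simp add: comp_diff)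
        have 3: "comp i (f [h]) \<approx> f [h]" using N_diff [OF 2 1] by (simp add: eqv_def)
        have 4: "\<kappa> (comp i (f [h])) = \<mu> [h]" using eq_iff [of "comp i (f [h])" b] 2 fh bC b comp_C by simp
        have "d (comp i (f [h])) \<in> N" using eqv_d [of "comp i (f [h])" b] 2 bC N_add by (fastforce simp: eqv_def)
        thus ?thesis using 3 4 cyc(2) fh comp_C comp_comp by (auto simp: hcycles_def hclass_def)
      qed
      have "hclass i (comp i z) = (\<Oplus>\<^bsub>homology A i\<^esub>h\<in>F. c h \<odot>\<^bsub>homology A i\<^esub> hclass i (comp i (f [h])))"
      proof -
        interpret H: vectorspace class_ring "homology A i" by (rule vectorspace_homology)
        show ?thesis unfolding F(3)
        proof (rule H.finsum_cong' [OF refl])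
          show "(\<lambda>h. c h \<odot>\<^bsub>homology A i\<^esub> hclass i (comp i (f [h]))) \<in> F \<rightarrow> carrier (homology A i)"
            using rep by (intro Pi_I H.smult_closed) (auto simp: homology_carrier)
        qed (use rep in auto)
      qed
      also have "\<dots> = hclass i (\<Sum>h\<in>F. scale (c h) (comp i (f [h])))"
        using rep F by (intro homology_lincomb) auto
      finally obtain y where y: "y \<in> C" "comp i z \<approx> (\<Sum>h\<in>F. scale (c h) (comp i (f [h]))) + d y"
        using rep cz by (subst (asm) hclass_eq_iff)
          (auto intro!: subspace_sum [OF subspace_hcycles] subspace_scale [OF subspace_hcycles])
      note y(2)
      also have "(\<Sum>h\<in>F. scale (c h) (comp i (f [h]))) + d y \<approx> (\<Sum>h\<in>F. scale (c h) (f [h])) + d y"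
        using rep by (intro eqv_add eqv_sum eqv_scale) auto
      finally show ?thesis
        using y(1) F(2) zC comp_C
        by (intro GI [of _ "\<Sum>h\<in>F. scale (c h) (f [h])" y] span_sum span_scale span_base) auto
    qed
    hence "(\<Sum>i\<in>S. comp i z) \<in> G" for S
      by (induction S rule: infinite_finite_induct) (auto simp: G_add G0)
    from this [of "{..r}"] have "(\<Sum>i\<le>r. comp i z) \<in> G" .
    thus "\<exists>u\<in>span ((\<lambda>h. f [h]) ` B). \<exists>y\<in>C. z \<approx> u + d y"
      using comp_sum [OF zC(1)] by (simp add: G_def)
  qed
qed

end

section \<open>A trivial Massey operation from vanishing\<close>

context dg_presentation
begin

text \<open>
  Cycles that represent a basis of homology: a basis of the boundaries is extended to a basis of
  the cycles, and the added vectors are taken.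
\<close>

lemma exists_homology_basis:
  "\<exists>X\<subseteq>hcycles i. (\<forall>z\<in>hcycles i. \<exists>u\<in>span X. \<exists>y\<in>C. z \<approx> u + d y) \<and>
     (\<forall>F c. finite F \<longrightarrow> F \<subseteq> X \<longrightarrow> (\<exists>y\<in>C. (\<Sum>x\<in>F. scale (c x) x) \<approx> d y) \<longrightarrow> (\<forall>x\<in>F. c x = 0))"
proof -
  define Bd where "Bd = {a \<in> hcycles i. \<exists>y\<in>C. a \<approx> d y}"
  have subB: "subspace Bd"
    unfolding subspace_def
  proof (intro conjI ballI allI)
    show "0 \<in> Bd" using subspace_0 [OF subspace_hcycles] C_zero by (auto simp: Bd_def intro!: bexI [of _ 0])
  next
    fix a b assume "a \<in> Bd" "b \<in> Bd"
    then obtain y y' where "a \<in> hcycles i" "b \<in> hcycles i" "y \<in> C" "y' \<in> C" "a \<approx> d y" "b \<approx> d y'"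
      by (auto simp: Bd_def)
    moreover from this have "a + b \<approx> d (y + y')" using eqv_add by (simp add: d_add)
    ultimately show "a + b \<in> Bd"
      using subspace_add [OF subspace_hcycles] C_add unfolding Bd_def by blast
  next
    fix c a assume "a \<in> Bd"
    then obtain y where "a \<in> hcycles i" "y \<in> C" "a \<approx> d y" by (auto simp: Bd_def)
    moreover from this have "scale c a \<approx> d (scale c y)" using eqv_scale by (simp add: d_scale)
    ultimately show "scale c a \<in> Bd"
      using subspace_scale [OF subspace_hcycles] C_scale unfolding Bd_def by blast
  qed
  have Bd_sub: "Bd \<subseteq> hcycles i" by (auto simp: Bd_def)
  obtain D0 where D0: "D0 \<subseteq> Bd" "independent D0" "Bd \<subseteq> span D0"
    by (rule maximal_independent_subset_extend [of "{}" Bd]) (auto simp: independent_empty)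
  obtain D where D: "D0 \<subseteq> D" "D \<subseteq> hcycles i" "independent D" "hcycles i \<subseteq> span D"
    by (rule maximal_independent_subset_extend [OF order_trans [OF D0(1) Bd_sub] D0(2)])
  let ?X = "D - D0"
  have "\<exists>u\<in>span ?X. \<exists>y\<in>C. z \<approx> u + d y" if z: "z \<in> hcycles i" for z
  proof -
    have "D = ?X \<union> D0" using D(1) by blast
    hence "z \<in> span (?X \<union> D0)" using z D(4) by (metis subsetD)
    then obtain u b where u: "u \<in> span ?X" "b \<in> span D0" "z = u + b"
      unfolding span_Un by blast
    have "b \<in> Bd" using span_minimal [OF D0(1) subB] u(2) by blast
    then obtain y where y: "y \<in> C" "b \<approx> d y" by (auto simp: Bd_def)
    have "z \<approx> u + d y" using eqv_add [OF eqv_refl y(2)] u(3) by simp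
    thus ?thesis using u y by blast
  qed
  moreover have "c x = 0" if F: "finite F" "F \<subseteq> ?X" "\<exists>y\<in>C. (\<Sum>x\<in>F. scale (c x) x) \<approx> d y" "x \<in> F" for F c x
  proof (rule ccontr)
    assume nz: "c x \<noteq> 0"
    have "(\<Sum>x\<in>F. scale (c x) x) \<in> hcycles i"
      using F D(2) by (intro subspace_sum [OF subspace_hcycles] subspace_scale [OF subspace_hcycles]) auto
    hence "(\<Sum>x\<in>F. scale (c x) x) \<in> Bd" using F(3) by (auto simp: Bd_def)
    hence 1: "(\<Sum>x\<in>F. scale (c x) x) \<in> span D0" using D0(3) by blast
    have "D0 \<subseteq> D - {x}" using D(1) F by blast
    hence 1: "(\<Sum>x\<in>F. scale (c x) x) \<in> span (D - {x})" using 1 span_mono by blast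
    have 2: "(\<Sum>x\<in>F - {x}. scale (c x) x) \<in> span (D - {x})"
      using F(2) by (intro span_sum span_scale span_base) auto
    have "scale (c x) x = (\<Sum>x\<in>F. scale (c x) x) - (\<Sum>x\<in>F - {x}. scale (c x) x)"
      using F by (simp add: sum.remove)
    hence "scale (c x) x \<in> span (D - {x})" using span_diff [OF 1 2] by simp
    hence "scale (inverse (c x)) (scale (c x) x) \<in> span (D - {x})" by (rule span_scale)
    hence "x \<in> span (D - {x})" using nz by simp
    moreover have "x \<in> D" using F by blast
    ultimately show False using D(3) dependent_def by blast
  qed
  moreover have "?X \<subseteq> hcycles i" using D(2) by blast
  ultimately show ?thesis
    by (intro exI [of _ ?X] conjI ballI allI impI) simp_all
qed

text \<open>
  The words between two positions of a word form a defining system, so \<open>massey_trivial\<close> applies to the values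
  of \<open>f\<close> on the subwords of a single word.
\<close>

lemma mc_defect_word:
  assumes "i < j" "j \<le> length w"
  shows "mc_defect (\<lambda>i j. f (drop i (take j w))) i j =
    (\<Sum>k\<in>{1..<length (drop i (take j w))}. sg (f (take k (drop i (take j w)))) \<star> f (drop k (drop i (take j w))))"
  unfolding mc_defect_def mm_def map_mat_def
  by (rule sum.reindex_bij_witness [where i = "\<lambda>k. i + k" and j = "\<lambda>l. l - i"])
    (use assms in \<open>auto simp: take_drop min_def add.commute split: if_splits\<close>)

text \<open>
  The recursion is over the length of words. The degree of the value at \<open>w\<close> is prescribed as the sum
  of the degrees of the letters plus \<open>length w - 1\<close>, because every product lowers the number of
  factors by one and every bounding element raises the degree by one; the component of a bounding
  element in this degree is again a bounding element.
\<close>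

lemma extend_massey_system:
  fixes B :: "'h set"
  assumes triv: massey_trivial
    and rep: "\<And>h. h \<in> B \<Longrightarrow> deg h \<ge> 1 \<and> rep h \<in> hcycles (deg h)"
  shows "\<exists>f. \<forall>w\<in>lists B - {[]}. f w \<in> C \<and> comp (sum_list (map deg w) + length w - 1) (f w) = f w \<and>
     (length w = 1 \<longrightarrow> f w = rep (hd w)) \<and>
     d (f w) \<approx> - (\<Sum>k\<in>{1..<length w}. sg (f (take k w)) \<star> f (drop k w))"
proof -
  let ?e = "\<lambda>w. sum_list (map deg w) + length w - 1"
  let ?S = "\<lambda>f w. \<Sum>k\<in>{1..<length w}. sg (f (take k w)) \<star> f (drop k w)"
  define P where "P f w x \<longleftrightarrow> (w \<in> lists B - {[]} \<longrightarrow> x \<in> C \<and> comp (?e w) x = x \<and>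
     (length w = 1 \<longrightarrow> x = rep (hd w)) \<and> d x \<approx> - ?S f w)" for f w x
  have "\<exists>f. \<forall>w. P f w (f w)"
  proof (rule dependent_wf_choice [of "measure length"])
    fix f g :: "'h list \<Rightarrow> 'x" and w x
    assume fg: "\<And>z. (z, w) \<in> measure length \<Longrightarrow> f z = g z"
    have "?S f w = ?S g w" by (intro sum.cong refl) (auto simp: fg)
    thus "P f w x = P g w x" by (simp add: P_def)
  next
    fix w f assume IH: "\<And>y. (y, w) \<in> measure length \<Longrightarrow> P f y (f y)"
    show "\<exists>x. P f w x"
    proof (cases "w \<in> lists B - {[]}")
      case False thus ?thesis by (auto simp: P_def)
    next
      case w: True
      show ?thesis
      proof (cases "length w = 1")
        case True
        then obtain h where h: "w = [h]" by (auto simp: length_Suc_conv)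
        thus ?thesis using rep [of h] w
          by (intro exI [of _ "rep h"]) (auto simp: P_def hcycles_def eqv_0_iff)
      next
        case False
        hence len: "length w \<ge> 2" using w by (cases w) (auto simp: Suc_le_eq)
        have sh: "f u \<in> C \<and> comp (?e u) (f u) = f u \<and> d (f u) \<approx> - ?S f u \<and> ?e u \<ge> 1"
          if u: "length u < length w" "u \<in> lists B" "u \<noteq> []" for u
        proof -
          obtain h t where "u = h # t" "h \<in> B" using u by (cases u) auto
          hence "?e u \<ge> 1" using rep [of h] by simp
          thus ?thesis using IH [of u] u by (simp add: P_def)
        qed
        have fl: "f u \<in> augmentation_ideal" if "length u < length w" "u \<in> lists B" "u \<noteq> []" for u
          using sh [OF that] aug_comp [of "?e u" "f u"] by (simp add: augmentation_ideal_def)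
        let ?X = "\<lambda>i j. f (drop i (take j w))"
        have sub: "drop i (take j w) \<in> lists B" for i j
          using w by (auto simp: in_lists_conv_set dest: in_set_takeD in_set_dropD)
        have "flat_at ?X i j" if ij: "i < j" "j \<le> length w" "(i, j) \<noteq> (0, length w)" for i j
        proof -
          have "length (drop i (take j w)) < length w" "drop i (take j w) \<noteq> []"
            using ij by auto
          note u = this(1) sub this(2)
          have "d (f (drop i (take j w))) \<approx> - ?S f (drop i (take j w))" using sh [OF u] by (elim conjE)
          thus ?thesis using fl [OF u]
            unfolding flat_at_def mc_defect_word [OF ij(1, 2), of f] by (intro conjI)
        qed
        then obtain y where y: "y \<in> C" "mc_defect ?X 0 (length w) \<approx> d y"
          using triv unfolding massey_trivial_def by blast
        moreover have "w \<noteq> []" using w by simp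
        ultimately have y2: "?S f w \<approx> d y" using mc_defect_word [of 0 "length w" w f] by simp
        obtain e where e: "?e w = Suc e" using len by (cases "?e w") auto
        have "comp e (sg (f (take k w)) \<star> f (drop k w)) = sg (f (take k w)) \<star> f (drop k w)"
          if k: "k \<in> {1..<length w}" for k
        proof -
          let ?u = "take k w" let ?v = "drop k w"
          have mem: "?u \<in> lists B" "?v \<in> lists B"
            using sub [of 0 k] sub [of k "length w"] by simp_all
          have "length ?u < length w" "?u \<noteq> []" "length ?v < length w" "?v \<noteq> []" using k by auto
          note sh [OF this(1) mem(1) this(2)] sh [OF this(3) mem(2) this(4)]
          hence u: "comp (?e ?u) (f ?u) = f ?u" "?e ?u \<ge> 1"
            and v: "comp (?e ?v) (f ?v) = f ?v" "?e ?v \<ge> 1" by blast+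
          have "sum_list (map deg w) = sum_list (map deg ?u) + sum_list (map deg ?v)"
            by (metis append_take_drop_id map_append sum_list_append)
          hence ee: "e = ?e ?u + ?e ?v" using e k u(2) v(2) by auto
          have "comp (?e ?u + ?e ?v) (f ?u \<star> f ?v) = f ?u \<star> f ?v"
            using comp_mul [of "?e ?u" "?e ?v" "f ?u" "f ?v"] u v by simp
          moreover have "sg (f ?u) = f ?u \<or> sg (f ?u) = - f ?u"
          proof (cases "even (?e ?u)")
            case True
            show ?thesis using sg_comp [of "?e ?u" "f ?u"] True unfolding u(1) by (simp only: if_True simp_thms)
          next
            case False
            show ?thesis using sg_comp [of "?e ?u" "f ?u"] False unfolding u(1) by (simp only: if_False simp_thms)
          qed
          ultimately show ?thesis unfolding ee by auto
        qed
        hence "comp e (?S f w) = ?S f w" unfolding comp_sum_distrib by (rule sum.cong [OF refl])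
        hence "?S f w - d (comp (Suc e) y) \<in> N"
          using comp_N [of "?S f w - d y" e] y2 y by (simp add: eqv_def comp_diff comp_d)
        hence "?S f w \<approx> d (comp (Suc e) y)" by (simp add: eqv_def)
        hence "d (- comp (Suc e) y) \<approx> - ?S f w" by (simp add: eqv_neg eqv_sym)
        hence "P f w (- comp (?e w) y)"
          unfolding P_def e using y False comp_C C_neg by (simp add: comp_comp)
        thus ?thesis by blast
      qed
    qed
  qed simp
  thus ?thesis unfolding P_def by blast
qed

text \<open>
  Letters are homology classes, which are cosets, so a letter must determine its degree and its
  representative. This holds since a coset of boundaries in one degree is not a coset in another
  degree unless its representative is zero (\<open>cross\<close>), and the representatives of a basis are nonzero.
\<close>

theorem trivial_massey_operation_if_massey_trivial:
  assumes triv: massey_trivial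
  shows "admits_trivial_massey_operation A"
proof -
  obtain X where X: "\<And>i. X i \<subseteq> hcycles i"
    and gen: "\<And>i z. z \<in> hcycles i \<Longrightarrow> \<exists>u\<in>span (X i). \<exists>y\<in>C. z \<approx> u + d y"
    and ind: "\<And>i F c x. finite F \<Longrightarrow> F \<subseteq> X i \<Longrightarrow> \<exists>y\<in>C. (\<Sum>x\<in>F. scale (c x) x) \<approx> d y \<Longrightarrow> x \<in> F \<Longrightarrow> c x = 0"
  proof -
    have "\<forall>i. \<exists>X. X\<subseteq>hcycles i \<and> (\<forall>z\<in>hcycles i. \<exists>u\<in>span X. \<exists>y\<in>C. z \<approx> u + d y) \<and>
     (\<forall>F c. finite F \<longrightarrow> F \<subseteq> X \<longrightarrow> (\<exists>y\<in>C. (\<Sum>x\<in>F. scale (c x) x) \<approx> d y) \<longrightarrow> (\<forall>x\<in>F. c x = 0))"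
      using exists_homology_basis by blast
    from choice [OF this] obtain X where X: "\<forall>i. X i\<subseteq>hcycles i \<and>
     (\<forall>z\<in>hcycles i. \<exists>u\<in>span (X i). \<exists>y\<in>C. z \<approx> u + d y) \<and>
     (\<forall>F c. finite F \<longrightarrow> F \<subseteq> X i \<longrightarrow> (\<exists>y\<in>C. (\<Sum>x\<in>F. scale (c x) x) \<approx> d y) \<longrightarrow> (\<forall>x\<in>F. c x = 0))"
      by (elim exE)
    show ?thesis by (rule that [of X]) (use X in blast)+
  qed
  have XC: "x \<in> C" "comp i x = x" if "x \<in> X i" for x i
    using that X [of i] by (auto simp: hcycles_def)
  have X_nz: "x \<notin> N" if "x \<in> X i" for x i
  proof
    assume "x \<in> N"
    hence "\<exists>y\<in>C. (\<Sum>x\<in>{x}. scale 1 x) \<approx> d y" by (intro bexI [of _ 0]) (auto simp: eqv_0_iff C_zero)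
    from ind [of "{x}" i, OF _ _ this] that show False by simp
  qed
  have cross: "j = i" if x: "x \<in> X i" "hclass i x \<in> carrier (homology A j)" for i j x
  proof (rule ccontr)
    assume "j \<noteq> i"
    obtain b where b: "b \<in> hcycles j" "hclass i x = hclass j b" using x by (auto simp: homology_carrier)
    have bC: "b \<in> C" "comp j b = b" using b by (auto simp: hcycles_def)
    have "\<kappa> x \<in> hclass j b" using hclass_self XC x b by metis
    then obtain y where y: "y \<in> C" "\<kappa> x = \<kappa> (d y + b)" "comp (Suc j) y = y" using bC by (auto simp: hclass_eq)
    hence "x - (d y + b) \<in> N" using eq_iff [of x "d y + b"] XC x bC C_closed by simp
    hence "comp i (x - (d y + b)) \<in> N" by (rule comp_N)
    moreover have "comp i b = 0" using comp_comp [of i j b] bC \<open>j \<noteq> i\<close> by simp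
    moreover have "comp i (d y) = 0"
      using comp_comp [of "Suc i" "Suc j" y] y \<open>j \<noteq> i\<close> by (simp add: comp_d)
    ultimately have "x \<in> N" using XC x by (simp add: comp_diff comp_add)
    thus False using X_nz x by blast
  qed
  have inj: "x = x'" if xx: "x \<in> X i" "x' \<in> X i" "hclass i x = hclass i x'" for i x x'
  proof (rule ccontr)
    assume ne: "x \<noteq> x'"
    have "x \<in> hcycles i" "x' \<in> hcycles i" using that X by blast+
    from hclass_eq_iff [OF this] obtain y where y: "y \<in> C" "x \<approx> x' + d y" using xx(3) by blast
    have "(\<Sum>v\<in>{x, x'}. scale (if v = x then 1 else - 1) v) \<approx> d y"
      using y(2) ne by (simp add: eqv_def algebra_simps)
    hence "(if x = x then 1 else - 1 :: 'k) = 0"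
      using y(1) that by (intro ind [of "{x, x'}" i "\<lambda>v. if v = x then 1 else - 1" x]) auto
    thus False by simp
  qed
  define B where "B = (\<Union>i\<in>{1..}. hclass i ` X i)"
  have "\<forall>h\<in>B. \<exists>p. fst p \<ge> 1 \<and> snd p \<in> X (fst p) \<and> h = hclass (fst p) (snd p)"
    by (auto simp: B_def)
  then obtain p where p: "\<And>h. h \<in> B \<Longrightarrow> fst (p h) \<ge> 1 \<and> snd (p h) \<in> X (fst (p h)) \<and> h = hclass (fst (p h)) (snd (p h))"
    by metis
  define deg where "deg h = fst (p h)" for h
  define rep where "rep h = snd (p h)" for h
  have rep: "deg h \<ge> 1" "rep h \<in> X (deg h)" "h = hclass (deg h) (rep h)" if "h \<in> B" for h
    using p [OF that] by (simp_all add: deg_def rep_def)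
  have deg: "deg h = i" if "h \<in> B" "h \<in> carrier (homology A i)" for h i
    using cross [of "rep h" "deg h" i] rep [OF that(1)] that(2) by simp
  have BH: "B \<inter> carrier (homology A i) = hclass i ` X i" if "i \<ge> 1" for i
  proof
    show "B \<inter> carrier (homology A i) \<subseteq> hclass i ` X i" using rep deg by blast
    show "hclass i ` X i \<subseteq> B \<inter> carrier (homology A i)"
      using that X [of i] by (auto simp: B_def homology_carrier)
  qed
  have rep_i: "rep v \<in> X i \<and> hclass i (rep v) = v" if "v \<in> hclass i ` X i" "i \<ge> 1" for v i
  proof -
    have "v \<in> B" "v \<in> carrier (homology A i)" using that BH by blast+
    thus ?thesis using rep [of v] deg [of v i] by simp
  qed
  have rep_cl: "rep (hclass i x) = x" if "x \<in> X i" "i \<ge> 1" for x i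
    using rep_i [of "hclass i x" i] inj that by blast
  have lin: "(\<Oplus>\<^bsub>homology A i\<^esub>v\<in>F. c v \<odot>\<^bsub>homology A i\<^esub> v) = hclass i (\<Sum>v\<in>F. scale (c v) (rep v))"
    if F: "finite F" "F \<subseteq> hclass i ` X i" "i \<ge> 1" for F c i
  proof -
    interpret H: vectorspace class_ring "homology A i" by (rule vectorspace_homology)
    have r: "rep v \<in> hcycles i \<and> hclass i (rep v) = v" if "v \<in> F" for v
      using rep_i [of v i] that F X by blast
    have "(\<Oplus>\<^bsub>homology A i\<^esub>v\<in>F. c v \<odot>\<^bsub>homology A i\<^esub> v) =
        (\<Oplus>\<^bsub>homology A i\<^esub>v\<in>F. c v \<odot>\<^bsub>homology A i\<^esub> hclass i (rep v))"
    proof (rule H.finsum_cong' [OF refl])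
      show "(\<lambda>v. c v \<odot>\<^bsub>homology A i\<^esub> hclass i (rep v)) \<in> F \<rightarrow> carrier (homology A i)"
        using r by (intro Pi_I H.smult_closed) (auto simp: homology_carrier)
    qed (use r in simp)
    also have "\<dots> = hclass i (\<Sum>v\<in>F. scale (c v) (rep v))"
      using r F by (intro homology_lincomb) auto
    finally show ?thesis .
  qed
  have basis: "homogeneous_homology_basis A B"
    unfolding homogeneous_homology_basis_def
  proof (intro conjI allI impI)
    show "B \<subseteq> (\<Union>i\<in>{1..}. carrier (homology A i))"
      using X by (fastforce simp: B_def homology_carrier)
  next
    fix i :: nat assume i: "1 \<le> i"
    show "vectorspace.basis class_ring (homology A i) (B \<inter> carrier (homology A i))"
      unfolding BH [OF i] basis_iff
    proof (intro conjI ballI allI impI)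
      show "hclass i ` X i \<subseteq> carrier (homology A i)" using X by (auto simp: homology_carrier)
    next
      fix h assume "h \<in> carrier (homology A i)"
      then obtain z where z: "z \<in> hcycles i" "h = hclass i z" by (auto simp: homology_carrier)
      obtain u y where u: "u \<in> span (X i)" "y \<in> C" "z \<approx> u + d y" using gen [OF z(1)] by blast
      then obtain T r where T: "finite T" "T \<subseteq> X i" "u = (\<Sum>x\<in>T. scale (r x) x)"
        by (auto simp: span_explicit)
      have "u \<in> hcycles i" using span_minimal [OF X subspace_hcycles] u(1) by blast
      hence "h = hclass i u" using z u hclass_eq_iff by blast
      also have "u = (\<Sum>v\<in>hclass i ` T. scale (r (rep v)) (rep v))"
      proof -
        have "inj_on (hclass i) T" using T(2) inj by (intro inj_onI) (meson subsetD)
        moreover have "rep (hclass i x) = x" if "x \<in> T" for x using that T(2) rep_cl i by blast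
        ultimately show ?thesis unfolding T(3) by (simp add: sum.reindex)
      qed
      also have "hclass i \<dots> = (\<Oplus>\<^bsub>homology A i\<^esub>v\<in>hclass i ` T. r (rep v) \<odot>\<^bsub>homology A i\<^esub> v)"
        using T i by (intro lin [symmetric]) auto
      finally show "\<exists>F c. finite F \<and> F \<subseteq> hclass i ` X i \<and> h = (\<Oplus>\<^bsub>homology A i\<^esub>v\<in>F. c v \<odot>\<^bsub>homology A i\<^esub> v)"
        using T by (intro exI [of _ "hclass i ` T"] exI [of _ "\<lambda>v. r (rep v)"]) auto
    next
      fix F c v
      assume F: "finite F" "F \<subseteq> hclass i ` X i"
        "(\<Oplus>\<^bsub>homology A i\<^esub>v\<in>F. c v \<odot>\<^bsub>homology A i\<^esub> v) = \<zero>\<^bsub>homology A i\<^esub>" "v \<in> F"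
      have r: "rep v \<in> X i \<and> hclass i (rep v) = v" if "v \<in> F" for v
        using rep_i [of v i] that F i by blast
      have injr: "inj_on rep F" using r by (metis inj_onI)
      let ?s = "\<Sum>v\<in>F. scale (c v) (rep v)"
      have "?s \<in> hcycles i"
        using r X by (intro subspace_sum [OF subspace_hcycles] subspace_scale [OF subspace_hcycles]) blast
      moreover have "hclass i ?s = hclass i 0" using lin [OF F(1, 2) i] F(3) homology_zero by metis
      ultimately obtain y where y: "y \<in> C" "?s \<approx> 0 + d y"
        using hclass_eq_iff [of ?s i 0] subspace_0 [OF subspace_hcycles] by blast
      have s: "?s = (\<Sum>x\<in>rep ` F. scale (c (hclass i x)) x)"
        using r by (simp add: sum.reindex [OF injr])
      have "c (hclass i (rep v)) = 0"
        by (rule ind [of "rep ` F" i "\<lambda>x. c (hclass i x)"])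
          (use F r y in \<open>auto simp: s [symmetric]\<close>)
      thus "c v = 0" using r F by simp
    qed
  qed
  have "deg h \<ge> 1 \<and> rep h \<in> hcycles (deg h)" if "h \<in> B" for h
    using rep [OF that] X by blast
  with triv have "\<exists>f. \<forall>w\<in>lists B - {[]}. f w \<in> C \<and> comp (sum_list (map deg w) + length w - 1) (f w) = f w \<and>
     (length w = 1 \<longrightarrow> f w = rep (hd w)) \<and>
     d (f w) \<approx> - (\<Sum>k\<in>{1..<length w}. sg (f (take k w)) \<star> f (drop k w))"
    by (rule extend_massey_system)
  then obtain f where f0: "\<forall>w\<in>lists B - {[]}. f w \<in> C \<and> comp (sum_list (map deg w) + length w - 1) (f w) = f w \<and>
     (length w = 1 \<longrightarrow> f w = rep (hd w)) \<and>
     d (f w) \<approx> - (\<Sum>k\<in>{1..<length w}. sg (f (take k w)) \<star> f (drop k w))" ..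
  note f = f0 [THEN bspec]
  have "trivial_massey_operation A B (\<lambda>w. \<kappa> (f w))"
    unfolding trivial_massey_operation_def
  proof (intro conjI ballI allI impI)
    fix w assume "w \<in> lists B - {[]}"
    thus "\<exists>i. \<kappa> (f w) \<in> hcomp A i" using f by (auto simp: hcomp)
  next
    fix i h assume i: "1 \<le> (i::nat)" "h \<in> B \<inter> carrier (homology A i)"
    have "deg h = i" using deg i by blast
    moreover have "f [h] = rep h" using f [of "[h]"] i by simp
    ultimately show "\<kappa> (f [h]) \<in> cycles A i" "boundaries A i +>\<^bsub>A\<^esub> \<kappa> (f [h]) = h"
      using rep [of h] X i by (auto simp: cycles_eq hclass_def)
  next
    fix w assume w: "w \<in> lists B - {[]}"
    let ?S = "\<Sum>k\<in>{1..<length w}. sg (f (take k w)) \<star> f (drop k w)"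
    have sub: "take j w \<in> lists B - {[]}" "drop j w \<in> lists B - {[]}"
      if "j \<in> {1..<length w}" for j
      using that w by (auto dest: in_set_takeD in_set_dropD simp: in_lists_conv_set)
    have "- ?S \<in> C"
      using f [OF sub(1)] f [OF sub(2)] by (intro C_neg C_sum mul_C sg_C) auto
    hence "\<kappa> (d (f w)) = \<kappa> (- ?S)"
      using f [OF w] eq_iff [of "d (f w)" "- ?S"] d_C by (simp add: eqv_def)
    also have "\<dots> = (\<Oplus>\<^bsub>A\<^esub>j\<in>{1..<length w}. bar A (\<kappa> (f (take j w))) \<otimes>\<^bsub>A\<^esub> \<kappa> (f (drop j w)))"
      by (rule massey_sum_lift [OF _ w, symmetric]) (use f in blast)
    finally show "differential A (\<kappa> (f w)) =
        (\<Oplus>\<^bsub>A\<^esub>j\<in>{1..<length w}. bar A (\<kappa> (f (take j w))) \<otimes>\<^bsub>A\<^esub> \<kappa> (f (drop j w)))"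
      using diff f [OF w] by simp
  qed
  thus ?thesis using basis unfolding admits_trivial_massey_operation_def by blast
qed

end

section \<open>Signs of shuffles\<close>

definition inv_count :: "nat set \<Rightarrow> nat set \<Rightarrow> nat" where
  "inv_count S T = card {(s, t). s \<in> S \<and> t \<in> T \<and> t < s}"

abbreviation below :: "nat set \<Rightarrow> nat \<Rightarrow> nat" where
  "below S i \<equiv> card {j \<in> S. j < i}"

abbreviation above :: "nat set \<Rightarrow> nat \<Rightarrow> nat" where
  "above S i \<equiv> card {j \<in> S. i < j}"

lemma inv_count_left: "finite S \<Longrightarrow> finite T \<Longrightarrow> inv_count S T = (\<Sum>s\<in>S. below T s)"
proof -
  assume fin: "finite S" "finite T"
  have "{(s, t). s \<in> S \<and> t \<in> T \<and> t < s} = Sigma S (\<lambda>s. {j \<in> T. j < s})" by auto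
  thus ?thesis using fin by (simp add: inv_count_def)
qed

lemma inv_count_right: "finite S \<Longrightarrow> finite T \<Longrightarrow> inv_count S T = (\<Sum>t\<in>T. above S t)"
proof -
  assume fin: "finite S" "finite T"
  have "{(s, t). s \<in> S \<and> t \<in> T \<and> t < s} = prod.swap ` Sigma T (\<lambda>t. {j \<in> S. t < j})" by force
  thus ?thesis using fin by (simp add: inv_count_def card_image)
qed

lemma inv_count_Un_left:
  "finite S \<Longrightarrow> finite S' \<Longrightarrow> finite T \<Longrightarrow> S \<inter> S' = {} \<Longrightarrow>
    inv_count (S \<union> S') T = inv_count S T + inv_count S' T"
  by (simp add: inv_count_left sum.union_disjoint)

lemma inv_count_Un_right:
  "finite S \<Longrightarrow> finite T \<Longrightarrow> finite T' \<Longrightarrow> T \<inter> T' = {} \<Longrightarrow>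
    inv_count S (T \<union> T') = inv_count S T + inv_count S T'"
  by (simp add: inv_count_right sum.union_disjoint)

lemma inv_count_insert_left:
  "finite S \<Longrightarrow> finite T \<Longrightarrow> i \<notin> S \<Longrightarrow> inv_count (insert i S) T = below T i + inv_count S T"
  by (simp add: inv_count_left)

lemma inv_count_insert_right:
  "finite S \<Longrightarrow> finite T \<Longrightarrow> i \<notin> T \<Longrightarrow> inv_count S (insert i T) = above S i + inv_count S T"
  by (simp add: inv_count_right)

lemma below_Un:
  "finite S \<Longrightarrow> finite T \<Longrightarrow> S \<inter> T = {} \<Longrightarrow> below (S \<union> T) i = below S i + below T i"
  by (subst card_Un_disjoint [symmetric]) (auto intro: arg_cong [where f = card])

lemma below_subset:
  assumes "finite U" "S \<subseteq> U" shows "below U i = below S i + below (U - S) i"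
proof -
  have "S \<union> (U - S) = U" "finite S" using assms by (auto dest: finite_subset)
  thus ?thesis using below_Un [of S "U - S" i] assms by simp
qed

lemma card_below_above:
  assumes "finite S" "i \<notin> S" shows "card S = below S i + above S i"
proof -
  have "j < i \<or> i < j" if "j \<in> S" for j using that assms(2) by (cases i j rule: linorder_cases) auto
  hence "S = {j \<in> S. j < i} \<union> {j \<in> S. i < j}" by blast
  moreover have "card ({j \<in> S. j < i} \<union> {j \<in> S. i < j}) = below S i + above S i"
    using assms by (intro card_Un_disjoint) auto
  ultimately show ?thesis by simp
qed

lemma below_insert: "below (insert j U) i = (if j < i \<and> j \<notin> U then Suc (below U i) else below U i)"
proof -
  have "{l \<in> insert j U. l < i} = (if j < i then insert j {l \<in> U. l < i} else {l \<in> U. l < i})" by auto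
  thus ?thesis by (auto simp: insert_absorb)
qed

lemma minus_one_power_cong: "m + n = 2 * k \<Longrightarrow> (- 1 :: 'r::comm_ring_1) ^ m = (- 1) ^ n"
  by (metis even_add even_mult_iff even_numeral minus_one_power_iff)

lemma minus_one_power_opp: "m + n = 2 * k + 1 \<Longrightarrow> (- 1 :: 'r::comm_ring_1) ^ m = - ((- 1) ^ n)"
  using minus_one_power_cong [of m "Suc n" "Suc k"] by simp

lemma sum_Pow_insert:
  fixes g :: "'a set \<Rightarrow> 'b::comm_monoid_add"
  assumes "finite U" "i \<notin> U"
  shows "(\<Sum>S\<in>Pow (insert i U). g S) = (\<Sum>S\<in>Pow U. g S) + (\<Sum>S\<in>Pow U. g (insert i S))"
proof -
  have "inj_on (insert i) (Pow U)" using assms(2) by (auto simp: inj_on_def)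
  moreover have "Pow U \<inter> insert i ` Pow U = {}" using assms(2) by auto
  ultimately show ?thesis
    using assms(1) by (simp add: Pow_insert sum.union_disjoint sum.reindex)
qed

text \<open>
  The condition \<open>f i i = 0\<close> does not follow from the first one in characteristic two.
\<close>

lemma sum_alternating_eq_0:
  fixes f :: "nat \<Rightarrow> nat \<Rightarrow> 'r::ab_group_add"
  assumes "\<And>i j. f i j = - f j i" "\<And>i. f i i = 0"
  shows "(\<Sum>i<r. \<Sum>j<r. f i j) = 0"
proof (induction r)
  case (Suc r)
  have "(\<Sum>j<r. f r j) = - (\<Sum>i<r. f i r)"
    by (subst sum_negf [symmetric]) (rule sum.cong [OF refl], rule assms(1))
  thus ?case using Suc assms(2) by (simp add: sum.distrib)
qed simp

section \<open>The Koszul differential on the exterior algebra\<close>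

text \<open>
  An element of the exterior algebra is given by its coefficients at the basis monomials, which are indexed by
  finite sets; the sign of a product counts the transpositions that sort the concatenation.
\<close>

definition kmul :: "(nat set \<Rightarrow> 'r::comm_ring_1) \<Rightarrow> (nat set \<Rightarrow> 'r) \<Rightarrow> nat set \<Rightarrow> 'r" where
  "kmul a b U = (\<Sum>S\<in>Pow U. (- 1) ^ inv_count S (U - S) * (a S * b (U - S)))"

text \<open>
  The contraction with the \<open>i\<close>-th dual basis vector. The value at infinite sets is zero, as it is for
  \<open>kmul\<close>, so that the identities below hold for all functions.
\<close>

definition contract :: "nat \<Rightarrow> (nat set \<Rightarrow> 'r::comm_ring_1) \<Rightarrow> nat set \<Rightarrow> 'r" where
  "contract i a U = (if finite U \<and> i \<notin> U then (- 1) ^ below U i * a (insert i U) else 0)"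

definition kd :: "nat \<Rightarrow> (nat \<Rightarrow> 'r::comm_ring_1) \<Rightarrow> (nat set \<Rightarrow> 'r) \<Rightarrow> nat set \<Rightarrow> 'r" where
  "kd r x a U = (\<Sum>i<r. x i * contract i a U)"

definition ksg :: "(nat set \<Rightarrow> 'r::comm_ring_1) \<Rightarrow> nat set \<Rightarrow> 'r" where
  "ksg a S = (- 1) ^ card S * a S"

definition rs :: "'r::comm_ring_1 \<Rightarrow> (nat set \<Rightarrow> 'r) \<Rightarrow> nat set \<Rightarrow> 'r" where
  "rs p a S = p * a S"

definition kone :: "nat set \<Rightarrow> 'r::comm_ring_1" where
  "kone S = (if S = {} then 1 else 0)"

lemma kmul_infinite: "infinite U \<Longrightarrow> kmul a b U = 0"
  by (simp add: kmul_def finite_Pow_iff)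

lemma fun_sum_apply: "(\<Sum>i\<in>A. f i) x = (\<Sum>i\<in>A. f i x)"
  by (induction A rule: infinite_finite_induct) auto

lemma kmul_add_left: "kmul (a + b) c = kmul a c + kmul b c"
  by (simp add: kmul_def fun_eq_iff algebra_simps sum.distrib)

lemma kmul_add_right: "kmul a (b + c) = kmul a b + kmul a c"
  by (simp add: kmul_def fun_eq_iff algebra_simps sum.distrib)

lemma kmul_rs_left: "kmul (rs p a) b = rs p (kmul a b)"
  by (simp add: kmul_def rs_def fun_eq_iff sum_distrib_left mult_ac)

lemma kmul_rs_right: "kmul a (rs p b) = rs p (kmul a b)"
  by (simp add: kmul_def rs_def fun_eq_iff sum_distrib_left mult_ac)

lemma kmul_assoc: "kmul (kmul a b) c = kmul a (kmul b c)"
proof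
  fix U :: "nat set"
  show "kmul (kmul a b) c U = kmul a (kmul b c) U"
  proof (cases "finite U")
    case False thus ?thesis by (simp add: kmul_infinite)
  next
    case fin: True
    hence fin': "finite S" if "S \<subseteq> U" for S using that finite_subset by blast
    have "kmul (kmul a b) c U = (\<Sum>V\<in>Pow U. \<Sum>S\<in>Pow V.
        (- 1) ^ (inv_count V (U - V) + inv_count S (V - S)) * (a S * b (V - S) * c (U - V)))"
      by (simp add: kmul_def sum_distrib_left sum_distrib_right power_add mult_ac)
    also have "\<dots> = (\<Sum>(V, S)\<in>Sigma (Pow U) Pow.
        (- 1) ^ (inv_count V (U - V) + inv_count S (V - S)) * (a S * b (V - S) * c (U - V)))"
      using fin fin' by (intro sum.Sigma) auto
    also have "\<dots> = (\<Sum>(S, T)\<in>Sigma (Pow U) (\<lambda>S. Pow (U - S)).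
        (- 1) ^ (inv_count S (U - S) + inv_count T (U - S - T)) * (a S * b T * c (U - S - T)))"
    proof (rule sum.reindex_bij_witness [where i = "\<lambda>(S, T). (S \<union> T, S)" and j = "\<lambda>(V, S). (S, V - S)"],
        goal_cases)
      case (5 p)
      obtain V S where p: "p = (V, S)" by force
      have VS: "S \<subseteq> V" "V \<subseteq> U" using 5 p by auto
      have e: "U - S - (V - S) = U - V" "U - S = (V - S) \<union> (U - V)" "V = S \<union> (V - S)" using VS by auto
      have "inv_count V (U - V) = inv_count S (U - V) + inv_count (V - S) (U - V)"
        by (subst e(3), rule inv_count_Un_left) (use VS fin fin' in auto)
      moreover have "inv_count S (U - S) = inv_count S (V - S) + inv_count S (U - V)"
        unfolding e(2) by (rule inv_count_Un_right) (use VS fin fin' in auto)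
      ultimately show ?case by (simp add: p e(1) add_ac)
    qed auto
    also have "\<dots> = (\<Sum>S\<in>Pow U. \<Sum>T\<in>Pow (U - S).
        (- 1) ^ (inv_count S (U - S) + inv_count T (U - S - T)) * (a S * b T * c (U - S - T)))"
      using fin fin' by (intro sum.Sigma [symmetric]) auto
    also have "\<dots> = kmul a (kmul b c) U"
      by (simp add: kmul_def sum_distrib_left power_add mult_ac)
    finally show ?thesis .
  qed
qed

lemma kmul_kone_left: "kmul kone a U = (if finite U then a U else 0)"
proof (cases "finite U")
  case True
  have "kmul kone a U = (\<Sum>S\<in>Pow U. if S = {} then a U else 0)"
    unfolding kmul_def by (intro sum.cong refl) (auto simp: kone_def inv_count_def)
  thus ?thesis using True by simp
qed (simp add: kmul_infinite)

lemma ksg_kmul: "ksg (kmul a b) = kmul (ksg a) (ksg b)"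
proof
  fix U :: "nat set"
  show "ksg (kmul a b) U = kmul (ksg a) (ksg b) U"
  proof (cases "finite U")
    case True
    have "card U = card S + card (U - S)" if "S \<subseteq> U" for S
      using that True by (metis card_Diff_subset card_mono finite_subset le_add_diff_inverse)
    thus ?thesis
      unfolding ksg_def kmul_def sum_distrib_left
      by (intro sum.cong refl) (simp add: power_add mult_ac)
  qed (simp add: kmul_infinite ksg_def)
qed

lemma ksg_ksg: "ksg (ksg a) = a"
  by (simp add: ksg_def fun_eq_iff mult.assoc [symmetric] power_add [symmetric])

lemma contract_ksg: "contract i (ksg a) U = - ((- 1) ^ card U * contract i a U)"
  by (simp add: contract_def ksg_def mult_ac)

lemma kd_ksg: "kd r x (ksg a) = - ksg (kd r x a)"
  by (simp add: kd_def ksg_def fun_eq_iff contract_ksg sum_negf sum_distrib_left mult_ac)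

lemma contract_contract:
  "contract i (contract j a) U = - contract j (contract i a) U" "contract i (contract i a) U = 0"
proof -
  show "contract i (contract i a) U = 0" by (simp add: contract_def)
  show "contract i (contract j a) U = - contract j (contract i a) U"
  proof (cases "finite U \<and> i \<notin> U \<and> j \<notin> U \<and> i \<noteq> j")
    case True
    thus ?thesis
      using below_insert [of i U j] below_insert [of j U i]
      by (cases "i < j") (auto simp: contract_def insert_commute)
  qed (auto simp: contract_def)
qed

lemma kd_kd: "kd r x (kd r x a) = 0"
proof
  fix U
  have "contract i (kd r x a) U = (\<Sum>j<r. x j * contract i (contract j a) U)" for i
  proof (cases "finite U \<and> i \<notin> U")
    case True
    thus ?thesis by (simp add: contract_def [of i] kd_def sum_distrib_left mult.left_commute)
  next
    case False
    hence "contract i b U = 0" for b :: "nat set \<Rightarrow> 'a" unfolding contract_def by (rule if_not_P)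
    thus ?thesis by simp
  qed
  hence "kd r x (kd r x a) U = (\<Sum>i<r. \<Sum>j<r. x i * x j * contract i (contract j a) U)"
    by (simp add: kd_def [of r x "kd r x a"] sum_distrib_left mult_ac)
  also have "\<dots> = 0"
  proof (rule sum_alternating_eq_0)
    show "x i * x j * contract i (contract j a) U = - (x j * x i * contract j (contract i a) U)" for i j
      by (subst contract_contract(1)) (simp add: mult_ac)
  qed (simp add: contract_contract(2))
  finally show "kd r x (kd r x a) U = 0 U" by simp
qed

text \<open>
  A contraction is an antiderivation. A subset \<open>S\<close> of \<open>insert i U\<close> either contains \<open>i\<close>, and then \<open>i\<close>
  is removed from the first factor, or \<open>i\<close> lies in the second factor and has to pass the \<open>card S\<close>
  elements of the first one, which gives the sign in \<open>ksg a\<close>.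
\<close>

lemma contract_kmul: "contract i (kmul a b) = kmul (contract i a) b + kmul (ksg a) (contract i b)"
proof
  fix U :: "nat set"
  show "contract i (kmul a b) U = (kmul (contract i a) b + kmul (ksg a) (contract i b)) U"
  proof (cases "finite U")
    case False thus ?thesis by (simp add: contract_def kmul_infinite)
  next
    case fin: True
    hence fin': "finite S" if "S \<subseteq> U" for S using that finite_subset by blast
    show ?thesis
    proof (cases "i \<in> U")
      case False
      have "contract i (kmul a b) U =
          (\<Sum>S\<in>Pow U. (- 1) ^ below U i * ((- 1) ^ inv_count S (insert i (U - S)) * (a S * b (insert i (U - S)))))
        + (\<Sum>S\<in>Pow U. (- 1) ^ below U i * ((- 1) ^ inv_count (insert i S) (U - S) * (a (insert i S) * b (U - S))))"
        (is "_ = sum ?f _ + sum ?g _")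
      proof -
        have "insert i U - S = insert i (U - S)" "insert i U - insert i S = U - S" if "S \<in> Pow U" for S
          using that False by auto
        thus ?thesis
          using False fin unfolding contract_def kmul_def
          by (simp add: sum_Pow_insert distrib_left sum_distrib_left)
      qed
      also have "sum ?f (Pow U) = kmul (ksg a) (contract i b) U"
        unfolding kmul_def
      proof (intro sum.cong refl)
        fix S assume S: "S \<in> Pow U"
        have n: "i \<notin> S" "i \<notin> U - S" "finite S" "finite (U - S)" using S False fin fin' by auto
        have "(- 1 :: 'a) ^ (below U i + inv_count S (insert i (U - S))) =
            (- 1) ^ (inv_count S (U - S) + card S + below (U - S) i)"
          by (rule minus_one_power_cong [of _ _ "below S i + above S i + below (U - S) i + inv_count S (U - S)"])
            (use S n fin in \<open>simp add: inv_count_insert_right card_below_above [of S i] below_subset [of U S i]\<close>)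
        thus "?f S = (- 1) ^ inv_count S (U - S) * (ksg a S * contract i b (U - S))"
          using n by (simp add: ksg_def contract_def power_add mult_ac)
      qed
      also have "sum ?g (Pow U) = kmul (contract i a) b U"
        unfolding kmul_def
      proof (intro sum.cong refl)
        fix S assume S: "S \<in> Pow U"
        have n: "i \<notin> S" "i \<notin> U - S" "finite S" "finite (U - S)" using S False fin fin' by auto
        have "(- 1 :: 'a) ^ (below U i + inv_count (insert i S) (U - S)) =
            (- 1) ^ (inv_count S (U - S) + below S i)"
          by (rule minus_one_power_cong [of _ _ "below S i + below (U - S) i + inv_count S (U - S)"])
            (use S n fin in \<open>simp add: inv_count_insert_left below_subset [of U S i]\<close>)
        thus "?g S = (- 1) ^ inv_count S (U - S) * (contract i a S * b (U - S))"
          using n by (simp add: contract_def power_add mult_ac)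
      qed
      finally show ?thesis by simp
    next
      case True
      define W where "W = U - {i}"
      have W: "U = insert i W" "i \<notin> W" "finite W" using True fin by (auto simp: W_def)
      have 1: "kmul (contract i a) b U =
          (\<Sum>S\<in>Pow W. (- 1) ^ inv_count S (insert i (W - S)) * (contract i a S * b (insert i (W - S))))"
      proof -
        have "insert i W - S = insert i (W - S)" if "S \<in> Pow W" for S using that W by auto
        thus ?thesis using W(2, 3) unfolding kmul_def W(1)
          by (simp add: sum_Pow_insert contract_def)
      qed
      have 2: "kmul (ksg a) (contract i b) U =
          (\<Sum>S\<in>Pow W. (- 1) ^ inv_count (insert i S) (W - S) * (ksg a (insert i S) * contract i b (W - S)))"
      proof -
        have "insert i W - S = insert i (W - S)" "insert i W - insert i S = W - S" if "S \<in> Pow W" for S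
          using that W by auto
        thus ?thesis using W(2, 3) unfolding kmul_def W(1)
          by (simp add: sum_Pow_insert) (simp add: contract_def)
      qed
      have "kmul (contract i a) b U + kmul (ksg a) (contract i b) U = 0"
        unfolding 1 2 sum.distrib [symmetric]
      proof (intro sum.neutral ballI)
        fix S assume S: "S \<in> Pow W"
        have n: "i \<notin> S" "i \<notin> W - S" "finite S" "finite (W - S)" using S W finite_subset by auto
        have "(- 1 :: 'a) ^ (inv_count S (insert i (W - S)) + below S i) =
            - ((- 1) ^ (inv_count (insert i S) (W - S) + Suc (card S) + below (W - S) i))"
          by (rule minus_one_power_opp [of _ _ "below S i + above S i + below (W - S) i + inv_count S (W - S)"])
            (use n in \<open>simp add: inv_count_insert_right inv_count_insert_left card_below_above [of S i]\<close>)
        thus "(- 1) ^ inv_count S (insert i (W - S)) * (contract i a S * b (insert i (W - S))) +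
            (- 1) ^ inv_count (insert i S) (W - S) * (ksg a (insert i S) * contract i b (W - S)) = 0"
          using n by (simp add: contract_def ksg_def power_add mult_ac)
      qed
      thus ?thesis using True by (simp add: contract_def [of i "kmul a b"])
    qed
  qed
qed

lemma kmul_sum_left: "kmul (\<lambda>U. \<Sum>i\<in>A. f i U) b U = (\<Sum>i\<in>A. kmul (f i) b U)"
  unfolding kmul_def by (subst sum.swap) (simp add: sum_distrib_left sum_distrib_right)

lemma kmul_sum_right: "kmul a (\<lambda>U. \<Sum>i\<in>A. f i U) U = (\<Sum>i\<in>A. kmul a (f i) U)"
  unfolding kmul_def by (subst sum.swap) (simp add: sum_distrib_left sum_distrib_right)

lemma kd_eq: "kd r x a = (\<lambda>U. \<Sum>i<r. rs (x i) (contract i a) U)"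
  by (simp add: kd_def rs_def fun_eq_iff)

lemma kd_kmul: "kd r x (kmul a b) = kmul (kd r x a) b + kmul (ksg a) (kd r x b)"
proof
  fix U
  have "kd r x (kmul a b) U = (\<Sum>i<r. rs (x i) (kmul (contract i a) b) U + rs (x i) (kmul (ksg a) (contract i b)) U)"
    by (simp add: kd_def contract_kmul rs_def distrib_left)
  also have "\<dots> = kmul (kd r x a) b U + kmul (ksg a) (kd r x b) U"
    by (simp add: kd_eq kmul_sum_left kmul_sum_right kmul_rs_left kmul_rs_right sum.distrib)
  finally show "kd r x (kmul a b) U = (kmul (kd r x a) b + kmul (ksg a) (kd r x b)) U" by simp
qed

lemma kd_add: "kd r x (a + b) = kd r x a + kd r x b"
proof
  fix U
  have "contract i (a + b) U = contract i a U + contract i b U" for i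
    by (simp add: contract_def distrib_left)
  thus "kd r x (a + b) U = (kd r x a + kd r x b) U"
    by (simp add: kd_def distrib_left sum.distrib)
qed

lemma kd_rs: "kd r x (rs p a) = rs p (kd r x a)"
proof
  fix U
  have "contract i (rs p a) U = p * contract i a U" for i
    by (simp add: contract_def rs_def)
  thus "kd r x (rs p a) U = rs p (kd r x a) U"
    by (simp add: kd_def rs_def sum_distrib_left mult.left_commute)
qed

section \<open>Products of elements of degree one\<close>

definition degree_one :: "(nat set \<Rightarrow> 'r::comm_ring_1) \<Rightarrow> bool" where
  "degree_one a \<longleftrightarrow> (\<forall>S. a S \<noteq> 0 \<longrightarrow> (\<exists>i. S = {i}))"

lemma kmul_degree_one:
  assumes a: "degree_one a" and b: "degree_one b"
  shows "i < j \<Longrightarrow> kmul a b {i, j} = a {i} * b {j} - a {j} * b {i}"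
    and "(\<nexists>i j. i < j \<and> U = {i, j}) \<Longrightarrow> kmul a b U = 0"
proof -
  assume ij: "i < j"
  have e: "a {} = 0" "b {} = 0" using a b by (auto simp: degree_one_def)
  have P: "Pow {i, j} = {{}, {i}, {j}, {i, j}}" by auto
  have n: "inv_count {i} {j} = 0" "inv_count {j} {i} = 1"
  proof -
    have "{l \<in> {i}. l < j} = {i}" "{l \<in> {j}. l < i} = {}" using ij by auto
    thus "inv_count {i} {j} = 0" "inv_count {j} {i} = 1"
      by (simp_all only: inv_count_left finite.emptyI finite_insert) simp_all
  qed
  have d: "{i, j} - {i} = {j}" "{i, j} - {j} = {i}" using ij by auto
  have "kmul a b {i, j} = (\<Sum>S\<in>{{}, {i}, {j}, {i, j}}. (- 1) ^ inv_count S ({i, j} - S) * (a S * b ({i, j} - S)))"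
    by (simp add: kmul_def P)
  also have "\<dots> = a {i} * b {j} - a {j} * b {i}"
    using ij e n d by (subst sum.insert; simp add: doubleton_eq_iff)+
  finally show "kmul a b {i, j} = a {i} * b {j} - a {j} * b {i}" .
next
  assume U: "\<nexists>i j. i < j \<and> U = {i, j}"
  have "a S * b (U - S) = 0" if S: "S \<subseteq> U" for S
  proof (rule ccontr)
    assume "a S * b (U - S) \<noteq> 0"
    hence "a S \<noteq> 0" "b (U - S) \<noteq> 0" by auto
    then obtain i j where ij: "S = {i}" "U - S = {j}" using a b by (meson degree_one_def)
    hence "U = {i, j}" "i \<noteq> j" using S by auto
    thus False using U by (metis insert_commute linorder_neq_iff)
  qed
  thus "kmul a b U = 0" by (simp add: kmul_def sum.neutral)
qed

lemma degree_one_square: "degree_one a \<Longrightarrow> kmul a a = 0"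
proof
  fix U assume a: "degree_one a"
  show "kmul a a U = 0 U"
    using kmul_degree_one [OF a a] by (cases "\<exists>i j. i < j \<and> U = {i, j}") (auto simp: mult.commute)
qed

lemma degree_one_anticommute: "degree_one a \<Longrightarrow> degree_one b \<Longrightarrow> kmul a b = - kmul b a"
proof
  fix U assume a: "degree_one a" and b: "degree_one b"
  show "kmul a b U = (- kmul b a) U"
    using kmul_degree_one [OF a b] kmul_degree_one [OF b a]
    by (cases "\<exists>i j. i < j \<and> U = {i, j}") (auto simp: mult.commute)
qed

lemma rs_simps [simp]:
  "rs p (rs q a) = rs (p * q) a" "rs 1 a = a" "rs p 0 = 0" "rs 0 a = 0"
  "rs p (- a) = - rs p a" "rs (- p) a = - rs p a"
  by (auto simp: rs_def fun_eq_iff mult.assoc)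

lemma rs_add: "rs p (a + b) = rs p a + rs p b" "rs (p + q) a = rs p a + rs q a"
  by (auto simp: rs_def fun_eq_iff distrib_left distrib_right)

lemma rs_sum: "rs p (\<Sum>i\<in>I. f i) = (\<Sum>i\<in>I. rs p (f i))" "rs (\<Sum>i\<in>I. g i) a = (\<Sum>i\<in>I. rs (g i) a)"
  by (auto simp: rs_def fun_eq_iff fun_sum_apply sum_distrib_left sum_distrib_right)

lemma kmul_minus: "kmul (- a) b = - kmul a b" "kmul a (- b) = - kmul a b"
  by (auto simp: kmul_def fun_eq_iff sum_negf)

lemma kmul_zero [simp]: "kmul 0 b = 0" "kmul a 0 = 0"
  by (auto simp: kmul_def fun_eq_iff)

lemma kmul_sum: "kmul (\<Sum>i\<in>I. f i) b = (\<Sum>i\<in>I. kmul (f i) b)" "kmul a (\<Sum>i\<in>I. f i) = (\<Sum>i\<in>I. kmul a (f i))"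
  by (induction I rule: infinite_finite_induct) (simp_all add: kmul_add_left kmul_add_right)

lemma kd_zero [simp]: "kd r x 0 = 0"
  by (auto simp: kd_def contract_def fun_eq_iff)

lemma kd_minus: "kd r x (- a) = - kd r x a"
  using kd_rs [of r x "- 1" a] by simp

lemma kd_sum: "kd r x (\<Sum>i\<in>I. f i) = (\<Sum>i\<in>I. kd r x (f i))"
  by (induction I rule: infinite_finite_induct)
    (simp_all only: kd_add sum.infinite sum.empty sum.insert kd_zero not_False_eq_True)

text \<open>
  The ordered product of the vectors \<open>v i\<close>, the image of a basis monomial under the morphism that is
  given by \<open>v\<close> on generators.
\<close>

definition vprod :: "(nat \<Rightarrow> nat set \<Rightarrow> 'r::comm_ring_1) \<Rightarrow> nat set \<Rightarrow> nat set \<Rightarrow> 'r" where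
  "vprod v S = foldr (\<lambda>i. kmul (v i)) (sorted_list_of_set S) kone"

lemma vprod_empty [simp]: "vprod v {} = kone"
  by (simp add: vprod_def)

lemma vprod_insert_min:
  assumes "finite T" "\<forall>t\<in>T. i < t"
  shows "vprod v (insert i T) = kmul (v i) (vprod v T)"
proof -
  have "i \<notin> T" using assms by auto
  hence "sorted_list_of_set (insert i T) = insort i (sorted_list_of_set T)"
    using assms(1) by (simp add: sorted_list_of_set_insert)
  also have "\<dots> = i # sorted_list_of_set T"
    using assms by (intro insort_is_Cons) (auto simp: less_imp_le)
  finally show ?thesis by (simp add: vprod_def)
qed

lemma vprod_left:
  assumes v: "\<And>i. degree_one (v i)" and T: "finite T"
  shows "kmul (v i) (vprod v T) = (if i \<in> T then 0 else rs ((- 1) ^ below T i) (vprod v (insert i T)))"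
  using T
proof (induction T rule: finite_linorder_min_induct)
  case empty
  show ?case using vprod_insert_min [of "{}" i v] by simp
next
  case (insert b A)
  have VA: "vprod v (insert b A) = kmul (v b) (vprod v A)"
    using insert.hyps by (intro vprod_insert_min)
  consider "i = b" | "i < b" | "b < i" by linarith
  thus ?case
  proof cases
    case 1
    thus ?thesis using degree_one_square [OF v] by (simp add: VA kmul_assoc [symmetric])
  next
    case 2
    hence "\<forall>t\<in>insert b A. i < t" using insert.hyps(2) by auto
    moreover from this have "i \<notin> insert b A" "{j \<in> insert b A. j < i} = {}" by auto
    ultimately show ?thesis
      using vprod_insert_min [of "insert b A" i v] insert.hyps(1) by (simp only: finite_insert if_False) simp
  next
    case 3
    have "kmul (v i) (vprod v (insert b A)) = - kmul (v b) (kmul (v i) (vprod v A))"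
      by (simp add: VA kmul_assoc [symmetric] degree_one_anticommute [OF v v, of i b] kmul_minus)
    also have "\<dots> = (if i \<in> insert b A then 0 else rs ((- 1) ^ below (insert b A) i) (vprod v (insert i (insert b A))))"
    proof (cases "i \<in> A")
      case True
      hence "kmul (v i) (vprod v A) = 0" using insert.IH by (simp only: if_True)
      thus ?thesis using True by (simp only: kmul_zero insert_iff simp_thms if_True minus_zero)
    next
      case False
      have b: "b \<notin> A" using insert.hyps(2) by auto
      have "vprod v (insert i (insert b A)) = kmul (v b) (vprod v (insert i A))"
        using insert.hyps 3 by (subst insert_commute) (intro vprod_insert_min; auto)
      moreover have "below (insert b A) i = Suc (below A i)"
        using 3 b by (simp only: below_insert) simp
      ultimately show ?thesis
        using False 3 insert.IH by (simp only: insert_iff) (simp add: kmul_rs_right)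
    qed
    finally show ?thesis .
  qed
qed

text \<open>
  The products of any family of elements of degree one obey the multiplication table of the basis
  monomials, as they anticommute and have square zero. So morphisms out of the
  exterior algebra can be prescribed on generators.
\<close>

lemma vprod_mult:
  assumes v: "\<And>i. degree_one (v i)" and S: "finite S" and T: "finite T"
  shows "kmul (vprod v S) (vprod v T) =
    (if S \<inter> T = {} then rs ((- 1) ^ inv_count S T) (vprod v (S \<union> T)) else 0)"
  using S
proof (induction S rule: finite_linorder_min_induct)
  case empty
  have "kmul kone (vprod v T) = vprod v T"
  proof (cases "T = {}")
    case True
    thus ?thesis by (auto simp: fun_eq_iff kmul_kone_left kone_def)
  next
    case False
    then obtain b A where "T = insert b A" "finite A" "\<forall>t\<in>A. b < t"
    proof -
      have "T = insert (Min T) (T - {Min T})" using T False by (metis Min_in insert_Diff)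
      moreover have "\<forall>t\<in>T - {Min T}. Min T < t" using T Min_le by (fastforce simp: le_less)
      ultimately show ?thesis using that T by blast
    qed
    hence "vprod v T = kmul (v b) (vprod v A)" using vprod_insert_min by blast
    thus ?thesis by (auto simp: fun_eq_iff kmul_kone_left kmul_infinite)
  qed
  thus ?case by (simp add: inv_count_def)
next
  case (insert b A)
  have b: "b \<notin> A" using insert.hyps(2) by auto
  have VA: "vprod v (insert b A) = kmul (v b) (vprod v A)"
    using insert.hyps by (intro vprod_insert_min)
  show ?case
  proof (cases "A \<inter> T = {}")
    case False
    hence "insert b A \<inter> T \<noteq> {}" by blast
    thus ?thesis using False insert.IH by (simp only: VA kmul_assoc if_False kmul_zero)
  next
    case True
    have "kmul (vprod v (insert b A)) (vprod v T) = rs ((- 1) ^ inv_count A T) (kmul (v b) (vprod v (A \<union> T)))"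
      using insert.IH True by (simp add: VA kmul_assoc kmul_rs_right)
    also have "\<dots> = (if b \<in> A \<union> T then 0 else
        rs ((- 1) ^ (inv_count A T + below (A \<union> T) b)) (vprod v (insert b (A \<union> T))))"
    proof -
      have "finite (A \<union> T)" using insert.hyps(1) T by simp
      from vprod_left [where v = v and i = b, OF v this] show ?thesis
        by (simp only: power_add rs_simps(1, 3) if_distrib [of "rs _"])
    qed
    also have "below (A \<union> T) b = below T b"
    proof -
      have "{j \<in> A. j < b} = {}" using insert.hyps(2) by auto
      thus ?thesis using below_Un [OF insert.hyps(1) T True, of b] by simp
    qed
    also have "inv_count A T + below T b = inv_count (insert b A) T"
      using inv_count_insert_left [OF insert.hyps(1) T b] by simp
    finally show ?thesis using True b by auto
  qed
qed

lemma kd_vprod: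
  assumes v: "\<And>i. degree_one (v i)" and T: "finite T" "T \<subseteq> {..<r'}"
    and d: "\<And>i. i < r' \<Longrightarrow> kd r x (v i) = rs (y i) kone"
  shows "kd r x (vprod v T) = (\<Sum>i\<in>T. rs ((- 1) ^ below T i * y i) (vprod v (T - {i})))"
  using T
proof (induction T rule: finite_linorder_min_induct)
  case empty
  show ?case by (auto simp: kd_def contract_def kone_def fun_eq_iff)
next
  case (insert b A)
  have b: "b \<notin> A" using insert.hyps(2) by auto
  have sg: "ksg (v b) = - v b"
  proof
    fix S
    show "ksg (v b) S = (- v b) S"
      using v [of b] by (cases "v b S = 0") (auto simp: ksg_def degree_one_def)
  qed
  have one: "kmul kone (vprod v A) = vprod v A"
    using vprod_mult [OF v finite.emptyI insert.hyps(1)] by (simp add: inv_count_def)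
  have VA: "vprod v (insert b A) = kmul (v b) (vprod v A)"
    using insert.hyps by (intro vprod_insert_min)
  have "kd r x (vprod v (insert b A)) = rs (y b) (vprod v A) - kmul (v b) (kd r x (vprod v A))"
    using insert.prems by (simp add: VA kd_kmul sg d kmul_rs_left one kmul_minus)
  also have "kmul (v b) (kd r x (vprod v A)) =
      (\<Sum>i\<in>A. rs ((- 1) ^ below A i * y i) (vprod v (insert b A - {i})))"
  proof -
    have "kmul (v b) (vprod v (A - {i})) = vprod v (insert b A - {i})" if "i \<in> A" for i
    proof -
      have "insert b A - {i} = insert b (A - {i})" using that b by auto
      thus ?thesis using insert.hyps vprod_insert_min [of "A - {i}" b v] by simp
    qed
    thus ?thesis using insert by (simp add: kmul_sum kmul_rs_right)
  qed
  also have "\<dots> = - (\<Sum>i\<in>A. rs ((- 1) ^ below (insert b A) i * y i) (vprod v (insert b A - {i})))"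
  proof -
    have "below (insert b A) i = Suc (below A i)" if "i \<in> A" for i
      using that insert.hyps(2) b by (simp only: below_insert) simp
    thus ?thesis unfolding sum_negf [symmetric] by (intro sum.cong refl) simp
  qed
  also have "rs (y b) (vprod v A) = rs ((- 1) ^ below (insert b A) b * y b) (vprod v (insert b A - {b}))"
  proof -
    have "{j \<in> insert b A. j < b} = {}" "insert b A - {b} = A" using insert.hyps(2) b by auto
    thus ?thesis by (simp only: card.empty power_0 mult_1)
  qed
  finally show ?case using insert.hyps(1) b by simp
qed

definition unit_vec :: "nat \<Rightarrow> nat set \<Rightarrow> 'r::comm_ring_1" where
  "unit_vec i S = (if S = {i} then 1 else 0)"

lemma degree_one_unit_vec: "degree_one (unit_vec i)"
  by (simp add: degree_one_def unit_vec_def)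

lemma vprod_unit_vec:
  assumes "finite S" shows "vprod unit_vec S = (\<lambda>T. if T = S then 1 else 0)"
  using assms
proof (induction S rule: finite_linorder_min_induct)
  case empty
  show ?case by (simp add: kone_def fun_eq_iff)
next
  case (insert b A)
  have b: "b \<notin> A" using insert.hyps(2) by auto
  show ?case
  proof
    fix U
    have eq: "unit_vec b S * (if U - S = A then 1 else 0) = (if S = {b} \<and> U = insert b A then 1 else 0 :: 'a)"
      if "S \<subseteq> U" for S
      using that b by (auto simp: unit_vec_def)
    have "vprod unit_vec (insert b A) U = (\<Sum>S\<in>Pow U. (- 1) ^ inv_count S (U - S) *
        (if S = {b} \<and> U = insert b A then 1 else 0 :: 'a))"
      using insert.hyps by (simp add: vprod_insert_min insert.IH kmul_def eq)
    also have "\<dots> = (if U = insert b A then 1 else 0)"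
    proof (cases "U = insert b A")
      case True
      have "inv_count {b} A = 0" using insert.hyps by (simp add: inv_count_left not_less less_imp_le)
      hence "(\<Sum>S\<in>Pow U. (- 1) ^ inv_count S (U - S) * (if S = {b} \<and> U = insert b A then 1 else 0 :: 'a)) =
          (\<Sum>S\<in>Pow U. if S = {b} then 1 else 0)"
        using True b by (intro sum.cong refl) auto
      thus ?thesis using True insert.hyps(1) by simp
    qed simp
    finally show "vprod unit_vec (insert b A) U = (if U = insert b A then 1 else 0 :: 'a)" .
  qed
qed

section \<open>Morphisms of exterior algebras\<close>

definition kmap :: "nat \<Rightarrow> (nat \<Rightarrow> nat set \<Rightarrow> 'r::comm_ring_1) \<Rightarrow> (nat set \<Rightarrow> 'r) \<Rightarrow> nat set \<Rightarrow> 'r" where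
  "kmap r v a = (\<Sum>S\<in>Pow {..<r}. rs (a S) (vprod v S))"

lemma kmap_add: "kmap r v (a + b) = kmap r v a + kmap r v b"
  by (simp add: kmap_def rs_add sum.distrib)

lemma kmap_rs: "kmap r v (rs p a) = rs p (kmap r v a)"
  by (simp add: kmap_def rs_sum) (simp add: rs_def)

lemma kmap_zero [simp]: "kmap r v 0 = 0"
  by (simp add: kmap_def)

lemma kmap_sum: "kmap r v (\<Sum>i\<in>I. f i) = (\<Sum>i\<in>I. kmap r v (f i))"
  by (induction I rule: infinite_finite_induct)
    (simp_all only: kmap_add sum.infinite sum.empty sum.insert kmap_zero not_False_eq_True)

lemma kmap_kmul:
  assumes v: "\<And>i. degree_one (v i)"
  shows "kmap r v (kmul a b) = kmul (kmap r v a) (kmap r v b)"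
proof -
  let ?P = "Pow {..<r}"
  have fin: "finite S" if "S \<subseteq> {..<r}" for S :: "nat set" using that finite_subset by blast
  have "kmul (kmap r v a) (kmap r v b) = (\<Sum>S\<in>?P. \<Sum>T\<in>?P. rs (a S * b T) (kmul (vprod v S) (vprod v T)))"
    by (simp only: kmap_def kmul_sum(1) kmul_rs_left)
      (simp only: kmul_sum(2) kmul_rs_right rs_sum(1) rs_simps(1))
  also have "\<dots> = (\<Sum>S\<in>?P. \<Sum>T\<in>?P. if S \<inter> T = {} then rs ((- 1) ^ inv_count S T * (a S * b T)) (vprod v (S \<union> T)) else 0)"
    by (intro sum.cong refl) (auto simp: vprod_mult [OF v] fin mult_ac)
  also have "\<dots> = (\<Sum>(S, T)\<in>?P \<times> ?P. if S \<inter> T = {} then rs ((- 1) ^ inv_count S T * (a S * b T)) (vprod v (S \<union> T)) else 0)"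
    by (simp add: sum.cartesian_product)
  also have "\<dots> = (\<Sum>(S, T)\<in>{(S, T). S \<in> ?P \<and> T \<in> ?P \<and> S \<inter> T = {}}.
      rs ((- 1) ^ inv_count S T * (a S * b T)) (vprod v (S \<union> T)))"
    by (rule sum.mono_neutral_cong_right) (auto split: if_splits)
  also have "\<dots> = (\<Sum>(U, S)\<in>Sigma ?P Pow. rs ((- 1) ^ inv_count S (U - S) * (a S * b (U - S))) (vprod v U))"
    by (rule sum.reindex_bij_witness [where i = "\<lambda>(U, S). (S, U - S)" and j = "\<lambda>(S, T). (S \<union> T, S)"])
      (auto simp: Un_Diff Diff_triv Un_absorb1 Int_commute)
  also have "\<dots> = (\<Sum>U\<in>?P. \<Sum>S\<in>Pow U. rs ((- 1) ^ inv_count S (U - S) * (a S * b (U - S))) (vprod v U))"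
    using fin by (intro sum.Sigma [symmetric]) auto
  also have "\<dots> = kmap r v (kmul a b)"
    by (simp add: kmap_def kmul_def rs_sum)
  finally show ?thesis ..
qed

text \<open>
  A morphism of algebras commutes with differentials as soon as it does so on generators, where the
  differential takes scalar values \<open>y i\<close>.
\<close>

lemma kmap_kd:
  assumes v: "\<And>i. degree_one (v i)" and d: "\<And>i. i < r \<Longrightarrow> kd r' x (v i) = rs (y i) kone"
  shows "kmap r v (kd r y a) = kd r' x (kmap r v a)"
proof -
  let ?P = "Pow {..<r}"
  have fin: "finite S" if "S \<subseteq> {..<r}" for S :: "nat set" using that finite_subset by blast
  have "kd r' x (kmap r v a) = (\<Sum>S\<in>?P. \<Sum>i\<in>S. rs (a S * ((- 1) ^ below S i * y i)) (vprod v (S - {i})))"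
    unfolding kmap_def kd_sum
    by (intro sum.cong refl) (auto simp: kd_rs kd_vprod [OF v _ _ d] fin rs_sum)
  also have "\<dots> = (\<Sum>(S, i)\<in>Sigma ?P (\<lambda>S. S). rs (a S * ((- 1) ^ below S i * y i)) (vprod v (S - {i})))"
    using fin by (intro sum.Sigma) auto
  also have "\<dots> = (\<Sum>(U, i)\<in>Sigma ?P (\<lambda>U. {..<r} - U). rs (y i * ((- 1) ^ below U i * a (insert i U))) (vprod v U))"
  proof (rule sum.reindex_bij_witness [where i = "\<lambda>(U, i). (insert i U, i)" and j = "\<lambda>(S, i). (S - {i}, i)"],
      goal_cases)
    case (5 p)
    obtain S i where p: "p = (S, i)" "i \<in> S" using 5 by auto
    have "insert i (S - {i}) = S" "{j \<in> S - {i}. j < i} = {j \<in> S. j < i}" using p by auto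
    thus ?case by (simp only: p prod.case) (simp add: mult_ac)
  qed (auto simp: insert_absorb)
  also have "\<dots> = (\<Sum>U\<in>?P. \<Sum>i\<in>{..<r} - U. rs (y i * ((- 1) ^ below U i * a (insert i U))) (vprod v U))"
    by (intro sum.Sigma [symmetric]) auto
  also have "\<dots> = (\<Sum>U\<in>?P. rs (kd r y a U) (vprod v U))"
  proof (intro sum.cong refl)
    fix U assume U: "U \<in> ?P"
    have "kd r y a U = (\<Sum>i\<in>{..<r} - U. y i * ((- 1) ^ below U i * a (insert i U)))"
      unfolding kd_def
      by (rule sum.mono_neutral_cong_right) (use U fin in \<open>auto simp: contract_def\<close>)
    thus "(\<Sum>i\<in>{..<r} - U. rs (y i * ((- 1) ^ below U i * a (insert i U))) (vprod v U)) =
        rs (kd r y a U) (vprod v U)"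
      by (simp add: rs_sum)
  qed
  finally show ?thesis by (simp add: kmap_def)
qed

lemma kmap_kone: "kmap r v kone = kone"
proof -
  have "kmap r v kone = (\<Sum>S\<in>Pow {..<r}. if S = {} then kone else 0)"
    unfolding kmap_def by (intro sum.cong refl) (auto simp: kone_def)
  thus ?thesis by simp
qed

lemma kmap_vprod:
  assumes w: "\<And>i. degree_one (w i)" and S: "finite S"
  shows "kmap r w (vprod v S) = vprod (\<lambda>i. kmap r w (v i)) S"
  using S by (induction S rule: finite_linorder_min_induct)
    (auto simp: kmap_kone vprod_insert_min kmap_kmul [OF w])

lemma vprod_cong:
  assumes "finite S" "\<And>i. i \<in> S \<Longrightarrow> v i = w i"
  shows "vprod v S = vprod w S"
  using assms by (induction S rule: finite_linorder_min_induct) (auto simp: vprod_insert_min)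

text \<open>
  A composite of two morphisms is the identity if it fixes the generators.
\<close>

lemma kmap_inverse:
  assumes w: "\<And>i. degree_one (w i)" and vw: "\<And>i. i < r \<Longrightarrow> kmap r' w (v i) = unit_vec i"
    and a: "\<And>S. \<not> S \<subseteq> {..<r} \<Longrightarrow> a S = 0"
  shows "kmap r' w (kmap r v a) = a"
proof -
  have "kmap r' w (kmap r v a) = (\<Sum>S\<in>Pow {..<r}. rs (a S) (kmap r' w (vprod v S)))"
    by (simp add: kmap_def [of r] kmap_sum kmap_rs)
  also have "\<dots> = (\<Sum>S\<in>Pow {..<r}. rs (a S) (\<lambda>T. if T = S then 1 else 0))"
  proof (intro sum.cong refl)
    fix S assume "S \<in> Pow {..<r}"
    hence S: "S \<subseteq> {..<r}" "finite S" using finite_subset by auto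
    have "vprod (\<lambda>i. kmap r' w (v i)) S = vprod unit_vec S"
      using S vw by (intro vprod_cong) auto
    thus "rs (a S) (kmap r' w (vprod v S)) = rs (a S) (\<lambda>T. if T = S then 1 else 0)"
      using S by (simp add: kmap_vprod [OF w] vprod_unit_vec)
  qed
  also have "\<dots> = a"
  proof
    fix T
    have "(\<Sum>S\<in>Pow {..<r}. rs (a S) (\<lambda>T. if T = S then 1 else 0)) T = (\<Sum>S\<in>Pow {..<r}. if S = T then a T else 0)"
      unfolding fun_sum_apply by (intro sum.cong refl) (auto simp: rs_def)
    thus "(\<Sum>S\<in>Pow {..<r}. rs (a S) (\<lambda>T. if T = S then 1 else 0)) T = a T"
      using a [of T] by auto
  qed
  finally show ?thesis .
qed

section \<open>The ring of polynomials in finitely many variables\<close>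

abbreviation polys :: "nat \<Rightarrow> 'k::field mpoly set" where
  "polys m \<equiv> carrier (poly_ring m)"

lemma poly_ring_simps [simp]:
  "mult (poly_ring m) = (*)" "one (poly_ring m) = 1" "zero (poly_ring m) = 0" "add (poly_ring m) = (+)"
  by (simp_all add: poly_ring_def)

lemma polys_iff: "p \<in> polys m \<longleftrightarrow> (\<forall>k\<in>Poly_Mapping.keys p. Poly_Mapping.keys k \<subseteq> {..<m})"
  by (simp add: poly_ring_def)

lemma keys_add_nat: "Poly_Mapping.keys (a + b :: nat \<Rightarrow>\<^sub>0 nat) = Poly_Mapping.keys a \<union> Poly_Mapping.keys b"
  by (auto simp: in_keys_iff lookup_add)

lemma polys_add: "p \<in> polys m \<Longrightarrow> q \<in> polys m \<Longrightarrow> p + q \<in> polys m"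
  using keys_add [of p q] unfolding polys_iff by blast

lemma polys_mult: "p \<in> polys m \<Longrightarrow> q \<in> polys m \<Longrightarrow> p * q \<in> polys m"
  using keys_mult [of p q] unfolding polys_iff by (fastforce simp: keys_add_nat)

lemma polys_minus: "p \<in> polys m \<Longrightarrow> - p \<in> polys m"
  by (simp add: polys_iff keys_def)

lemma polys_diff: "p \<in> polys m \<Longrightarrow> q \<in> polys m \<Longrightarrow> p - q \<in> polys m"
  using polys_add [of p m "- q"] polys_minus [of q m] by simp

lemma polys_single: "Poly_Mapping.keys k \<subseteq> {..<m} \<Longrightarrow> Poly_Mapping.single k c \<in> polys m"
  by (auto simp: polys_iff)

lemma polys_const: "const c \<in> polys m"
  by (rule polys_single) simp

lemma polys_0: "0 \<in> polys m" and polys_1: "1 \<in> polys m"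
  using polys_const [of 0 m] polys_const [of 1 m] by simp_all

lemma polys_sum: "(\<And>i. i \<in> A \<Longrightarrow> f i \<in> polys m) \<Longrightarrow> sum f A \<in> polys m"
  by (induction A rule: infinite_finite_induct) (auto simp: polys_0 polys_add)

lemmas polys_closed = polys_add polys_mult polys_minus polys_diff polys_const polys_0 polys_1

lemma const_mult: "const (a * b) = const a * const b"
  by (simp add: mult_single)

lemma const_add: "const (a + b) = const a + const b"
  by (simp add: single_add)

lemma cring_poly_ring: "cring (poly_ring m)"
proof (rule cringI)
  show "abelian_group (poly_ring m)"
    by (rule abelian_groupI)
      (auto simp: polys_closed add_ac intro!: bexI [of _ "- x" for x])
  show "Group.comm_monoid (poly_ring m)"
    by (rule comm_monoidI) (auto simp: polys_closed mult_ac)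
qed (auto simp: polys_closed algebra_simps)

lemma ring_poly_ring: "ring (poly_ring m)"
  by (rule cring.axioms(1)) (rule cring_poly_ring)

lemma a_inv_poly_ring: "p \<in> polys m \<Longrightarrow> \<ominus>\<^bsub>poly_ring m\<^esub> p = - p"
  by (rule abelian_group.minus_equality [OF ring.axioms(1) [OF ring_poly_ring]])
    (auto simp: polys_closed)

lemma sum_single: "(p :: 'k::field mpoly) = (\<Sum>k\<in>Poly_Mapping.keys p. Poly_Mapping.single k (Poly_Mapping.lookup p k))"
  by (rule poly_mapping_eqI) (auto simp: lookup_sum lookup_single when_def in_keys_iff)

lemma mpoly_induct:
  assumes "\<And>k c. P (Poly_Mapping.single k c)" "P 0" "\<And>p q. P p \<Longrightarrow> P q \<Longrightarrow> P (p + q)"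
  shows "P (p :: 'k::field mpoly)"
proof -
  have "P (\<Sum>k\<in>A. Poly_Mapping.single k (Poly_Mapping.lookup p k))" if "finite A" for A
    using that by induction (auto intro: assms)
  thus ?thesis using sum_single [of p] by (metis finite_keys)
qed

section \<open>Homogeneous parts\<close>

lemma mdeg_eq: "finite A \<Longrightarrow> Poly_Mapping.keys k \<subseteq> A \<Longrightarrow> mdeg k = (\<Sum>i\<in>A. Poly_Mapping.lookup k i)"
  unfolding mdeg_def by (rule sum.mono_neutral_left) (auto simp: in_keys_iff)

lemma mdeg_add: "mdeg (a + b) = mdeg a + mdeg b"
proof -
  let ?A = "Poly_Mapping.keys a \<union> Poly_Mapping.keys b"
  have "mdeg (a + b) = (\<Sum>i\<in>?A. Poly_Mapping.lookup (a + b) i)" by (rule mdeg_eq) (auto simp: keys_add_nat)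
  also have "\<dots> = mdeg a + mdeg b"
    using mdeg_eq [of ?A a] mdeg_eq [of ?A b] by (simp add: lookup_add sum.distrib)
  finally show ?thesis .
qed

lemma mdeg_0_iff: "mdeg k = 0 \<longleftrightarrow> k = 0"
  by (auto simp: mdeg_def) (metis in_keys_iff poly_mapping_eqI lookup_zero)

abbreviation vmon :: "nat \<Rightarrow> nat \<Rightarrow>\<^sub>0 nat" where
  "vmon i \<equiv> Poly_Mapping.single i 1"

lemma mdeg_vmon: "mdeg (vmon i) = 1"
  by (simp add: mdeg_def)

lemmas mdeg_vmon_Suc = mdeg_vmon [unfolded One_nat_def]

lemma mdeg_1E:
  assumes "mdeg k = 1" obtains i where "k = vmon i"
proof -
  have "k \<noteq> 0" using assms by (auto simp: mdeg_def)
  then obtain i where i: "i \<in> Poly_Mapping.keys k" by (metis keys_eq_empty equals0I)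
  have le: "vmon i + (k - vmon i) = k"
    using i by (intro poly_mapping_eqI) (auto simp: lookup_add lookup_minus lookup_single when_def in_keys_iff)
  hence "mdeg (k - vmon i) = 0" using mdeg_add [of "vmon i" "k - vmon i"] assms mdeg_vmon by simp
  hence "k = vmon i" using le by (simp add: mdeg_0_iff)
  thus ?thesis by (rule that)
qed

definition part :: "nat \<Rightarrow> 'k::field mpoly \<Rightarrow> 'k mpoly" where
  "part e p = (\<Sum>k\<in>{k \<in> Poly_Mapping.keys p. mdeg k = e}. Poly_Mapping.single k (Poly_Mapping.lookup p k))"

lemma lookup_part: "Poly_Mapping.lookup (part e p) k = (if mdeg k = e then Poly_Mapping.lookup p k else 0)"
  by (auto simp: part_def lookup_sum lookup_single when_def in_keys_iff)

lemma part_add: "part e (p + q) = part e p + part e q"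
  by (rule poly_mapping_eqI) (simp add: lookup_part lookup_add)

lemma part_0 [simp]: "part e 0 = 0"
  by (rule poly_mapping_eqI) (simp add: lookup_part)

lemma part_diff: "part e (p - q) = part e p - part e q"
  by (rule poly_mapping_eqI) (simp add: lookup_part lookup_minus)

lemma part_sum: "part e (\<Sum>i\<in>A. f i) = (\<Sum>i\<in>A. part e (f i))"
  by (induction A rule: infinite_finite_induct) (auto simp: part_add)

lemma part_single: "part e (Poly_Mapping.single k c) = (if mdeg k = e then Poly_Mapping.single k c else 0)"
  by (rule poly_mapping_eqI) (auto simp: lookup_part lookup_single when_def)

lemma part_zero_eq: "part 0 p = const (Poly_Mapping.lookup p 0)"
  by (rule poly_mapping_eqI) (auto simp: lookup_part lookup_single when_def mdeg_0_iff)

lemma part_0_mult: "part 0 (p * q) = part 0 p * part 0 q"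
proof (induction p rule: mpoly_induct)
  case (1 k c)
  show ?case
    by (induction q rule: mpoly_induct) (auto simp: mult_single part_single mdeg_add distrib_left part_add)
qed (auto simp: distrib_right part_add)

lemma part_1_mult: "part 1 (p * q) = part 0 p * part 1 q + part 1 p * part 0 q"
proof (induction p rule: mpoly_induct)
  case (1 k c)
  show ?case
    by (induction q rule: mpoly_induct)
      (auto simp: mult_single part_single mdeg_add distrib_left part_add add_is_1 algebra_simps)
qed (auto simp: distrib_right part_add algebra_simps)

lemmas part_1_mult_Suc = part_1_mult [unfolded One_nat_def]

lemma lookup_mult_0: "Poly_Mapping.lookup (p * q) 0 = Poly_Mapping.lookup p 0 * Poly_Mapping.lookup (q :: 'k::field mpoly) 0"
proof -
  have "Poly_Mapping.lookup (part 0 (p * q)) 0 = Poly_Mapping.lookup (part 0 p * part 0 q) 0"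
    by (simp only: part_0_mult)
  thus ?thesis by (simp add: lookup_part mdeg_0_iff part_zero_eq mult_single)
qed

lemma part_in_polys: "p \<in> polys m \<Longrightarrow> part e p \<in> polys m"
  by (auto simp: polys_iff in_keys_iff lookup_part split: if_splits)

lemma part_in_forms: "p \<in> polys m \<Longrightarrow> part e p \<in> forms m e"
  using part_in_polys [of p m e] by (auto simp: forms_def in_keys_iff lookup_part split: if_splits)

lemma part_forms: "p \<in> forms m e \<Longrightarrow> part e' p = (if e = e' then p else 0)"
  by (rule poly_mapping_eqI) (auto simp: forms_def lookup_part in_keys_iff)

lemma forms_polys: "p \<in> forms m e \<Longrightarrow> p \<in> polys m"
  by (simp add: forms_def)

lemma forms_add: "p \<in> forms m e \<Longrightarrow> q \<in> forms m e \<Longrightarrow> p + q \<in> forms m e"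
  using part_in_forms [of "p + q" m e] by (simp add: part_add part_forms forms_polys polys_add)

lemma forms_zero: "0 \<in> forms m e"
  by (simp add: forms_def polys_0)

lemma forms_const_mult: "p \<in> forms m 1 \<Longrightarrow> const c * p \<in> forms m 1"
  using part_in_forms [of "const c * p" m 1] part_1_mult [of "const c" p]
  by (auto simp: part_forms part_single mdeg_0_iff forms_polys polys_closed)

lemma forms_sum: "(\<And>i. i \<in> A \<Longrightarrow> f i \<in> forms m e) \<Longrightarrow> sum f A \<in> forms m e"
  by (induction A rule: infinite_finite_induct) (auto simp: forms_add forms_zero)

abbreviation var :: "nat \<Rightarrow> 'k::field mpoly" where
  "var i \<equiv> Poly_Mapping.single (vmon i) 1"

lemma var_forms: "i < m \<Longrightarrow> var i \<in> forms m 1"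
  by (auto simp: forms_def mdeg_vmon_Suc polys_single)

lemma linear_form_eq:
  assumes "l \<in> forms m 1"
  shows "l = (\<Sum>i<m. const (Poly_Mapping.lookup l (vmon i)) * var i)"
proof (rule poly_mapping_eqI)
  fix k
  have vm: "vmon i = vmon j \<longleftrightarrow> i = j" for i j
    by (metis lookup_single_eq lookup_single_not_eq zero_neq_one)
  have "Poly_Mapping.lookup (\<Sum>i<m. const (Poly_Mapping.lookup l (vmon i)) * var i) k =
      (\<Sum>i<m. if vmon i = k then Poly_Mapping.lookup l k else 0)"
    unfolding lookup_sum by (intro sum.cong refl) (auto simp: mult_single lookup_single when_def)
  also have "\<dots> = Poly_Mapping.lookup l k"
  proof (cases "k \<in> Poly_Mapping.keys l")
    case True
    hence "mdeg k = 1" "Poly_Mapping.keys k \<subseteq> {..<m}" using assms by (auto simp: forms_def polys_iff)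
    then obtain i where "k = vmon i" "i < m" by (metis mdeg_1E keys_single insert_subset lessThan_iff one_neq_zero)
    thus ?thesis by (simp add: vm [unfolded One_nat_def])
  next
    case False
    thus ?thesis by (auto simp: in_keys_iff intro!: sum.neutral)
  qed
  finally show "Poly_Mapping.lookup l k = Poly_Mapping.lookup (\<Sum>i<m. const (Poly_Mapping.lookup l (vmon i)) * var i) k" ..
qed

section \<open>Ideals\<close>

lemma ideal_poly_ringI:
  fixes J :: "'k::field mpoly set"
  assumes "J \<subseteq> polys m" "0 \<in> J" "\<And>a b. a \<in> J \<Longrightarrow> b \<in> J \<Longrightarrow> a + b \<in> J"
    "\<And>r a. r \<in> polys m \<Longrightarrow> a \<in> J \<Longrightarrow> r * a \<in> J"
  shows "ideal J (poly_ring m)"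
proof (rule idealI)
  show "ring (poly_ring m :: 'k mpoly ring)" by (rule ring_poly_ring)
  have "- a \<in> J" if "a \<in> J" for a
    using assms(4) [OF polys_minus [OF polys_1] that] by simp
  moreover have "a_inv (poly_ring m) a = - a" if "a \<in> J" for a
    using that assms(1) a_inv_poly_ring by blast
  ultimately show "subgroup J (add_monoid (poly_ring m))"
    using assms by (intro subgroup.intro) (auto simp: a_inv_def)
next
  fix a x :: "'k mpoly" assume "a \<in> J" "x \<in> carrier (poly_ring m)"
  thus "x \<otimes>\<^bsub>poly_ring m\<^esub> a \<in> J" "a \<otimes>\<^bsub>poly_ring m\<^esub> x \<in> J"
    using assms(4) [of x a] by (simp_all add: mult.commute)
qed

lemma ideal_poly_ringD:
  fixes J :: "'k::field mpoly set"
  assumes "ideal J (poly_ring m)"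
  shows "J \<subseteq> polys m" "0 \<in> J" "a \<in> J \<Longrightarrow> b \<in> J \<Longrightarrow> a + b \<in> J"
    "r \<in> polys m \<Longrightarrow> a \<in> J \<Longrightarrow> r * a \<in> J" "a \<in> J \<Longrightarrow> r \<in> polys m \<Longrightarrow> a * r \<in> J" "a \<in> J \<Longrightarrow> - a \<in> J"
    "a \<in> J \<Longrightarrow> b \<in> J \<Longrightarrow> a - b \<in> J"
proof -
  interpret ideal J "poly_ring m" by fact
  show J: "J \<subseteq> polys m" using a_subset .
  show "0 \<in> J" using additive_subgroup.zero_closed [OF is_additive_subgroup] by simp
  show add: "a + b \<in> J" if "a \<in> J" "b \<in> J" for a b
    using additive_subgroup.a_closed [OF is_additive_subgroup that] by simp
  show mult: "r * a \<in> J" if "r \<in> polys m" "a \<in> J" for r a using I_l_closed [of a r] that by simp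
  show "a * r \<in> J" if "a \<in> J" "r \<in> polys m" for r a
    using mult [OF that(2, 1)] by (simp only: mult.commute)
  show neg: "- a \<in> J" if "a \<in> J" for a
    using mult [OF polys_minus [OF polys_1] that] by simp
  show "a - b \<in> J" if "a \<in> J" "b \<in> J" for a b
    using add [of a "- b"] neg that by simp
qed

lemma ideal_sum: "ideal J (poly_ring m) \<Longrightarrow> (\<And>i. i \<in> A \<Longrightarrow> f i \<in> J) \<Longrightarrow> sum f A \<in> J"
  by (induction A rule: infinite_finite_induct) (auto simp: ideal_poly_ringD)

lemma genideal_ideal: "F \<subseteq> polys m \<Longrightarrow> ideal (Idl\<^bsub>poly_ring m\<^esub> F) (poly_ring m)"
  and genideal_self: "F \<subseteq> polys m \<Longrightarrow> F \<subseteq> Idl\<^bsub>poly_ring m\<^esub> F"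
  by (simp_all add: ring.genideal_ideal [OF ring_poly_ring] ring.genideal_self [OF ring_poly_ring])

lemma genideal_minimal: "ideal J (poly_ring m) \<Longrightarrow> F \<subseteq> J \<Longrightarrow> Idl\<^bsub>poly_ring m\<^esub> F \<subseteq> J"
  by (rule ring.genideal_minimal [OF ring_poly_ring])

lemma graded_max_subset:
  fixes J :: "'k::field mpoly set"
  assumes J: "ideal J (poly_ring m)" and v: "\<And>i. i < m \<Longrightarrow> var i \<in> J"
  shows "graded_max_ideal m \<subseteq> J"
proof
  fix p :: "'k mpoly" assume "p \<in> graded_max_ideal m"
  hence p: "p \<in> polys m" "Poly_Mapping.lookup p 0 = 0" by (auto simp: graded_max_ideal_def)
  have "Poly_Mapping.single k (Poly_Mapping.lookup p k) \<in> J" if k: "k \<in> Poly_Mapping.keys p" for k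
  proof -
    have "k \<noteq> 0" using k p(2) by (auto simp: in_keys_iff)
    then obtain i where i: "i \<in> Poly_Mapping.keys k" by (metis keys_eq_empty equals0I)
    have km: "Poly_Mapping.keys k \<subseteq> {..<m}" using k p(1) by (auto simp: polys_iff)
    have eq: "(k - vmon i) + vmon i = k"
      using i by (intro poly_mapping_eqI) (auto simp: lookup_add lookup_minus lookup_single when_def in_keys_iff)
    hence "Poly_Mapping.keys (k - vmon i) \<subseteq> Poly_Mapping.keys k" by (metis keys_add_nat Un_upper1)
    hence "Poly_Mapping.single (k - vmon i) (Poly_Mapping.lookup p k) \<in> polys m" using km by (intro polys_single) auto
    hence "Poly_Mapping.single (k - vmon i) (Poly_Mapping.lookup p k) * var i \<in> J"
      using v i km by (intro ideal_poly_ringD(4) [OF J]) auto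
    thus ?thesis by (simp only: mult_single eq mult_1_right)
  qed
  hence "(\<Sum>k\<in>Poly_Mapping.keys p. Poly_Mapping.single k (Poly_Mapping.lookup p k)) \<in> J"
    by (intro ideal_sum [OF J])
  thus "p \<in> J" using sum_single [of p] by simp
qed

text \<open>
  Two consequences of being homogeneous and proper that concern the constant and the linear
  parts; they pass to images and suffice for the arguments with linear forms.
\<close>

definition graded_proper :: "nat \<Rightarrow> 'k::field mpoly set \<Rightarrow> bool" where
  "graded_proper m I \<longleftrightarrow> ideal I (poly_ring m) \<and> I \<subseteq> graded_max_ideal m \<and> (\<forall>p\<in>I. part 1 p \<in> I)"

lemma homogeneous_ideal_part:
  fixes I :: "'k::field mpoly set"
  assumes "homogeneous_ideal m I" "p \<in> I"
  shows "part 0 p \<in> I" "part 1 p \<in> I"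
proof -
  obtain F where F: "F \<subseteq> homogeneous_elements m" "I = Idl\<^bsub>poly_ring m\<^esub> F"
    using assms(1) by (auto simp: homogeneous_ideal_def)
  have Fp: "F \<subseteq> polys m" using F(1) by (auto simp: homogeneous_elements_def forms_def)
  have I: "ideal I (poly_ring m)" using genideal_ideal [OF Fp] F(2) by simp
  note D = ideal_poly_ringD [OF I]
  let ?J = "{p \<in> I. part 0 p \<in> I \<and> part 1 p \<in> I}"
  have "ideal ?J (poly_ring m)"
  proof (rule ideal_poly_ringI)
    fix r a :: "'k mpoly" assume r: "r \<in> polys m" and a: "a \<in> ?J"
    thus "r * a \<in> ?J"
      using D part_in_polys [OF r] by (simp add: part_0_mult part_1_mult_Suc)
  qed (use D in \<open>auto simp: part_add\<close>)
  moreover have "F \<subseteq> ?J"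
  proof
    fix f assume f: "f \<in> F"
    then obtain e where "f \<in> forms m e" using F(1) by (auto simp: homogeneous_elements_def)
    moreover have "f \<in> I" using genideal_self [OF Fp] F(2) f by blast
    ultimately show "f \<in> ?J" using D(2) by (simp add: part_forms)
  qed
  ultimately have "I \<subseteq> ?J" unfolding F(2) by (rule genideal_minimal)
  thus "part 0 p \<in> I" "part 1 p \<in> I" using assms(2) by auto
qed

lemma graded_properI:
  assumes "homogeneous_ideal m I" "I \<noteq> polys m"
  shows "graded_proper m I"
proof -
  obtain F where F: "F \<subseteq> homogeneous_elements m" "I = Idl\<^bsub>poly_ring m\<^esub> F"
    using assms(1) by (auto simp: homogeneous_ideal_def)
  have "F \<subseteq> polys m" using F(1) by (auto simp: homogeneous_elements_def forms_def)
  hence I: "ideal I (poly_ring m)" using genideal_ideal F(2) by simp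
  note D = ideal_poly_ringD [OF I]
  have "Poly_Mapping.lookup p 0 = 0" if "p \<in> I" for p
  proof (rule ccontr)
    let ?c = "Poly_Mapping.lookup p 0"
    assume "?c \<noteq> 0"
    have "const ?c \<in> I" using homogeneous_ideal_part(1) [OF assms(1) that] by (simp add: part_zero_eq)
    hence "const (inverse ?c) * const ?c \<in> I" using D(4) polys_const by blast
    hence "1 \<in> I" using \<open>?c \<noteq> 0\<close> by (simp add: mult_single)
    hence "r \<in> I" if "r \<in> polys m" for r using D(4) [OF that] by fastforce
    thus False using assms(2) D(1) by blast
  qed
  thus ?thesis
    using I D(1) homogeneous_ideal_part(2) [OF assms(1)] by (auto simp: graded_proper_def graded_max_ideal_def)
qed

section \<open>The Koszul complex over a quotient of the polynomial ring\<close>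

text \<open>
  The Koszul complex on \<open>r\<close> elements of \<open>R/I\<close>, before passing to the quotient: chains
  have coefficients in the polynomial ring, and those with coefficients in \<open>I\<close> are to be
  identified with zero.
\<close>

definition kcarrier :: "nat \<Rightarrow> nat \<Rightarrow> (nat set \<Rightarrow> 'k::field mpoly) set" where
  "kcarrier m r = {a. (\<forall>S. a S \<in> polys m) \<and> (\<forall>S. \<not> S \<subseteq> {..<r} \<longrightarrow> a S = 0)}"

definition kideal :: "nat \<Rightarrow> 'k::field mpoly set \<Rightarrow> nat \<Rightarrow> (nat set \<Rightarrow> 'k mpoly) set" where
  "kideal m I r = {a \<in> kcarrier m r. \<forall>S. a S \<in> I}"

definition kscale :: "'k::field \<Rightarrow> (nat set \<Rightarrow> 'k mpoly) \<Rightarrow> nat set \<Rightarrow> 'k mpoly" where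
  "kscale c = rs (const c)"

text \<open>
  The augmentation \<open>R \<rightarrow> k\<close> on the component of degree zero. It is compatible with the differential
  because the differential takes values in the maximal ideal there.
\<close>

definition kaug :: "(nat set \<Rightarrow> 'k::field mpoly) \<Rightarrow> 'k" where
  "kaug a = Poly_Mapping.lookup (a {}) 0"

definition kcomp :: "nat \<Rightarrow> (nat set \<Rightarrow> 'r::zero) \<Rightarrow> nat set \<Rightarrow> 'r" where
  "kcomp i a S = (if card S = i then a S else 0)"

lemma nth_graded_max:
  assumes "set xs \<subseteq> graded_max_ideal m" "i < length xs"
  shows "xs ! i \<in> polys m" "Poly_Mapping.lookup (xs ! i) 0 = 0"
proof -
  have "xs ! i \<in> graded_max_ideal m" using assms nth_mem by blast
  thus "xs ! i \<in> polys m" "Poly_Mapping.lookup (xs ! i) 0 = 0" by (simp_all add: graded_max_ideal_def)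
qed

lemma kcarrierI: "(\<And>S. a S \<in> polys m) \<Longrightarrow> (\<And>S. \<not> S \<subseteq> {..<r} \<Longrightarrow> a S = 0) \<Longrightarrow> a \<in> kcarrier m r"
  by (simp add: kcarrier_def)

lemma kcarrierD: "a \<in> kcarrier m r \<Longrightarrow> a S \<in> polys m" "a \<in> kcarrier m r \<Longrightarrow> \<not> S \<subseteq> {..<r} \<Longrightarrow> a S = 0"
  by (simp_all add: kcarrier_def)

lemma kidealI: "a \<in> kcarrier m r \<Longrightarrow> (\<And>S. a S \<in> I) \<Longrightarrow> a \<in> kideal m I r"
  by (simp add: kideal_def)

lemma kidealD: "a \<in> kideal m I r \<Longrightarrow> a \<in> kcarrier m r" "a \<in> kideal m I r \<Longrightarrow> a S \<in> I"
  by (simp_all add: kideal_def)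

lemma polys_sign: "p \<in> polys m \<Longrightarrow> (- 1) ^ n * p \<in> polys m"
  by (cases "even n") (auto simp: polys_minus)

lemma ideal_sign: "ideal I (poly_ring m) \<Longrightarrow> p \<in> I \<Longrightarrow> (- 1) ^ n * p \<in> I"
  by (cases "even n") (auto simp: ideal_poly_ringD)

lemma kmul_kcarrier:
  assumes "a \<in> kcarrier m r" "b \<in> kcarrier m r"
  shows "kmul a b \<in> kcarrier m r"
proof (rule kcarrierI)
  fix U
  show "kmul a b U \<in> polys m"
    unfolding kmul_def
    by (intro polys_sum polys_sign polys_mult kcarrierD(1) [OF assms(1)] kcarrierD(1) [OF assms(2)])
  assume U: "\<not> U \<subseteq> {..<r}"
  have "\<not> S \<subseteq> {..<r} \<or> \<not> U - S \<subseteq> {..<r}" for S using U by blast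
  hence "a S * b (U - S) = 0" for S using kcarrierD(2) assms by (metis mult_eq_0_iff)
  thus "kmul a b U = 0" by (simp add: kmul_def)
qed

lemma contract_kcarrier: "a \<in> kcarrier m r \<Longrightarrow> contract i a \<in> kcarrier m r"
  by (rule kcarrierI) (auto simp: contract_def polys_0 kcarrierD intro!: polys_sign)

lemma kd_kcarrier:
  assumes "\<And>i. i < r' \<Longrightarrow> x i \<in> polys m" "a \<in> kcarrier m r"
  shows "kd r' x a \<in> kcarrier m r"
proof (rule kcarrierI)
  note c = contract_kcarrier [OF assms(2)]
  show "kd r' x a S \<in> polys m" for S
    unfolding kd_def using assms(1) kcarrierD(1) [OF c] by (intro polys_sum polys_mult) auto
  show "kd r' x a S = 0" if "\<not> S \<subseteq> {..<r}" for S
    unfolding kd_def using kcarrierD(2) [OF c that] by (intro sum.neutral) simp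
qed

lemma ksg_kcarrier: "a \<in> kcarrier m r \<Longrightarrow> ksg a \<in> kcarrier m r"
  by (rule kcarrierI) (auto simp: ksg_def kcarrierD intro!: polys_sign)

lemma kcarrier_add: "a \<in> kcarrier m r \<Longrightarrow> b \<in> kcarrier m r \<Longrightarrow> a + b \<in> kcarrier m r"
  by (simp add: kcarrier_def polys_add)

lemma kcarrier_rs: "p \<in> polys m \<Longrightarrow> a \<in> kcarrier m r \<Longrightarrow> rs p a \<in> kcarrier m r"
  by (simp add: kcarrier_def rs_def polys_mult)

lemma kcarrier_0: "0 \<in> kcarrier m r"
  by (simp add: kcarrier_def polys_0)

lemma vector_space_kscale: "vector_space (kscale :: 'k::field \<Rightarrow> _)"
proof
  fix a b :: 'k and x y :: "nat set \<Rightarrow> 'k mpoly"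
  show "kscale a (x + y) = kscale a x + kscale a y" by (simp add: kscale_def rs_add)
  show "kscale (a + b) x = kscale a x + kscale b x" by (simp add: kscale_def const_add rs_add)
  show "kscale a (kscale b x) = kscale (a * b) x" by (simp add: kscale_def const_mult)
  show "kscale 1 x = x" by (simp add: kscale_def)
qed

lemma dg_koszul:
  fixes I :: "'k::field mpoly set"
  assumes I: "ideal I (poly_ring m)" "I \<subseteq> graded_max_ideal m" and xs: "set xs \<subseteq> graded_max_ideal m"
  shows "dg_subquotient kscale kmul (kd (length xs) ((!) xs)) ksg kaug (kcarrier m (length xs)) (kideal m I (length xs))"
proof -
  interpret V: vector_space "kscale :: 'k \<Rightarrow> _" by (rule vector_space_kscale)
  note D = ideal_poly_ringD [OF I(1)]
  let ?r = "length xs" let ?x = "(!) xs"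
  have x: "?x i \<in> polys m" "Poly_Mapping.lookup (?x i) 0 = 0" if "i < ?r" for i
    using nth_graded_max [OF xs that] by simp_all
  have subC: "V.subspace (kcarrier m ?r)"
    unfolding V.subspace_def by (auto simp: kcarrier_0 kcarrier_add kscale_def kcarrier_rs polys_const)
  show ?thesis
  proof (unfold_locales, goal_cases)
    case (6 a b) show ?case by (rule kd_add)
  next
    case (19 a)
    have "(kd ?r ?x a) {} = (\<Sum>i<?r. ?x i * contract i a {})" by (simp add: kd_def)
    thus ?case using x by (simp add: kaug_def lookup_sum lookup_mult_0)
  next
    case 20 show ?case by (rule subC)
  next
    case (21 a b) thus ?case by (rule kmul_kcarrier)
  next
    case (22 a) thus ?case using x by (intro kd_kcarrier)
  next
    case (23 a) thus ?case by (rule ksg_kcarrier)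
  next
    case 24
    show ?case
      unfolding V.subspace_def
      using subC D(2, 3) D(4) [OF polys_const] by (auto simp: V.subspace_def kideal_def kscale_def rs_def)
  next
    case 25 show ?case by (auto simp: kideal_def)
  next
    case (26 a b)
    show ?case unfolding kideal_def mem_Collect_eq kmul_def
    proof (intro conjI allI)
      show "(\<lambda>U. \<Sum>S\<in>Pow U. (- 1) ^ inv_count S (U - S) * (a S * b (U - S))) \<in> kcarrier m ?r"
        using kmul_kcarrier [of a m ?r b] 26 by (simp add: kidealD kmul_def [abs_def])
    qed (intro ideal_sum [OF I(1)] ideal_sign [OF I(1)] D(5); use 26 in \<open>auto simp: kidealD kcarrierD\<close>)
  next
    case (27 a b)
    show ?case unfolding kideal_def mem_Collect_eq kmul_def
    proof (intro conjI allI)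
      show "(\<lambda>U. \<Sum>S\<in>Pow U. (- 1) ^ inv_count S (U - S) * (a S * b (U - S))) \<in> kcarrier m ?r"
        using kmul_kcarrier [of a m ?r b] 27 by (simp add: kidealD kmul_def [abs_def])
    qed (intro ideal_sum [OF I(1)] ideal_sign [OF I(1)] D(4); use 27 in \<open>auto simp: kidealD kcarrierD\<close>)
  next
    case (28 a)
    have "contract i a U \<in> I" for i U
      using 28 D(2) by (auto simp: contract_def kidealD intro!: ideal_sign [OF I(1)])
    hence "kd ?r ?x a U \<in> I" for U
      unfolding kd_def using x D(4) by (intro ideal_sum [OF I(1)]) auto
    thus ?case using kd_kcarrier [of ?r ?x m a ?r] x 28 by (auto intro!: kidealI simp: kidealD)
  next
    case (29 a)
    have "ksg a S \<in> I" for S unfolding ksg_def by (rule ideal_sign [OF I(1) kidealD(2) [OF 29]])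
    thus ?case using ksg_kcarrier [OF kidealD(1) [OF 29]] by (rule kidealI [rotated])
  next
    case (30 a)
    thus ?case using I(2) by (auto simp: kaug_def kideal_def graded_max_ideal_def)
  qed (simp_all add: kmul_add_left kmul_add_right kmul_assoc kscale_def kmul_rs_left kmul_rs_right
      kd_rs kd_kd ksg_ksg ksg_kmul kd_ksg kd_kmul kaug_def lookup_add lookup_mult_0 rs_def kmul_def inv_count_def
      , (simp_all add: ksg_def fun_eq_iff rs_def distrib_left distrib_right mult_ac)?)
qed

definition koszul_massey_trivial :: "nat \<Rightarrow> 'k::field mpoly set \<Rightarrow> 'k mpoly list \<Rightarrow> bool" where
  "koszul_massey_trivial m I xs = dg_subquotient.massey_trivial kmul (kd (length xs) ((!) xs)) ksg kaug
     (kcarrier m (length xs)) (kideal m I (length xs))"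

context
  fixes m :: nat and I :: "'k::field mpoly set"
  assumes I: "ideal I (poly_ring m)"
begin

abbreviation (input) QI where "QI \<equiv> poly_ring m Quot I"
abbreviation (input) qI where "qI \<equiv> \<lambda>p. I +>\<^bsub>poly_ring m\<^esub> p"

lemma quot_hom: "ring_hom_ring (poly_ring m) QI qI"
  using ideal.rcos_ring_hom_ring [OF I] by simp

lemma quot_carrier: "carrier QI = qI ` polys m"
  unfolding FactRing_def A_RCOSETS_def' by auto

lemma quot_eq_iff: "a \<in> polys m \<Longrightarrow> b \<in> polys m \<Longrightarrow> qI a = qI b \<longleftrightarrow> a - b \<in> I"
  using ring.quotient_eq_iff_same_a_r_cos [OF ring_poly_ring I, of a b]
  by (simp add: a_minus_def a_inv_poly_ring)

lemma quot_simps: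
  assumes "a \<in> polys m" "b \<in> polys m"
  shows "qI a \<oplus>\<^bsub>QI\<^esub> qI b = qI (a + b)" "qI a \<otimes>\<^bsub>QI\<^esub> qI b = qI (a * b)" "\<ominus>\<^bsub>QI\<^esub> qI a = qI (- a)" "\<zero>\<^bsub>QI\<^esub> = qI 0"
proof -
  interpret ring_hom_ring "poly_ring m" QI qI by (rule quot_hom)
  show "qI a \<oplus>\<^bsub>QI\<^esub> qI b = qI (a + b)" "qI a \<otimes>\<^bsub>QI\<^esub> qI b = qI (a * b)"
    using hom_add [of a b] hom_mult [of a b] assms by simp_all
  show "\<ominus>\<^bsub>QI\<^esub> qI a = qI (- a)"
    using hom_a_inv [of a] assms by (simp add: a_inv_poly_ring)
  show "\<zero>\<^bsub>QI\<^esub> = qI 0" using hom_zero by simp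
qed

lemma quot_zero: "\<zero>\<^bsub>QI\<^esub> = qI 0"
  using quot_simps(4) [OF polys_0 polys_0] .

lemma quot_sum:
  assumes "\<And>i. i \<in> A \<Longrightarrow> f i \<in> polys m"
  shows "(\<Oplus>\<^bsub>QI\<^esub>i\<in>A. qI (f i)) = qI (\<Sum>i\<in>A. f i)"
proof -
  interpret QI: ring QI using quot_hom by (simp add: ring_hom_ring_def)
  show ?thesis using assms
  proof (induction A rule: infinite_finite_induct)
    case (infinite A) thus ?case by (simp add: QI.add.finprod_infinite quot_zero)
  next
    case empty show ?case by (simp add: quot_zero)
  next
    case (insert i A)
    have "(\<lambda>i. qI (f i)) \<in> A \<rightarrow> carrier QI" "qI (f i) \<in> carrier QI"
      using insert.prems by (auto simp: quot_carrier)
    with insert show ?case by (simp add: quot_simps polys_sum)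
  qed
qed

lemma quot_sgn: "p \<in> polys m \<Longrightarrow> sgn_mult QI k (qI p) = qI ((- 1) ^ k * p)"
  by (cases "even k") (simp_all add: sgn_mult_def quot_simps)

text \<open>
  The acyclicity in degree zero that a presentation requires holds by \<open>gen\<close>: an element of the
  maximal ideal is congruent to a combination of the \<open>xs ! i\<close>, which is the differential of a chain
  of degree one.
\<close>

lemma koszul_presentation:
  fixes xs :: "'k mpoly list"
  assumes Imax: "I \<subseteq> graded_max_ideal m" and xs: "set xs \<subseteq> graded_max_ideal m"
    and gen: "\<And>p. p \<in> graded_max_ideal m \<Longrightarrow>
      \<exists>f. (\<forall>i<length xs. f i \<in> polys m) \<and> p - (\<Sum>i<length xs. f i * xs ! i) \<in> I"
  shows "dg_presentation kscale kmul (kd (length xs) ((!) xs)) ksg kaug (kcarrier m (length xs))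
    (kideal m I (length xs)) (koszul QI (\<lambda>c. qI (const c)) (map qI xs)) (\<lambda>a S. qI (a S)) kcomp (length xs)"
proof -
  let ?r = "length xs" let ?x = "(!) xs"
  let ?A = "koszul QI (\<lambda>c. qI (const c)) (map qI xs)"
  let ?\<kappa> = "\<lambda>a S. qI (a S) :: 'k mpoly set"
  interpret dg_subquotient kscale kmul "kd ?r ?x" ksg kaug "kcarrier m ?r" "kideal m I ?r"
    by (rule dg_koszul [OF I Imax xs])
  note D = ideal_poly_ringD [OF I]
  have x: "?x i \<in> polys m" if "i < ?r" for i
    using nth_graded_max [OF xs that] by simp
  have lift: "\<exists>a\<in>kcarrier m ?r. f = ?\<kappa> a \<and> (\<forall>S. f S = qI 0 \<longrightarrow> a S = 0)"
    if f: "\<And>S. f S \<in> carrier QI" "\<And>S. \<not> S \<subseteq> {..<?r} \<Longrightarrow> f S = qI 0" for f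
  proof -
    have "\<exists>a. a \<in> polys m \<and> f S = qI a \<and> (f S = qI 0 \<longrightarrow> a = 0)" for S
      using f(1) [of S] polys_0 by (cases "f S = qI 0") (auto simp: quot_carrier)
    then obtain a where "\<And>S. a S \<in> polys m \<and> f S = qI (a S) \<and> (f S = qI 0 \<longrightarrow> a S = 0)" by metis
    thus ?thesis using f(2) by (intro bexI [of _ a] kcarrierI) auto
  qed
  have car: "carrier ?A = {a. (\<forall>S. a S \<in> carrier QI) \<and> (\<forall>S. \<not> S \<subseteq> {..<?r} \<longrightarrow> a S = qI 0)}"
    by (simp add: koszul_def quot_zero)
  have in_car: "?\<kappa> a \<in> carrier ?A" if "a \<in> kcarrier m ?r" for a
    using that by (auto simp: car quot_carrier kcarrierD)
  show ?thesis
  proof (unfold_locales, goal_cases)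
    case 1
    show ?case
    proof (intro equalityI subsetI)
      fix f assume "f \<in> carrier ?A"
      hence "\<exists>a\<in>kcarrier m ?r. f = ?\<kappa> a \<and> (\<forall>S. f S = qI 0 \<longrightarrow> a S = 0)"
        by (intro lift) (simp_all add: car)
      thus "f \<in> ?\<kappa> ` kcarrier m ?r" by blast
    qed (use in_car in auto)
  next
    case (2 a b)
    have "?\<kappa> a = ?\<kappa> b \<longleftrightarrow> (\<forall>S. a S - b S \<in> I)"
      using 2 by (simp add: fun_eq_iff quot_eq_iff kcarrierD)
    thus ?case using C_diff [OF 2] by (simp add: kideal_def)
  next
    case (3 a b)
    thus ?case by (simp add: koszul_def quot_simps kcarrierD)
  next
    case 4 show ?case by (simp add: koszul_def quot_zero)
  next
    case (5 a b)
    show ?case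
    proof
      fix U
      have "(?\<kappa> a \<otimes>\<^bsub>?A\<^esub> ?\<kappa> b) U =
          (\<Oplus>\<^bsub>QI\<^esub>S\<in>Pow U. sgn_mult QI (inv_count S (U - S)) (qI (a S) \<otimes>\<^bsub>QI\<^esub> qI (b (U - S))))"
        by (simp add: koszul_def inv_count_def)
      also have "\<dots> = (\<Oplus>\<^bsub>QI\<^esub>S\<in>Pow U. qI ((- 1) ^ inv_count S (U - S) * (a S * b (U - S))))"
        using 5 by (simp add: quot_simps kcarrierD quot_sgn polys_mult)
      also have "\<dots> = qI (kmul a b U)"
        unfolding kmul_def using 5 by (intro quot_sum polys_sign polys_mult kcarrierD)
      finally show "qI (kmul a b U) = (?\<kappa> a \<otimes>\<^bsub>?A\<^esub> ?\<kappa> b) U" ..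
    qed
  next
    case (6 a c)
    thus ?case by (simp add: koszul_def kscale_def rs_def quot_simps kcarrierD polys_const)
  next
    case (7 a)
    show ?case
    proof
      fix U
      have "differential ?A (?\<kappa> a) U =
          (\<Oplus>\<^bsub>QI\<^esub>i\<in>{..<?r} - U. sgn_mult QI (below U i) (map qI xs ! i \<otimes>\<^bsub>QI\<^esub> qI (a (insert i U))))"
        by (simp add: koszul_def)
      also have "\<dots> = (\<Oplus>\<^bsub>QI\<^esub>i\<in>{..<?r} - U. qI ((- 1) ^ below U i * (?x i * a (insert i U))))"
      proof -
        interpret Qr: ring QI using quot_hom by (simp add: ring_hom_ring_def)
        show ?thesis
          by (rule Qr.add.finprod_cong')
            (use 7 x in \<open>auto simp: quot_simps kcarrierD quot_sgn polys_mult quot_carrier intro!: imageI polys_sign\<close>)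
      qed
      also have "\<dots> = qI (\<Sum>i\<in>{..<?r} - U. (- 1) ^ below U i * (?x i * a (insert i U)))"
        using x kcarrierD(1) [OF 7] by (intro quot_sum polys_sign polys_mult) auto
      also have "(\<Sum>i\<in>{..<?r} - U. (- 1) ^ below U i * (?x i * a (insert i U))) = kd ?r ?x a U"
        unfolding kd_def
      proof (rule sum.mono_neutral_cong_left)
        show "\<forall>i\<in>{..<?r} - ({..<?r} - U). ?x i * contract i a U = 0"
          by (auto simp: contract_def)
        fix i assume i: "i \<in> {..<?r} - U"
        show "(- 1) ^ below U i * (?x i * a (insert i U)) = ?x i * contract i a U"
        proof (cases "finite U")
          case True thus ?thesis using i by (simp add: contract_def mult_ac)
        next
          case False
          hence "\<not> insert i U \<subseteq> {..<?r}" by (meson finite_lessThan finite_subset insert_subset)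
          hence "a (insert i U) = 0" by (rule kcarrierD(2) [OF 7])
          thus ?thesis using False by (simp add: contract_def)
        qed
      qed auto
      finally show "qI (kd ?r ?x a U) = differential ?A (?\<kappa> a) U" ..
    qed
  next
    case (8 i)
    have hc: "hcomp ?A i = {f \<in> carrier ?A. \<forall>S. f S \<noteq> qI 0 \<longrightarrow> card S = i}"
      by (simp add: koszul_def quot_zero)
    show ?case
    proof (intro equalityI subsetI)
      fix f assume "f \<in> hcomp ?A i"
      hence f: "f \<in> carrier ?A" "\<And>S. f S \<noteq> qI 0 \<Longrightarrow> card S = i" by (auto simp: hc)
      then obtain a where a: "a \<in> kcarrier m ?r" "f = ?\<kappa> a" "\<And>S. f S = qI 0 \<Longrightarrow> a S = 0"
        using lift [of f] by (auto simp: car)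
      have "a S = 0" if "card S \<noteq> i" for S using that a(3) [of S] f(2) [of S] by blast
      hence "kcomp i a = a" by (auto simp: kcomp_def fun_eq_iff)
      thus "f \<in> ?\<kappa> ` {a \<in> kcarrier m ?r. kcomp i a = a}" using a by blast
    next
      fix f assume "f \<in> ?\<kappa> ` {a \<in> kcarrier m ?r. kcomp i a = a}"
      then obtain a where a: "a \<in> kcarrier m ?r" "kcomp i a = a" "f = ?\<kappa> a" by blast
      have "a S = 0" if "card S \<noteq> i" for S using fun_cong [OF a(2), of S] that by (simp add: kcomp_def)
      thus "f \<in> hcomp ?A i" using a in_car by (auto simp: hc)
    qed
  next
    case (9 i a b) show ?case by (auto simp: kcomp_def fun_eq_iff)
  next
    case (10 i c a) show ?case by (auto simp: kcomp_def kscale_def rs_def fun_eq_iff)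
  next
    case (11 a i) thus ?case by (auto simp: kcarrier_def kcomp_def polys_0)
  next
    case (12 a i) thus ?case using D(2) by (auto simp: kideal_def kcarrier_def kcomp_def polys_0)
  next
    case (13 i j a) show ?case by (auto simp: kcomp_def fun_eq_iff)
  next
    case (14 a)
    show ?case
    proof
      fix S
      have "(\<Sum>i\<le>?r. kcomp i a) S = (\<Sum>i\<le>?r. if i = card S then a S else 0)"
        unfolding fun_sum_apply by (intro sum.cong) (auto simp: kcomp_def)
      also have "\<dots> = a S"
        using kcarrierD(2) [OF 14, of S] card_mono [of "{..<?r}" S] by auto
      finally show "a S = (\<Sum>i\<le>?r. kcomp i a) S" ..
    qed
  next
    case (15 a i)
    have *: "kcomp i (contract j a) U = contract j (kcomp (Suc i) a) U" for j U
      by (auto simp: kcomp_def contract_def)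
    show ?case
    proof
      fix U
      have "kcomp i (kd ?r ?x a) U = (\<Sum>j<?r. ?x j * kcomp i (contract j a) U)"
        by (simp add: kcomp_def kd_def)
      also have "\<dots> = kd ?r ?x (kcomp (Suc i) a) U" unfolding * kd_def ..
      finally show "kcomp i (kd ?r ?x a) U = kd ?r ?x (kcomp (Suc i) a) U" .
    qed
  next
    case (16 a)
    have "contract j (kcomp 0 a) U = 0" for j U by (auto simp: kcomp_def contract_def)
    thus ?case by (auto simp: kd_def fun_eq_iff)
  next
    case (17 i a) show ?case by (auto simp: ksg_def kcomp_def fun_eq_iff)
  next
    case (18 i j a b)
    show ?case
    proof
      fix U
      have "kmul (kcomp i a) (kcomp j b) U = 0" if "card U \<noteq> i + j"
      proof (cases "finite U")
        case True
        have "kcomp i a S * kcomp j b (U - S) = 0" if "S \<subseteq> U" for S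
          using that True \<open>card U \<noteq> i + j\<close> card_mono [OF True that]
          by (auto simp: kcomp_def card_Diff_subset finite_subset)
        thus ?thesis by (simp add: kmul_def sum.neutral)
      qed (simp add: kmul_infinite)
      thus "kcomp (i + j) (kmul (kcomp i a) (kcomp j b)) U = kmul (kcomp i a) (kcomp j b) U"
        by (simp add: kcomp_def [of "i + j"])
    qed
  next
    case (19 i a) thus ?case by (simp add: kaug_def kcomp_def)
  next
    case (20 a)
    have "a {} \<in> graded_max_ideal m" using 20 by (simp add: graded_max_ideal_def kcarrierD kaug_def)
    from gen [OF this] obtain f where f: "\<And>i. i < ?r \<Longrightarrow> f i \<in> polys m" "a {} - (\<Sum>i<?r. f i * ?x i) \<in> I" by auto
    define y where "y S = (if \<exists>i<?r. S = {i} then f (the_elem S) else 0)" for S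
    have y: "y \<in> kcarrier m ?r"
    proof (rule kcarrierI)
      show "y S \<in> polys m" for S using f(1) by (auto simp: y_def polys_0)
      show "y S = 0" if "\<not> S \<subseteq> {..<?r}" for S using that by (auto simp: y_def)
    qed
    have y1: "y {i} = (if i < ?r then f i else 0)" for i by (auto simp: y_def)
    have "contract i y U = (if U = {} then y {i} else 0)" for i U
      by (auto simp: contract_def y_def)
    hence dy: "kd ?r ?x y U = (if U = {} then (\<Sum>i<?r. f i * ?x i) else 0)" for U
      unfolding kd_def by (auto simp: y1 mult.commute intro!: sum.cong)
    have a0: "a U = 0" if "U \<noteq> {}" for U
    proof (cases "finite U")
      case True thus ?thesis using fun_cong [OF 20(2), of U] that by (simp add: kcomp_def)
    next
      case False thus ?thesis using kcarrierD(2) [OF 20(1), of U] finite_subset by blast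
    qed
    have "(a - kd ?r ?x y) U \<in> I" for U using f(2) a0 dy D(2) by (cases "U = {}") auto
    moreover have "a - kd ?r ?x y \<in> kcarrier m ?r" using C_diff [OF 20(1) d_C [OF y]] .
    ultimately have "eqv a (kd ?r ?x y)" by (simp add: eqv_def kidealI)
    thus ?case using y by blast
  qed
qed

end

section \<open>Linear forms modulo an ideal\<close>

definition mscale :: "'k::field \<Rightarrow> 'k mpoly \<Rightarrow> 'k mpoly" where
  "mscale c p = const c * p"

interpretation MP: vector_space mscale
  by unfold_locales (simp_all add: mscale_def distrib_left distrib_right const_add const_mult mult.assoc)

lemma ideal_subspace: "ideal J (poly_ring m) \<Longrightarrow> MP.subspace J"
  by (auto simp: MP.subspace_def mscale_def ideal_poly_ringD polys_const)

lemma ideal_graded_max: "ideal (graded_max_ideal m) (poly_ring m)"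
  by (rule ideal_poly_ringI)
    (auto simp: graded_max_ideal_def polys_closed lookup_add lookup_mult_0)

lemma forms_graded_max: "forms m 1 \<subseteq> graded_max_ideal m"
proof
  fix p assume p: "p \<in> forms m 1"
  have "Poly_Mapping.lookup p 0 = Poly_Mapping.lookup (part 1 p) 0" using p by (simp add: part_forms)
  thus "p \<in> graded_max_ideal m" using p by (simp add: graded_max_ideal_def forms_polys lookup_part mdeg_def)
qed

text \<open>
  A version of Nakayama's lemma. The ideal is contained in the preimage of the span under \<open>part 1\<close>, which is
  an ideal since multiplication by \<open>r\<close> acts on the linear part of an element without constant term
  as multiplication by the constant term of \<open>r\<close>.
\<close>

lemma part1_genideal:
  assumes I: "graded_proper m I" and X: "X \<subseteq> homogeneous_elements m" "X \<subseteq> graded_max_ideal m"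
    and p: "p \<in> Idl\<^bsub>poly_ring m\<^esub> (I \<union> X)"
  shows "part 1 p \<in> MP.span (I \<union> (X \<inter> forms m 1))"
proof -
  let ?S = "MP.span (I \<union> (X \<inter> forms m 1))"
  let ?J = "{p \<in> polys m. Poly_Mapping.lookup p 0 = 0 \<and> part 1 p \<in> ?S}"
  have sc: "const c * p \<in> ?S" if "p \<in> ?S" for c p
    using MP.span_scale [OF that] by (simp add: mscale_def)
  have "ideal ?J (poly_ring m)"
  proof (rule ideal_poly_ringI)
    fix r a :: "'a mpoly" assume "r \<in> polys m" "a \<in> ?J"
    thus "r * a \<in> ?J" using sc by (simp add: polys_mult lookup_mult_0 part_1_mult_Suc part_zero_eq)
  qed (auto simp: polys_closed lookup_add part_add MP.span_zero MP.span_add)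
  moreover have "I \<union> X \<subseteq> ?J"
  proof
    fix p assume "p \<in> I \<union> X"
    hence p0: "p \<in> graded_max_ideal m" using I X by (auto simp: graded_proper_def)
    have "part 1 p \<in> ?S"
    proof (cases "p \<in> I")
      case True thus ?thesis using I by (auto simp: graded_proper_def intro: MP.span_base)
    next
      case False
      hence "p \<in> X" using \<open>p \<in> I \<union> X\<close> by blast
      then obtain e where e: "p \<in> forms m e" using X by (auto simp: homogeneous_elements_def)
      show ?thesis
        using \<open>p \<in> X\<close> e MP.span_zero by (cases "e = 1") (auto simp: part_forms intro: MP.span_base)
    qed
    thus "p \<in> ?J" using p0 by (simp add: graded_max_ideal_def)
  qed
  ultimately have "Idl\<^bsub>poly_ring m\<^esub> (I \<union> X) \<subseteq> ?J" by (rule genideal_minimal)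
  thus ?thesis using p by blast
qed

text \<open>
  The classes of \<open>xs\<close> are a basis of the space of linear forms modulo \<open>I\<close>. The independence
  is stated with indices, so that it includes that the entries of \<open>xs\<close> are distinct.
\<close>

definition lin_basis :: "nat \<Rightarrow> 'k::field mpoly set \<Rightarrow> 'k mpoly list \<Rightarrow> bool" where
  "lin_basis m I xs \<longleftrightarrow> set xs \<subseteq> forms m 1 \<and> forms m 1 \<subseteq> MP.span (I \<union> set xs) \<and>
     (\<forall>c. (\<Sum>i<length xs. const (c i) * xs ! i) \<in> I \<longrightarrow> (\<forall>i<length xs. c i = 0))"

lemma span_nth:
  assumes I: "MP.subspace I" and S: "finite S" and p: "p \<in> MP.span (I \<union> (\<lambda>i. xs ! i) ` S)"
  shows "\<exists>c. p - (\<Sum>i\<in>S. const (c i) * xs ! i) \<in> I"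
proof -
  let ?G = "{p. \<exists>c. p - (\<Sum>i\<in>S. const (c i) * xs ! i) \<in> I}"
  have "MP.subspace ?G"
    unfolding MP.subspace_def
  proof (intro conjI ballI allI)
    show "0 \<in> ?G" using MP.subspace_0 [OF I] by (auto intro!: exI [of _ "\<lambda>_. 0"])
  next
    fix p q assume "p \<in> ?G" "q \<in> ?G"
    then obtain c c' where "p - (\<Sum>i\<in>S. const (c i) * xs ! i) \<in> I" "q - (\<Sum>i\<in>S. const (c' i) * xs ! i) \<in> I" by auto
    from MP.subspace_add [OF I this]
    have "p + q - (\<Sum>i\<in>S. const (c i + c' i) * xs ! i) \<in> I"
      by (simp add: const_add distrib_right sum.distrib algebra_simps)
    thus "p + q \<in> ?G" by (intro CollectI exI [of _ "\<lambda>i. c i + c' i"])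
  next
    fix b p assume "p \<in> ?G"
    then obtain c where "p - (\<Sum>i\<in>S. const (c i) * xs ! i) \<in> I" by auto
    from MP.subspace_scale [OF I this, of b]
    have "mscale b p - (\<Sum>i\<in>S. const (b * c i) * xs ! i) \<in> I"
      by (simp add: mscale_def const_mult right_diff_distrib sum_distrib_left mult.assoc)
    thus "mscale b p \<in> ?G" by (intro CollectI exI [of _ "\<lambda>i. b * c i"])
  qed
  moreover have "I \<union> (\<lambda>i. xs ! i) ` S \<subseteq> ?G"
  proof (intro Un_least subsetI)
    fix p assume "p \<in> I" thus "p \<in> ?G" by (auto intro!: exI [of _ "\<lambda>_. 0"])
  next
    fix p assume "p \<in> (\<lambda>i. xs ! i) ` S"
    then obtain j where j: "j \<in> S" "p = xs ! j" by auto
    have "(\<Sum>i\<in>S. const (if i = j then 1 else 0) * xs ! i) = (\<Sum>i\<in>S. if i = j then xs ! j else 0)"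
      by (intro sum.cong) auto
    hence "p - (\<Sum>i\<in>S. const (if i = j then 1 else 0) * xs ! i) = 0" using j S by simp
    hence "p - (\<Sum>i\<in>S. const (if i = j then 1 else 0) * xs ! i) \<in> I" using MP.subspace_0 [OF I] by simp
    thus "p \<in> ?G" by (intro CollectI exI)
  qed
  ultimately have "MP.span (I \<union> (\<lambda>i. xs ! i) ` S) \<subseteq> ?G" by (intro MP.span_minimal)
  thus ?thesis using p by blast
qed

lemma set_conv_nth_image: "set xs = (\<lambda>i. xs ! i) ` {..<length xs}"
  by (auto simp: set_conv_nth)

lemma lin_basis_coords:
  assumes "ideal I (poly_ring m)" "lin_basis m I xs" "l \<in> forms m 1"
  shows "\<exists>c. l - (\<Sum>i<length xs. const (c i) * xs ! i) \<in> I"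
  using assms span_nth [OF ideal_subspace [OF assms(1)], of "{..<length xs}" l xs]
  by (auto simp: lin_basis_def set_conv_nth_image)

lemma lin_basis_not_span:
  assumes I: "ideal I (poly_ring m)" and xs: "lin_basis m I xs" and S: "S \<subseteq> {..<length xs}"
    and j: "j < length xs" "j \<notin> S"
  shows "xs ! j \<notin> MP.span (I \<union> (\<lambda>i. xs ! i) ` S)"
proof
  assume "xs ! j \<in> MP.span (I \<union> (\<lambda>i. xs ! i) ` S)"
  moreover have "finite S" using S finite_subset by blast
  ultimately obtain c where c: "xs ! j - (\<Sum>i\<in>S. const (c i) * xs ! i) \<in> I"
    using span_nth [OF ideal_subspace [OF I]] by blast
  define b where "b i = (if i = j then 1 else if i \<in> S then - c i else 0)" for i
  have "(\<Sum>i<length xs. const (b i) * xs ! i) = (\<Sum>i\<in>insert j S. const (b i) * xs ! i)"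
    using S j by (intro sum.mono_neutral_right) (auto simp: b_def)
  also have "\<dots> = xs ! j + (\<Sum>i\<in>S. const (b i) * xs ! i)"
    using j \<open>finite S\<close> by (simp add: b_def)
  also have "(\<Sum>i\<in>S. const (b i) * xs ! i) = (\<Sum>i\<in>S. - (const (c i) * xs ! i))"
    using j by (intro sum.cong) (auto simp: b_def single_uminus)
  finally have "(\<Sum>i<length xs. const (b i) * xs ! i) \<in> I" using c by (simp add: sum_negf)
  hence "b j = 0" using xs j by (auto simp: lin_basis_def)
  thus False by (simp add: b_def)
qed

lemma span_in_ideal:
  assumes "ideal K (poly_ring m)" "I \<union> X \<subseteq> K"
  shows "MP.span (I \<union> X) \<subseteq> K"
  using assms by (intro MP.span_minimal ideal_subspace)

lemma graded_max_genideal: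
  assumes I: "ideal I (poly_ring m)" and X: "X \<subseteq> polys m" and f: "forms m 1 \<subseteq> MP.span (I \<union> X)"
  shows "graded_max_ideal m \<subseteq> Idl\<^bsub>poly_ring m\<^esub> (I \<union> X)"
proof (rule graded_max_subset)
  have sub: "I \<union> X \<subseteq> polys m" using ideal_poly_ringD(1) [OF I] X by blast
  show J: "ideal (Idl\<^bsub>poly_ring m\<^esub> (I \<union> X)) (poly_ring m)" by (rule genideal_ideal [OF sub])
  show "var i \<in> Idl\<^bsub>poly_ring m\<^esub> (I \<union> X)" if "i < m" for i
    using span_in_ideal [OF J genideal_self [OF sub]] f var_forms [OF that] by blast
qed

text \<open>
  The elements that are congruent to combinations of \<open>xs\<close> form an ideal, which contains the variables.
\<close>

lemma lin_basis_gen: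
  assumes I: "ideal I (poly_ring m)" and xs: "lin_basis m I xs" and p: "p \<in> graded_max_ideal m"
  shows "\<exists>f. (\<forall>i<length xs. f i \<in> polys m) \<and> p - (\<Sum>i<length xs. f i * xs ! i) \<in> I"
proof -
  note D = ideal_poly_ringD [OF I]
  let ?r = "length xs"
  let ?J = "{p \<in> polys m. \<exists>f. (\<forall>i<?r. f i \<in> polys m) \<and> p - (\<Sum>i<?r. f i * xs ! i) \<in> I}"
  have "ideal ?J (poly_ring m)"
  proof (rule ideal_poly_ringI)
    show "0 \<in> ?J" using D(2) polys_0 by (auto intro!: exI [of _ "\<lambda>_. 0"])
  next
    fix a b assume "a \<in> ?J" "b \<in> ?J"
    then obtain f g where fg: "a \<in> polys m" "b \<in> polys m" "\<forall>i<?r. f i \<in> polys m" "\<forall>i<?r. g i \<in> polys m"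
      "a - (\<Sum>i<?r. f i * xs ! i) \<in> I" "b - (\<Sum>i<?r. g i * xs ! i) \<in> I" by blast
    have "a + b - (\<Sum>i<?r. (f i + g i) * xs ! i) \<in> I"
      using D(3) [OF fg(5, 6)] by (simp add: distrib_right sum.distrib algebra_simps)
    thus "a + b \<in> ?J" using fg by (intro CollectI conjI exI [of _ "\<lambda>i. f i + g i"]) (auto intro!: polys_add)
  next
    fix s a :: "'a mpoly" assume s: "s \<in> polys m" and "a \<in> ?J"
    then obtain f where f: "a \<in> polys m" "\<forall>i<?r. f i \<in> polys m" "a - (\<Sum>i<?r. f i * xs ! i) \<in> I" by blast
    have "s * a - (\<Sum>i<?r. (s * f i) * xs ! i) \<in> I"
      using D(4) [OF s f(3)] by (simp add: right_diff_distrib sum_distrib_left mult.assoc)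
    thus "s * a \<in> ?J" using f s by (intro CollectI conjI exI [of _ "\<lambda>i. s * f i"]) (auto intro!: polys_mult)
  qed auto
  moreover have "var i \<in> ?J" if i: "i < m" for i
  proof -
    obtain c where "var i - (\<Sum>j<?r. const (c j) * xs ! j) \<in> I"
      using lin_basis_coords [OF I xs var_forms [OF i]] by (elim exE)
    thus ?thesis using forms_polys [OF var_forms [OF i]]
      by (intro CollectI conjI exI [of _ "\<lambda>j. const (c j)"]) (auto intro: polys_const)
  qed
  ultimately have "graded_max_ideal m \<subseteq> ?J" by (rule graded_max_subset)
  thus ?thesis using p by blast
qed

section \<open>Minimal generators of the graded maximal ideal\<close>

lemma quot_genideal:
  assumes I: "ideal I (poly_ring m)" and X: "X \<subseteq> polys m" and p: "p \<in> polys m"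
  shows "I +>\<^bsub>poly_ring m\<^esub> p \<in> Idl\<^bsub>poly_ring m Quot I\<^esub> ((\<lambda>p. I +>\<^bsub>poly_ring m\<^esub> p) ` X) \<longleftrightarrow>
    p \<in> Idl\<^bsub>poly_ring m\<^esub> (I \<union> X)"
proof -
  let ?q = "\<lambda>p. I +>\<^bsub>poly_ring m\<^esub> p" let ?Q = "poly_ring m Quot I"
  interpret h: ring_hom_ring "poly_ring m" ?Q ?q by (rule quot_hom [OF I])
  have sub: "I \<union> X \<subseteq> polys m" using ideal_poly_ringD(1) [OF I] X by blast
  have qX: "?q ` X \<subseteq> carrier ?Q" using X by (auto simp: quot_carrier [OF I])
  let ?K = "Idl\<^bsub>poly_ring m\<^esub> (I \<union> X)"
  have K: "ideal ?K (poly_ring m)" by (rule genideal_ideal [OF sub])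
  have KI: "I \<union> X \<subseteq> ?K" by (rule genideal_self [OF sub])
  have 1: "Idl\<^bsub>?Q\<^esub> (?q ` X) \<subseteq> ?q ` ?K"
    using KI by (intro h.S.genideal_minimal h.R.ring_ideal_imp_quot_ideal I K) auto
  let ?J = "{p \<in> polys m. ?q p \<in> Idl\<^bsub>?Q\<^esub> (?q ` X)}"
  have "ideal ?J (poly_ring m)"
    using h.ideal_vimage [OF h.S.genideal_ideal [OF qX]] by simp
  moreover have "I \<union> X \<subseteq> ?J"
  proof
    fix x assume x: "x \<in> I \<union> X"
    have "?q x \<in> Idl\<^bsub>?Q\<^esub> (?q ` X)"
    proof (cases "x \<in> I")
      case True
      hence "?q x = \<zero>\<^bsub>?Q\<^esub>"
        using quot_eq_iff [OF I, of x 0] quot_zero [OF I] sub polys_0 by auto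
      thus ?thesis
        using additive_subgroup.zero_closed [OF ideal.axioms(1) [OF h.S.genideal_ideal [OF qX]]] by simp
    next
      case False thus ?thesis using x h.S.genideal_self [OF qX] by blast
    qed
    thus "x \<in> ?J" using x sub by blast
  qed
  ultimately have 2: "?K \<subseteq> ?J" by (rule genideal_minimal)
  show ?thesis
  proof
    assume "?q p \<in> Idl\<^bsub>?Q\<^esub> (?q ` X)"
    then obtain b where b: "b \<in> ?K" "?q p = ?q b" using 1 by blast
    have "b \<in> polys m" using b K ideal_poly_ringD(1) by blast
    hence "p - b \<in> ?K" using quot_eq_iff [OF I p] b KI by blast
    from ideal_poly_ringD(3) [OF K this b(1)] show "p \<in> ?K" by simp
  qed (use 2 in blast)
qed

lemma quot_genideal_eq:
  assumes I: "graded_proper m I" and X: "X \<subseteq> graded_max_ideal m"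
  shows "Idl\<^bsub>poly_ring m Quot I\<^esub> ((\<lambda>p. I +>\<^bsub>poly_ring m\<^esub> p) ` X) = (\<lambda>p. I +>\<^bsub>poly_ring m\<^esub> p) ` graded_max_ideal m
    \<longleftrightarrow> graded_max_ideal m \<subseteq> Idl\<^bsub>poly_ring m\<^esub> (I \<union> X)" (is "?L = ?q ` ?M \<longleftrightarrow> _")
proof -
  have Ii: "ideal I (poly_ring m)" and IM: "I \<subseteq> ?M" using I by (auto simp: graded_proper_def)
  have Mp: "?M \<subseteq> polys m" by (auto simp: graded_max_ideal_def)
  have Xp: "X \<subseteq> polys m" using X Mp by blast
  interpret h: ring_hom_ring "poly_ring m" "poly_ring m Quot I" ?q by (rule quot_hom [OF Ii])
  note qg = quot_genideal [OF Ii Xp]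
  have sub: "?L \<subseteq> ?q ` ?M"
    using X by (intro h.S.genideal_minimal h.R.ring_ideal_imp_quot_ideal Ii ideal_graded_max) auto
  show ?thesis
  proof
    assume eq: "?L = ?q ` ?M"
    show "?M \<subseteq> Idl\<^bsub>poly_ring m\<^esub> (I \<union> X)"
    proof
      fix p assume p: "p \<in> ?M"
      hence "?q p \<in> ?L" using eq by blast
      thus "p \<in> Idl\<^bsub>poly_ring m\<^esub> (I \<union> X)" using qg p Mp by blast
    qed
  next
    assume *: "?M \<subseteq> Idl\<^bsub>poly_ring m\<^esub> (I \<union> X)"
    show "?L = ?q ` ?M" using sub qg Mp * by blast
  qed
qed

lemma min_hom_gens_of_lin_basis:
  assumes I: "graded_proper m I" and xs: "lin_basis m I xs"
  shows "min_hom_gens (poly_ring m Quot I) ((\<lambda>p. I +>\<^bsub>poly_ring m\<^esub> p) ` homogeneous_elements m)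
     ((\<lambda>p. I +>\<^bsub>poly_ring m\<^esub> p) ` graded_max_ideal m) (map (\<lambda>p. I +>\<^bsub>poly_ring m\<^esub> p) xs)"
proof -
  let ?q = "\<lambda>p. I +>\<^bsub>poly_ring m\<^esub> p" let ?M = "graded_max_ideal m"
  have Ii: "ideal I (poly_ring m)" using I by (auto simp: graded_proper_def)
  have xf: "set xs \<subseteq> forms m 1" using xs by (simp add: lin_basis_def)
  have xM: "set xs \<subseteq> ?M" using xf forms_graded_max by blast
  have xp: "set xs \<subseteq> polys m" using xf forms_polys by blast
  have inj: "i = j" if "i < length xs" "j < length xs" "?q (xs ! i) = ?q (xs ! j)" for i j
  proof (rule ccontr)
    assume ne: "i \<noteq> j"
    have "xs ! j \<in> polys m" "xs ! i \<in> polys m" using xp that(1, 2) by (auto dest: nth_mem)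
    hence "xs ! j - xs ! i \<in> I" using that(3) quot_eq_iff [OF Ii, of "xs ! j" "xs ! i"] by simp
    hence "(xs ! j - xs ! i) + xs ! i \<in> MP.span (I \<union> (\<lambda>i. xs ! i) ` {i})"
      by (intro MP.span_add MP.span_base) auto
    thus False using lin_basis_not_span [OF Ii xs, of "{i}" j] that ne by simp
  qed
  show ?thesis
    unfolding min_hom_gens_def
  proof (intro conjI allI impI)
    show "distinct (map ?q xs)" using inj by (auto simp: distinct_conv_nth)
    show "set (map ?q xs) \<subseteq> ?q ` homogeneous_elements m" using xf by (auto simp: homogeneous_elements_def)
    show "Idl\<^bsub>poly_ring m Quot I\<^esub> (set (map ?q xs)) = ?q ` ?M"
      using quot_genideal_eq [OF I xM] graded_max_genideal [OF Ii xp] xs by (simp add: lin_basis_def)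
  next
    fix F assume F: "F \<subset> set (map ?q xs)"
    let ?S = "{i. i < length xs \<and> ?q (xs ! i) \<in> F}"
    let ?X = "(\<lambda>i. xs ! i) ` ?S"
    have FX: "F = ?q ` ?X"
    proof (intro equalityI subsetI)
      fix y assume y: "y \<in> F"
      hence "y \<in> ?q ` set xs" using F by auto
      then obtain i where "i < length xs" "y = ?q (xs ! i)" by (auto simp: in_set_conv_nth)
      thus "y \<in> ?q ` ?X" using y by blast
    qed blast
    have "set (map ?q xs) \<noteq> F" using F by blast
    then obtain y where "y \<in> set (map ?q xs)" "y \<notin> F" using F by blast
    then obtain j where j: "j < length xs" "?q (xs ! j) \<notin> F" by (auto simp: in_set_conv_nth)
    have XM: "?X \<subseteq> ?M" using xM by auto
    show "Idl\<^bsub>poly_ring m Quot I\<^esub> F \<noteq> ?q ` ?M"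
    proof
      assume "Idl\<^bsub>poly_ring m Quot I\<^esub> F = ?q ` ?M"
      hence "?M \<subseteq> Idl\<^bsub>poly_ring m\<^esub> (I \<union> ?X)" using quot_genideal_eq [OF I XM] FX by simp
      hence "xs ! j \<in> Idl\<^bsub>poly_ring m\<^esub> (I \<union> ?X)" using xM j by (auto dest: nth_mem)
      moreover have "?X \<subseteq> homogeneous_elements m" using xf by (auto simp: homogeneous_elements_def dest: nth_mem)
      ultimately have "part 1 (xs ! j) \<in> MP.span (I \<union> (?X \<inter> forms m 1))"
        using XM by (intro part1_genideal [OF I])
      moreover have "?X \<inter> forms m 1 = ?X" using xf by (auto dest: nth_mem)
      moreover have "part 1 (xs ! j) = xs ! j" using xf j by (auto simp: part_forms dest: nth_mem)
      ultimately show False using lin_basis_not_span [OF Ii xs, of ?S j] j by auto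
    qed
  qed
qed

text \<open>
  By \<open>part1_genideal\<close> the linear elements among the generators already generate the maximal ideal, so
  minimality leaves no others. A linear relation among them would make one of them
  redundant.
\<close>

lemma lin_basis_of_min_hom_gens:
  assumes I: "graded_proper m I"
    and ys: "min_hom_gens (poly_ring m Quot I) ((\<lambda>p. I +>\<^bsub>poly_ring m\<^esub> p) ` homogeneous_elements m)
     ((\<lambda>p. I +>\<^bsub>poly_ring m\<^esub> p) ` graded_max_ideal m) ys"
  shows "\<exists>xs. ys = map (\<lambda>p. I +>\<^bsub>poly_ring m\<^esub> p) xs \<and> lin_basis m I xs"
proof -
  let ?q = "\<lambda>p. I +>\<^bsub>poly_ring m\<^esub> p" let ?M = "graded_max_ideal m" let ?Q = "poly_ring m Quot I"
  have Ii: "ideal I (poly_ring m)" and IM: "I \<subseteq> ?M" using I by (auto simp: graded_proper_def)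
  have Mp: "?M \<subseteq> polys m" by (auto simp: graded_max_ideal_def)
  interpret h: ring_hom_ring "poly_ring m" ?Q ?q by (rule quot_hom [OF Ii])
  have ys': "distinct ys" "set ys \<subseteq> ?q ` homogeneous_elements m" "Idl\<^bsub>?Q\<^esub> (set ys) = ?q ` ?M"
    and min: "\<And>F. F \<subset> set ys \<Longrightarrow> Idl\<^bsub>?Q\<^esub> F \<noteq> ?q ` ?M"
    using ys by (auto simp: min_hom_gens_def)
  define H where "H = {h \<in> homogeneous_elements m \<inter> ?M. ?q h \<in> set ys}"
  have HM: "H \<subseteq> ?M" "H \<subseteq> homogeneous_elements m" by (auto simp: H_def)
  have qH: "?q ` H = set ys"
  proof
    show "?q ` H \<subseteq> set ys" by (auto simp: H_def)
    show "set ys \<subseteq> ?q ` H"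
    proof
      fix y assume y: "y \<in> set ys"
      obtain b where b: "b \<in> homogeneous_elements m" "y = ?q b" using ys'(2) y by blast
      have "homogeneous_elements m \<subseteq> polys m" by (auto simp: homogeneous_elements_def forms_def)
      hence bp: "b \<in> polys m" "set ys \<subseteq> carrier ?Q"
        using b ys'(2) quot_carrier [OF Ii] by blast+
      have "y \<in> ?q ` ?M" using h.S.genideal_self [OF bp(2)] ys'(3) y by blast
      then obtain g where g: "g \<in> ?M" "?q b = ?q g" using b by auto
      hence "b - g \<in> ?M" using quot_eq_iff [OF Ii bp(1)] Mp IM by blast
      from ideal_poly_ringD(3) [OF ideal_graded_max this g(1)] have "b \<in> ?M" by simp
      thus "y \<in> ?q ` H" using b y by (auto simp: H_def)
    qed
  qed
  define L where "L = H \<inter> forms m 1"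
  have LM: "L \<subseteq> ?M" "L \<subseteq> polys m" "L \<subseteq> forms m 1" using HM Mp by (auto simp: L_def)
  have "?M \<subseteq> Idl\<^bsub>poly_ring m\<^esub> (I \<union> H)" using quot_genideal_eq [OF I HM(1)] ys'(3) qH by simp
  hence "part 1 l \<in> MP.span (I \<union> L)" if "l \<in> forms m 1" for l
    using part1_genideal [OF I HM(2, 1), of l] that forms_graded_max by (auto simp: L_def)
  hence spanL: "forms m 1 \<subseteq> MP.span (I \<union> L)" by (auto simp: part_forms)
  have eqL: "Idl\<^bsub>?Q\<^esub> (?q ` L) = ?q ` ?M"
    using quot_genideal_eq [OF I LM(1)] graded_max_genideal [OF Ii LM(2) spanL] by simp
  have "?q ` L \<subseteq> set ys" using qH by (auto simp: L_def)
  hence "?q ` L = set ys" using min [of "?q ` L"] eqL by blast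
  hence "\<forall>y\<in>set ys. \<exists>x\<in>L. y = ?q x" by auto
  then obtain g where g: "\<And>y. y \<in> set ys \<Longrightarrow> g y \<in> L \<and> y = ?q (g y)" by metis
  define xs where "xs = map g ys"
  have ysx: "ys = map ?q xs" using g by (auto simp: xs_def intro!: nth_equalityI)
  have xL: "set xs \<subseteq> L" using g by (auto simp: xs_def)
  have xM: "set xs \<subseteq> ?M" "set xs \<subseteq> homogeneous_elements m" "set xs \<subseteq> forms m 1" "set xs \<subseteq> polys m"
    using xL LM HM by (auto simp: L_def)
  have "lin_basis m I xs"
    unfolding lin_basis_def
  proof (intro conjI allI impI)
    show "set xs \<subseteq> forms m 1" by (rule xM)
    show "forms m 1 \<subseteq> MP.span (I \<union> set xs)"
    proof
      fix l :: "'a mpoly" assume l: "l \<in> forms m 1"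
      have "?M \<subseteq> Idl\<^bsub>poly_ring m\<^esub> (I \<union> set xs)"
        using quot_genideal_eq [OF I xM(1)] ys'(3) by (simp add: ysx)
      hence "part 1 l \<in> MP.span (I \<union> (set xs \<inter> forms m 1))"
        using l forms_graded_max by (intro part1_genideal [OF I xM(2, 1)]) auto
      moreover have "set xs \<inter> forms m 1 = set xs" using xM by blast
      ultimately show "l \<in> MP.span (I \<union> set xs)" using l by (simp add: part_forms)
    qed
  next
    fix c j assume c: "(\<Sum>i<length xs. const (c i) * xs ! i) \<in> I" and j: "j < length xs"
    show "c j = 0"
    proof (rule ccontr)
      assume nz: "c j \<noteq> 0"
      let ?S = "{..<length xs} - {j}"
      let ?X = "(\<lambda>i. xs ! i) ` ?S"
      have XM: "?X \<subseteq> ?M" "?X \<subseteq> polys m" using xM(1, 4) by (auto dest: nth_mem)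
      have sub: "I \<union> ?X \<subseteq> polys m" using XM ideal_poly_ringD(1) [OF Ii] by blast
      let ?K = "Idl\<^bsub>poly_ring m\<^esub> (I \<union> ?X)"
      have K: "ideal ?K (poly_ring m)" by (rule genideal_ideal [OF sub])
      note KI = genideal_self [OF sub]
      have "(\<Sum>i\<in>?S. const (c i) * xs ! i) \<in> ?K"
        using KI by (intro ideal_sum [OF K] ideal_poly_ringD(4) [OF K] polys_const) auto
      hence "(\<Sum>i<length xs. const (c i) * xs ! i) - (\<Sum>i\<in>?S. const (c i) * xs ! i) \<in> ?K"
        using KI c by (intro ideal_poly_ringD(7) [OF K]) auto
      hence "const (c j) * xs ! j \<in> ?K" using j by (simp add: sum.remove [of _ j])
      hence "const (inverse (c j)) * (const (c j) * xs ! j) \<in> ?K"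
        by (rule ideal_poly_ringD(4) [OF K polys_const])
      moreover have "const (inverse (c j)) * (const (c j) * xs ! j) = xs ! j"
        using nz by (simp add: mult.assoc [symmetric] const_mult [symmetric])
      ultimately have "xs ! j \<in> ?K" by (simp only:)
      hence "set xs \<subseteq> ?K" using KI by (auto simp: set_conv_nth)
      hence "Idl\<^bsub>poly_ring m\<^esub> (I \<union> set xs) \<subseteq> ?K" using KI by (intro genideal_minimal [OF K]) auto
      moreover have "?M \<subseteq> Idl\<^bsub>poly_ring m\<^esub> (I \<union> set xs)"
        using quot_genideal_eq [OF I xM(1)] ys'(3) by (simp add: ysx)
      ultimately have "Idl\<^bsub>?Q\<^esub> (?q ` ?X) = ?q ` ?M" using quot_genideal_eq [OF I XM(1)] by blast
      moreover have "?q ` ?X \<subset> set ys"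
      proof -
        have "?q (xs ! j) \<notin> ?q ` ?X"
        proof
          assume "?q (xs ! j) \<in> ?q ` ?X"
          then obtain i where "i < length xs" "i \<noteq> j" "?q (xs ! j) = ?q (xs ! i)" by auto
          thus False using ys'(1) j unfolding ysx by (auto simp: distinct_conv_nth)
        qed
        thus ?thesis using j by (auto simp: ysx psubset_eq)
      qed
      ultimately show False using min [of "?q ` ?X"] by simp
    qed
  qed
  thus ?thesis using ysx by blast
qed

text \<open>
  Minimal generators of the maximal ideal of \<open>R/I\<close> are the classes of a basis of linear forms modulo
  \<open>I\<close>, and the Koszul complex on them is presented by \<open>koszul_presentation\<close>.
\<close>

theorem golod_iff:
  assumes I: "graded_proper m I"
  shows "golod m I \<longleftrightarrow> (\<exists>xs. lin_basis m I xs \<and> koszul_massey_trivial m I xs)"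
proof -
  have Ii: "ideal I (poly_ring m)" and IM: "I \<subseteq> graded_max_ideal m" using I by (auto simp: graded_proper_def)
  let ?q = "\<lambda>p. I +>\<^bsub>poly_ring m\<^esub> p"
  have *: "admits_trivial_massey_operation (koszul (poly_ring m Quot I) (\<lambda>c::'a. ?q (const c)) (map ?q xs)) \<longleftrightarrow>
      koszul_massey_trivial m I xs" if xs: "lin_basis m I xs" for xs
  proof -
    have "set xs \<subseteq> graded_max_ideal m" using xs forms_graded_max by (auto simp: lin_basis_def)
    then interpret dg_presentation kscale kmul "kd (length xs) ((!) xs)" ksg kaug "kcarrier m (length xs)"
      "kideal m I (length xs)" "koszul (poly_ring m Quot I) (\<lambda>c::'a. ?q (const c)) (map ?q xs)" "\<lambda>a S. ?q (a S)"
      kcomp "length xs"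
      using lin_basis_gen [OF Ii xs] by (intro koszul_presentation [OF Ii IM])
    show ?thesis
      unfolding koszul_massey_trivial_def
      using massey_trivial_if_trivial_massey_operation trivial_massey_operation_if_massey_trivial by blast
  qed
  show ?thesis
    unfolding golod_def using * min_hom_gens_of_lin_basis [OF I] lin_basis_of_min_hom_gens [OF I] by metis
qed

section \<open>Comparison of Koszul complexes\<close>

lemma koszul_massey_trivial_transfer:
  assumes I: "graded_proper m I" and xs: "set xs \<subseteq> graded_max_ideal m"
    and J: "graded_proper n J" and ys: "set ys \<subseteq> graded_max_ideal n"
    and add: "\<And>a b. a \<in> kcarrier m (length xs) \<Longrightarrow> b \<in> kcarrier m (length xs) \<Longrightarrow> \<pi> (a + b) = \<pi> a + \<pi> b"
    and in_C: "\<And>a. a \<in> kcarrier m (length xs) \<Longrightarrow> \<pi> a \<in> kcarrier n (length ys)"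
    and in_N: "\<And>a. a \<in> kideal m I (length xs) \<Longrightarrow> \<pi> a \<in> kideal n J (length ys)"
    and mul: "\<And>a b. a \<in> kcarrier m (length xs) \<Longrightarrow> b \<in> kcarrier m (length xs) \<Longrightarrow> \<pi> (kmul a b) = kmul (\<pi> a) (\<pi> b)"
    and sg: "\<And>a. a \<in> kcarrier m (length xs) \<Longrightarrow> \<pi> (ksg a) = ksg (\<pi> a)"
    and diff: "\<And>a. a \<in> kcarrier m (length xs) \<Longrightarrow>
      \<pi> (kd (length xs) ((!) xs) a) - kd (length ys) ((!) ys) (\<pi> a) \<in> kideal n J (length ys)"
    and aug: "\<And>a. a \<in> kcarrier m (length xs) \<Longrightarrow> kaug (\<pi> a) = kaug a"
    and surj: "\<And>b. b \<in> kcarrier n (length ys) \<Longrightarrow> \<exists>a\<in>kcarrier m (length xs). \<pi> a = b"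
    and ker: "\<And>a. a \<in> kcarrier m (length xs) \<Longrightarrow> \<pi> a \<in> kideal n J (length ys) \<Longrightarrow>
      kd (length xs) ((!) xs) a \<in> kideal m I (length xs) \<Longrightarrow>
      \<exists>y\<in>kcarrier m (length xs). \<pi> y \<in> kideal n J (length ys) \<and> a - kd (length xs) ((!) xs) y \<in> kideal m I (length xs)"
  shows "koszul_massey_trivial m I xs \<longleftrightarrow> koszul_massey_trivial n J ys"
proof -
  have I': "ideal I (poly_ring m)" "I \<subseteq> graded_max_ideal m" using I by (auto simp: graded_proper_def)
  have J': "ideal J (poly_ring n)" "J \<subseteq> graded_max_ideal n" using J by (auto simp: graded_proper_def)
  interpret S: dg_subquotient kscale kmul "kd (length xs) ((!) xs)" ksg kaug "kcarrier m (length xs)" "kideal m I (length xs)"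
    by (rule dg_koszul [OF I' xs])
  interpret T: dg_subquotient kscale kmul "kd (length ys) ((!) ys)" ksg kaug "kcarrier n (length ys)" "kideal n J (length ys)"
    by (rule dg_koszul [OF J' ys])
  interpret dg_surjection kscale kmul "kd (length xs) ((!) xs)" ksg kaug "kcarrier m (length xs)" "kideal m I (length xs)"
    kscale kmul "kd (length ys) ((!) ys)" ksg kaug "kcarrier n (length ys)" "kideal n J (length ys)" \<pi>
  proof (unfold_locales, goal_cases)
    case (8 b)
    then obtain a where "a \<in> kcarrier m (length xs)" "\<pi> a = b" using surj by blast
    thus ?case by (intro bexI [of _ a]) simp_all
  next
    case (9 a) thus ?case using ker [of a] by (simp add: S.eqv_def)
  next
    case (6 a) thus ?case using diff [of a] by (simp add: T.eqv_def)
  qed (use add in_C in_N mul sg aug in auto)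
  show ?thesis unfolding koszul_massey_trivial_def by (rule massey_trivial_iff)
qed

text \<open>
  Membership in \<open>I + (f)\<close>, solved for the multiple of \<open>f\<close>.
\<close>

lemma genideal_insert_mod:
  assumes I: "ideal I (poly_ring m)" and f: "f \<in> polys m" and p: "p \<in> Idl\<^bsub>poly_ring m\<^esub> (I \<union> {f})"
  shows "\<exists>b\<in>polys m. p - f * b \<in> I"
proof -
  note D = ideal_poly_ringD [OF I]
  let ?J = "{p \<in> polys m. \<exists>b\<in>polys m. p - f * b \<in> I}"
  have "ideal ?J (poly_ring m)"
  proof (rule ideal_poly_ringI)
    show "0 \<in> ?J" using D(2) polys_0 by (auto intro!: bexI [of _ 0])
  next
    fix a b assume "a \<in> ?J" "b \<in> ?J"
    then obtain u v where uv: "a \<in> polys m" "b \<in> polys m" "u \<in> polys m" "v \<in> polys m" "a - f * u \<in> I" "b - f * v \<in> I"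
      by blast
    have "a + b - f * (u + v) \<in> I" using D(3) [OF uv(5, 6)] by (simp add: algebra_simps)
    thus "a + b \<in> ?J" using uv polys_add by blast
  next
    fix r a :: "'a mpoly" assume r: "r \<in> polys m" and "a \<in> ?J"
    then obtain u where u: "a \<in> polys m" "u \<in> polys m" "a - f * u \<in> I" by blast
    have "r * a - f * (r * u) \<in> I" using D(4) [OF r u(3)] by (simp add: algebra_simps)
    thus "r * a \<in> ?J" using u r polys_mult by blast
  qed auto
  moreover have "I \<union> {f} \<subseteq> ?J"
  proof (intro Un_least subsetI)
    fix x assume x: "x \<in> I"
    hence "x - f * 0 \<in> I" by simp
    thus "x \<in> ?J" using x D(1) polys_0 by blast
  next
    fix x assume x: "x \<in> {f}"
    hence "x - f * 1 \<in> I" using D(2) by simp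
    thus "x \<in> ?J" using x f polys_1 by blast
  qed
  ultimately have "Idl\<^bsub>poly_ring m\<^esub> (I \<union> {f}) \<subseteq> ?J" by (rule genideal_minimal)
  thus ?thesis using p by blast
qed

text \<open>
  The surjection sets the exterior generator \<open>e\<close> of \<open>f\<close> to zero. A cycle \<open>a\<close> in its kernel is
  modulo \<open>I\<close> of the form \<open>f t + e a'\<close>, where \<open>t\<close> and \<open>a'\<close> do not involve \<open>e\<close>. The product of \<open>e\<close> and
  \<open>t\<close>, up to sign the chain \<open>y\<close> of the proof, has a differential with \<open>f t\<close> as its part without \<open>e\<close>.
  Subtracting it leaves a cycle \<open>w\<close> that is divisible by \<open>e\<close>, and the part of \<open>d w\<close>
  without \<open>e\<close> is \<open>f\<close> times the quotient. As \<open>f\<close> is regular modulo \<open>I\<close>, the quotient vanishes there.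
\<close>

lemma koszul_mod_regular_element:
  assumes I: "graded_proper m I" and I': "graded_proper m I'" "I' = Idl\<^bsub>poly_ring m\<^esub> (I \<union> {f})"
    and f: "f \<in> graded_max_ideal m" and reg: "\<And>a. a \<in> polys m \<Longrightarrow> f * a \<in> I \<Longrightarrow> a \<in> I"
    and ys: "set ys \<subseteq> graded_max_ideal m"
  shows "koszul_massey_trivial m I (ys @ [f]) \<longleftrightarrow> koszul_massey_trivial m I' ys"
proof -
  let ?r = "length ys" let ?xs = "ys @ [f]"
  have fp: "f \<in> polys m" using f by (simp add: graded_max_ideal_def)
  have Ii: "ideal I (poly_ring m)" "ideal I' (poly_ring m)" using I I' by (auto simp: graded_proper_def)
  note D = ideal_poly_ringD [OF Ii(1)] and D' = ideal_poly_ringD [OF Ii(2)]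
  have "I \<union> {f} \<subseteq> polys m" using D(1) fp by blast
  hence sub: "I \<union> {f} \<subseteq> I'" unfolding I'(2) by (rule genideal_self)
  have yp: "ys ! i \<in> polys m" if "i < ?r" for i using nth_graded_max [OF ys that] by simp
  define \<pi> where "\<pi> a S = (if S \<subseteq> {..<?r} then a S else 0)" for a :: "nat set \<Rightarrow> 'a mpoly" and S
  have len: "length ?xs = Suc ?r" by simp
  have kdx: "kd (Suc ?r) ((!) ?xs) a U = kd ?r ((!) ys) a U + f * contract ?r a U" for a U
    unfolding kd_def by (simp add: nth_append)
  have contr: "contract i (\<pi> a) U = contract i a U" if "U \<subseteq> {..<?r}" "i < ?r" for i a U
    using that by (auto simp: contract_def \<pi>_def)
  show ?thesis
  proof (rule koszul_massey_trivial_transfer [where \<pi> = \<pi> and xs = "ys @ [f]" and ys = ys, OF I _ I'(1) ys, unfolded len])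
    show "set ?xs \<subseteq> graded_max_ideal m" using f ys by auto
  next
    fix a b :: "nat set \<Rightarrow> 'a mpoly" assume ab: "a \<in> kcarrier m (Suc ?r)" "b \<in> kcarrier m (Suc ?r)"
    show "\<pi> (a + b) = \<pi> a + \<pi> b" by (auto simp: \<pi>_def fun_eq_iff)
    show "\<pi> (kmul a b) = kmul (\<pi> a) (\<pi> b)"
    proof
      fix U
      show "\<pi> (kmul a b) U = kmul (\<pi> a) (\<pi> b) U"
      proof (cases "U \<subseteq> {..<?r}")
        case True
        hence "S \<subseteq> {..<?r} \<and> U - S \<subseteq> {..<?r}" if "S \<in> Pow U" for S using that by auto
        thus ?thesis using True unfolding kmul_def by (auto simp: \<pi>_def [of "kmul a b"] \<pi>_def kmul_def intro!: sum.cong)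
      next
        case False
        have "\<pi> a S * \<pi> b (U - S) = 0" for S using False by (auto simp: \<pi>_def)
        thus ?thesis using False by (simp add: kmul_def \<pi>_def)
      qed
    qed
  next
    fix a :: "nat set \<Rightarrow> 'a mpoly" assume a: "a \<in> kcarrier m (Suc ?r)"
    show \<pi>C: "\<pi> a \<in> kcarrier m ?r" using a by (auto simp: \<pi>_def kcarrier_def polys_0)
    show "\<pi> (ksg a) = ksg (\<pi> a)" by (auto simp: \<pi>_def ksg_def fun_eq_iff)
    show "kaug (\<pi> a) = kaug a" by (simp add: kaug_def \<pi>_def)
    have "(\<pi> (kd (Suc ?r) ((!) ?xs) a) - kd ?r ((!) ys) (\<pi> a)) U = (if U \<subseteq> {..<?r} then f * contract ?r a U else 0)" for U
    proof (cases "U \<subseteq> {..<?r}")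
      case True
      have "kd ?r ((!) ys) (\<pi> a) U = kd ?r ((!) ys) a U"
        unfolding kd_def using contr [OF True] by (intro sum.cong) auto
      thus ?thesis using True by (simp add: \<pi>_def [of "kd (Suc ?r) ((!) ?xs) a"] kdx)
    next
      case False
      have "kd ?r ((!) ys) (\<pi> a) U = 0" using kcarrierD(2) [OF kd_kcarrier [OF yp \<pi>C] False] .
      thus ?thesis using False by (simp add: \<pi>_def)
    qed
    moreover have "f * contract ?r a U \<in> I'" for U
      using sub kcarrierD(1) [OF contract_kcarrier [OF a]] by (intro D'(5)) auto
    ultimately show "\<pi> (kd (Suc ?r) ((!) ?xs) a) - kd ?r ((!) ys) (\<pi> a) \<in> kideal m I' ?r"
      using D'(1, 2) by (auto simp: kideal_def kcarrier_def)
  next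
    fix a :: "nat set \<Rightarrow> 'a mpoly" assume "a \<in> kideal m I (Suc ?r)"
    thus "\<pi> a \<in> kideal m I' ?r"
      using sub D'(2) by (auto simp: \<pi>_def kideal_def kcarrier_def polys_0)
  next
    fix b :: "nat set \<Rightarrow> 'a mpoly" assume b: "b \<in> kcarrier m ?r"
    have "b \<in> kcarrier m (Suc ?r)"
    proof (rule kcarrierI)
      show "b S \<in> polys m" for S by (rule kcarrierD(1) [OF b])
      show "b S = 0" if "\<not> S \<subseteq> {..<Suc ?r}" for S using that by (intro kcarrierD(2) [OF b]) auto
    qed
    moreover have "\<pi> b = b" using b by (auto simp: kcarrier_def \<pi>_def fun_eq_iff)
    ultimately show "\<exists>a\<in>kcarrier m (Suc ?r). \<pi> a = b" by blast
  next
    fix a :: "nat set \<Rightarrow> 'a mpoly" assume a: "a \<in> kcarrier m (Suc ?r)" and \<pi>a: "\<pi> a \<in> kideal m I' ?r"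
      and da: "kd (Suc ?r) ((!) ?xs) a \<in> kideal m I (Suc ?r)"
    have "\<exists>t. t \<in> polys m \<and> (S \<subseteq> {..<?r} \<longrightarrow> a S - f * t \<in> I) \<and> (\<not> S \<subseteq> {..<?r} \<longrightarrow> t = 0)" for S
    proof (cases "S \<subseteq> {..<?r}")
      case True
      hence "a S \<in> I'" using kidealD(2) [OF \<pi>a, of S] by (simp add: \<pi>_def)
      thus ?thesis using True genideal_insert_mod [OF Ii(1) fp] I'(2) by blast
    qed (auto simp: polys_0)
    then obtain t where t: "\<And>S. t S \<in> polys m" "\<And>S. S \<subseteq> {..<?r} \<Longrightarrow> a S - f * t S \<in> I"
      "\<And>S. \<not> S \<subseteq> {..<?r} \<Longrightarrow> t S = 0" by metis
    define y where "y S = (if ?r \<in> S then (- 1) ^ card (S - {?r}) * t (S - {?r}) else 0)" for S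
    have y: "y \<in> kcarrier m (Suc ?r)"
    proof (rule kcarrierI)
      fix S
      show "y S \<in> polys m" using t(1) by (auto simp: y_def polys_0 intro!: polys_sign)
      assume S: "\<not> S \<subseteq> {..<Suc ?r}"
      have "\<not> S - {?r} \<subseteq> {..<?r}" using S by (auto simp: less_Suc_eq)
      thus "y S = 0" by (simp add: y_def t(3))
    qed
    have "\<pi> y = 0" by (auto simp: \<pi>_def y_def fun_eq_iff)
    hence \<pi>y: "\<pi> y \<in> kideal m I' ?r" using D'(2) kcarrier_0 by (simp add: kideal_def)
    define w where "w = a - kd (Suc ?r) ((!) ?xs) y"
    have xp: "?xs ! i \<in> polys m" if "i < Suc ?r" for i using that yp fp by (auto simp: nth_append less_Suc_eq)
    have wC: "w \<in> kcarrier m (Suc ?r)"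
      using a kd_kcarrier [OF xp y] unfolding w_def by (auto simp: kcarrier_def polys_diff)
    have dw: "kd (Suc ?r) ((!) ?xs) w = kd (Suc ?r) ((!) ?xs) a"
      unfolding w_def using kd_add [of "Suc ?r" "(!) ?xs" a "- kd (Suc ?r) ((!) ?xs) y"]
      by (simp only: kd_minus kd_kd diff_conv_add_uminus minus_zero add_0_right)
    have w1: "w U \<in> I" if U: "U \<subseteq> {..<?r}" for U
    proof -
      have fin: "finite U" "?r \<notin> U" using U finite_subset by auto
      have "kd ?r ((!) ys) y U = 0"
        unfolding kd_def using U by (intro sum.neutral) (auto simp: contract_def y_def)
      moreover have "contract ?r y U = t U"
      proof -
        have "{j \<in> U. j < ?r} = U" using U by auto
        thus ?thesis using fin by (simp add: contract_def y_def mult.assoc [symmetric] power_add [symmetric])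
      qed
      ultimately show ?thesis using t(2) [OF U] by (simp add: w_def kdx)
    qed
    have "w U \<in> I" for U
    proof (cases "U \<subseteq> {..<Suc ?r}")
      case False thus ?thesis using kcarrierD(2) [OF wC] D(2) by simp
    next
      case U: True
      show ?thesis
      proof (cases "?r \<in> U")
        case False
        hence "U \<subseteq> {..<?r}" using U by (auto simp: less_Suc_eq)
        thus ?thesis by (rule w1)
      next
        case True
        define V where "V = U - {?r}"
        have V: "U = insert ?r V" "V \<subseteq> {..<?r}" "finite V" "?r \<notin> V"
          using U True finite_subset by (auto simp: V_def less_Suc_eq)
        have "kd (Suc ?r) ((!) ?xs) w V \<in> I" using kidealD(2) [OF da] dw by simp
        moreover have "kd ?r ((!) ys) w V \<in> I"
          unfolding kd_def
        proof (intro ideal_sum [OF Ii(1)] D(4))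
          fix i assume i: "i \<in> {..<?r}"
          thus "ys ! i \<in> polys m" using yp by simp
          show "contract i w V \<in> I"
            using V i D(2) by (auto simp: contract_def intro!: ideal_sign [OF Ii(1)] w1)
        qed
        ultimately have "f * contract ?r w V \<in> I" using D(7) by (fastforce simp: kdx)
        hence "contract ?r w V \<in> I" using reg kcarrierD(1) [OF contract_kcarrier [OF wC]] by blast
        hence "(- 1) ^ below V ?r * contract ?r w V \<in> I" by (rule ideal_sign [OF Ii(1)])
        thus ?thesis using V by (simp add: contract_def mult.assoc [symmetric] power_add [symmetric])
      qed
    qed
    hence "w \<in> kideal m I (Suc ?r)" using wC by (simp add: kideal_def)
    thus "\<exists>y\<in>kcarrier m (Suc ?r). \<pi> y \<in> kideal m I' ?r \<and> a - kd (Suc ?r) ((!) ?xs) y \<in> kideal m I (Suc ?r)"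
      using y \<pi>y unfolding w_def by blast
  qed
qed

section \<open>Independence of the basis of linear forms\<close>

lemma kmul_kone_right: "kmul a kone U = (if finite U then a U else 0)"
proof (cases "finite U")
  case True
  have "inv_count U {} = 0" by (simp add: inv_count_def)
  hence "kmul a kone U = (\<Sum>S\<in>Pow U. if S = U then a U else 0)"
    unfolding kmul_def by (intro sum.cong refl) (auto simp: kone_def)
  thus ?thesis using True by simp
qed (simp add: kmul_infinite)

lemma vprod_singleton:
  assumes "degree_one (v i)" shows "vprod v {i} = v i"
proof
  fix U
  have "v i U = 0" if "infinite U" using assms that by (auto simp: degree_one_def)
  thus "vprod v {i} U = v i U" using vprod_insert_min [of "{}" i v] by (auto simp: kmul_kone_right)
qed

lemma degree_one_sum: "(\<And>i. i \<in> A \<Longrightarrow> degree_one (f i)) \<Longrightarrow> degree_one (\<Sum>i\<in>A. f i)"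
  unfolding degree_one_def fun_sum_apply by (metis (mono_tags, lifting) sum.neutral)

lemma degree_one_rs: "degree_one a \<Longrightarrow> degree_one (rs p a)"
  unfolding degree_one_def rs_def by (metis mult_zero_right)

lemma kd_unit_vec: "j < r \<Longrightarrow> kd r x (unit_vec j) = rs (x j) kone"
proof
  fix U assume j: "j < r"
  have "x i * contract i (unit_vec j) U = (if i = j then x j * kone U else 0)" for i
    by (auto simp: contract_def unit_vec_def kone_def)
  thus "kd r x (unit_vec j) U = rs (x j) kone U" using j by (simp add: kd_def rs_def)
qed

definition lin_comb_vec :: "nat \<Rightarrow> (nat \<Rightarrow> 'k::field) \<Rightarrow> nat set \<Rightarrow> 'k mpoly" where
  "lin_comb_vec r c = (\<Sum>j<r. rs (const (c j)) (unit_vec j))"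

lemma degree_one_lin_comb_vec: "degree_one (lin_comb_vec r c)"
  unfolding lin_comb_vec_def by (intro degree_one_sum degree_one_rs degree_one_unit_vec)

lemma kd_lin_comb_vec: "kd r x (lin_comb_vec r c) = rs (\<Sum>j<r. const (c j) * x j) kone"
  by (simp add: lin_comb_vec_def kd_sum kd_rs kd_unit_vec rs_sum)

lemma kmap_unit_vec:
  assumes "degree_one (w j)" "j < r" shows "kmap r w (unit_vec j) = w j"
proof -
  have "kmap r w (unit_vec j) = (\<Sum>S\<in>Pow {..<r}. if S = {j} then w j else 0)"
    unfolding kmap_def by (intro sum.cong refl) (auto simp: unit_vec_def vprod_singleton assms(1))
  thus ?thesis using assms(2) by simp
qed

lemma lin_comb_vec_kcarrier: "lin_comb_vec r c \<in> kcarrier m r"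
proof -
  have "rs (const (c j)) (unit_vec j) S \<in> polys m" for S j
    by (auto simp: rs_def unit_vec_def polys_0 polys_const)
  moreover have "rs (const (c j)) (unit_vec j) S = 0" if "j < r" "\<not> S \<subseteq> {..<r}" for S j
    using that by (auto simp: rs_def unit_vec_def)
  ultimately show ?thesis
    by (intro kcarrierI) (auto simp: lin_comb_vec_def fun_sum_apply intro!: polys_sum sum.neutral)
qed

lemma vprod_kcarrier:
  assumes "\<And>i. v i \<in> kcarrier m r" "finite S" shows "vprod v S \<in> kcarrier m r"
  using assms(2)
proof (induction S rule: finite_linorder_min_induct)
  case empty show ?case by (auto simp: kone_def kcarrier_def polys_0 polys_1)
next
  case (insert b A) thus ?case using assms(1) by (simp add: vprod_insert_min kmul_kcarrier)
qed

lemma ksg_vprod: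
  assumes v: "\<And>i. degree_one (v i)" and "finite S"
  shows "ksg (vprod v S) = rs ((- 1) ^ card S) (vprod v S)"
  using assms(2)
proof (induction S rule: finite_linorder_min_induct)
  case empty show ?case by (auto simp: ksg_def rs_def kone_def fun_eq_iff)
next
  case (insert b A)
  have "ksg (v b) = rs (- 1) (v b)"
  proof
    fix S
    show "ksg (v b) S = rs (- 1) (v b) S"
      using v [of b] by (cases "v b S = 0") (auto simp: ksg_def degree_one_def rs_def)
  qed
  moreover have "card (insert b A) = Suc (card A)" using insert.hyps by (intro card_insert_disjoint) auto
  ultimately show ?case
    using insert by (simp only: vprod_insert_min ksg_kmul kmul_rs_left kmul_rs_right rs_simps(1) power_Suc2)
qed

text \<open>
  The product of the two matrices of base change is the identity, since the \<open>xs ! i\<close> are linearly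
  independent modulo \<open>I\<close>.
\<close>

lemma basis_change_inverse:
  assumes I: "ideal I (poly_ring m)" and xs: "lin_basis m I xs"
    and M: "\<And>i. i < length xs \<Longrightarrow> xs ! i - (\<Sum>j<r. const (M i j) * ys ! j) \<in> I"
    and M': "\<And>j. j < r \<Longrightarrow> ys ! j - (\<Sum>k<length xs. const (M' j k) * xs ! k) \<in> I"
    and i: "i < length xs"
  shows "kmap r (\<lambda>j. lin_comb_vec (length xs) (M' j)) (lin_comb_vec r (M i)) = unit_vec i"
proof -
  note D = ideal_poly_ringD [OF I]
  let ?r = "length xs"
  define P where "P k = (\<Sum>j<r. M i j * M' j k)" for k
  have constP: "const (P k) = (\<Sum>j<r. const (M i j) * const (M' j k))" for k
  proof -
    have "const (\<Sum>j\<in>A. g j) = (\<Sum>j\<in>A. const (g j))" for A :: "nat set" and g :: "nat \<Rightarrow> 'a"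
      by (induction A rule: infinite_finite_induct) (auto simp: const_add)
    thus ?thesis by (simp add: P_def const_mult)
  qed
  have "xs ! i - (\<Sum>j<r. const (M i j) * ys ! j) +
      (\<Sum>j<r. const (M i j) * (ys ! j - (\<Sum>k<?r. const (M' j k) * xs ! k))) \<in> I"
    using M' by (intro D(3) M i ideal_sum [OF I] D(4) polys_const) auto
  also have "xs ! i - (\<Sum>j<r. const (M i j) * ys ! j) +
      (\<Sum>j<r. const (M i j) * (ys ! j - (\<Sum>k<?r. const (M' j k) * xs ! k))) =
      xs ! i - (\<Sum>j<r. \<Sum>k<?r. const (M i j) * const (M' j k) * xs ! k)"
    by (simp add: right_diff_distrib sum_subtractf sum_distrib_left mult.assoc)
  also have "(\<Sum>j<r. \<Sum>k<?r. const (M i j) * const (M' j k) * xs ! k) = (\<Sum>k<?r. const (P k) * xs ! k)"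
    by (subst sum.swap) (simp add: constP sum_distrib_right)
  finally have 1: "xs ! i - (\<Sum>k<?r. const (P k) * xs ! k) \<in> I" .
  have "(\<Sum>k<?r. const ((if k = i then 1 else 0) - P k) * xs ! k) = xs ! i - (\<Sum>k<?r. const (P k) * xs ! k)"
  proof -
    have "const ((if k = i then 1 else 0) - P k) * xs ! k = (if k = i then xs ! i else 0) - const (P k) * xs ! k" for k
      by (simp add: single_diff left_diff_distrib)
    thus ?thesis using i by (simp add: sum_subtractf)
  qed
  hence "(\<Sum>k<?r. const ((if k = i then 1 else 0) - P k) * xs ! k) \<in> I" using 1 by simp
  hence "\<forall>k<?r. (if k = i then 1 else 0) - P k = 0"
    using xs unfolding lin_basis_def by (elim conjE allE [of _ "\<lambda>k. (if k = i then 1 else 0) - P k"] impE)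
  hence P: "P k = (if k = i then 1 else 0)" if "k < ?r" for k using that by simp
  have "kmap r (\<lambda>j. lin_comb_vec ?r (M' j)) (lin_comb_vec r (M i)) =
      (\<Sum>j<r. rs (const (M i j)) (lin_comb_vec ?r (M' j)))"
    unfolding lin_comb_vec_def [of r] kmap_sum kmap_rs
    by (intro sum.cong refl) (simp add: kmap_unit_vec degree_one_lin_comb_vec)
  also have "\<dots> = (\<Sum>j<r. \<Sum>k<?r. rs (const (M i j) * const (M' j k)) (unit_vec k))"
    by (simp only: lin_comb_vec_def rs_sum rs_simps(1))
  also have "\<dots> = (\<Sum>k<?r. rs (const (P k)) (unit_vec k))"
    by (subst sum.swap) (simp only: constP rs_sum)
  also have "\<dots> = (\<Sum>k<?r. if k = i then unit_vec i else 0)"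
    by (intro sum.cong refl) (auto simp: P)
  also have "\<dots> = unit_vec i" using i by simp
  finally show ?thesis .
qed

lemma kmap_kideal:
  assumes I: "ideal I (poly_ring m)" and v: "\<And>i. v i \<in> kcarrier m r'"
    and a: "a \<in> kcarrier m r" "\<And>S. a S \<in> I"
  shows "kmap r v a \<in> kideal m I r'"
proof -
  have vp: "vprod v S \<in> kcarrier m r'" if "S \<in> Pow {..<r}" for S
    using that finite_subset by (intro vprod_kcarrier v) auto
  have "rs (a S) (vprod v S) U \<in> I" if "S \<in> Pow {..<r}" for S U
    using kcarrierD(1) [OF vp [OF that]] a(2) ideal_poly_ringD(5) [OF I] by (simp add: rs_def)
  moreover have "rs (a S) (vprod v S) U = 0" if "S \<in> Pow {..<r}" "\<not> U \<subseteq> {..<r'}" for S U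
    using kcarrierD(2) [OF vp [OF that(1)] that(2)] by (simp add: rs_def)
  ultimately show ?thesis
    using ideal_poly_ringD(1) [OF I]
    by (auto simp: kmap_def kideal_def kcarrier_def fun_sum_apply intro!: ideal_sum [OF I] sum.neutral)
qed

lemma ideal_polys: "ideal (polys m) (poly_ring m)"
  by (rule ideal_poly_ringI) (auto simp: polys_closed)

lemma kmap_kcarrier:
  assumes "\<And>i. v i \<in> kcarrier m r'" "a \<in> kcarrier m r"
  shows "kmap r v a \<in> kcarrier m r'"
  using kmap_kideal [OF ideal_polys assms(1, 2)] assms(2) by (simp add: kideal_def kcarrierD)

text \<open>
  The linear forms \<open>xs ! i\<close> are congruent to combinations \<open>z i\<close> of \<open>ys\<close>. The induced isomorphism of
  exterior algebras commutes exactly with the differentials given by \<open>z\<close> and \<open>ys\<close>, and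
  the differential given by \<open>xs\<close> is congruent to the one given by \<open>z\<close>.
\<close>

lemma koszul_basis_independent:
  assumes I: "graded_proper m I" and xs: "lin_basis m I xs" and ys: "lin_basis m I ys"
  shows "koszul_massey_trivial m I xs \<longleftrightarrow> koszul_massey_trivial m I ys"
proof -
  have Ii: "ideal I (poly_ring m)" using I by (simp add: graded_proper_def)
  note D = ideal_poly_ringD [OF Ii]
  let ?r = "length xs" let ?s = "length ys"
  have xf: "set xs \<subseteq> forms m 1" and yf: "set ys \<subseteq> forms m 1" using xs ys by (auto simp: lin_basis_def)
  define M where "M i = (SOME c. xs ! i - (\<Sum>j<?s. const (c j) * ys ! j) \<in> I)" for i
  have M: "xs ! i - (\<Sum>j<?s. const (M i j) * ys ! j) \<in> I" if i: "i < ?r" for i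
  proof -
    have "xs ! i \<in> forms m 1" using xf i by auto
    from someI_ex [OF lin_basis_coords [OF Ii ys this]] show ?thesis unfolding M_def .
  qed
  define M' where "M' j = (SOME c. ys ! j - (\<Sum>k<?r. const (c k) * xs ! k) \<in> I)" for j
  have M': "ys ! j - (\<Sum>k<?r. const (M' j k) * xs ! k) \<in> I" if j: "j < ?s" for j
  proof -
    have "ys ! j \<in> forms m 1" using yf j by auto
    from someI_ex [OF lin_basis_coords [OF Ii xs this]] show ?thesis unfolding M'_def .
  qed
  define v where "v i = lin_comb_vec ?s (M i)" for i
  define w where "w j = lin_comb_vec ?r (M' j)" for j
  have v1: "degree_one (v i)" and w1: "degree_one (w i)" for i
    by (simp_all add: v_def w_def degree_one_lin_comb_vec)
  have vC: "v i \<in> kcarrier m ?s" and wC: "w i \<in> kcarrier m ?r" for i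
    by (simp_all add: v_def w_def lin_comb_vec_kcarrier)
  have wv: "kmap ?s w (v i) = unit_vec i" if "i < ?r" for i
    using basis_change_inverse [OF Ii xs M M' that] by (simp add: v_def w_def [abs_def])
  have vw: "kmap ?r v (w j) = unit_vec j" if "j < ?s" for j
    using basis_change_inverse [OF Ii ys M' M that] by (simp add: w_def v_def [abs_def])
  have inv1: "kmap ?s w (kmap ?r v a) = a" if "a \<in> kcarrier m ?r" for a
    using kmap_inverse [OF w1 wv] kcarrierD(2) [OF that] by blast
  have inv2: "kmap ?r v (kmap ?s w b) = b" if "b \<in> kcarrier m ?s" for b
    using kmap_inverse [OF v1 vw] kcarrierD(2) [OF that] by blast
  define z where "z i = (\<Sum>j<?s. const (M i j) * ys ! j)" for i
  show ?thesis
  proof (rule koszul_massey_trivial_transfer [where \<pi> = "kmap ?r v" and xs = xs and ys = ys, OF I _ I])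
    show "set xs \<subseteq> graded_max_ideal m" "set ys \<subseteq> graded_max_ideal m" using xf yf forms_graded_max by blast+
  next
    fix a b :: "nat set \<Rightarrow> 'a mpoly" assume "a \<in> kcarrier m ?r" "b \<in> kcarrier m ?r"
    show "kmap ?r v (a + b) = kmap ?r v a + kmap ?r v b" by (rule kmap_add)
    show "kmap ?r v (kmul a b) = kmul (kmap ?r v a) (kmap ?r v b)" by (rule kmap_kmul [OF v1])
  next
    fix a :: "nat set \<Rightarrow> 'a mpoly" assume a: "a \<in> kideal m I ?r"
    show "kmap ?r v a \<in> kideal m I ?s" by (rule kmap_kideal [OF Ii vC kidealD [OF a]])
  next
    fix b :: "nat set \<Rightarrow> 'a mpoly" assume b: "b \<in> kcarrier m ?s"
    show "\<exists>a\<in>kcarrier m ?r. kmap ?r v a = b"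
      using inv2 [OF b] kmap_kcarrier [where v = w, OF wC b] by (intro bexI [of _ "kmap ?s w b"])
  next
    fix a :: "nat set \<Rightarrow> 'a mpoly" assume a: "a \<in> kcarrier m ?r" and k: "kmap ?r v a \<in> kideal m I ?s"
    have "kmap ?s w (kmap ?r v a) \<in> kideal m I ?r" by (rule kmap_kideal [OF Ii wC kidealD [OF k]])
    hence "a - kd ?r ((!) xs) 0 \<in> kideal m I ?r" using inv1 [OF a] by simp
    moreover have "kmap ?r v 0 \<in> kideal m I ?s" using D(2) kcarrier_0 by (simp add: kideal_def)
    ultimately show "\<exists>y\<in>kcarrier m ?r. kmap ?r v y \<in> kideal m I ?s \<and> a - kd ?r ((!) xs) y \<in> kideal m I ?r"
      using kcarrier_0 by blast
  next
    fix a :: "nat set \<Rightarrow> 'a mpoly" assume a: "a \<in> kcarrier m ?r"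
    show "kmap ?r v a \<in> kcarrier m ?s" by (rule kmap_kcarrier [OF vC a])
    show "kmap ?r v (ksg a) = ksg (kmap ?r v a)"
    proof -
      have ksg_sum: "ksg (\<Sum>i\<in>A. f i) = (\<Sum>i\<in>A. ksg (f i))" for A :: "nat set set" and f :: "nat set \<Rightarrow> nat set \<Rightarrow> 'a mpoly"
        by (auto simp: ksg_def fun_eq_iff fun_sum_apply sum_distrib_left)
      have "ksg (rs (a S) (vprod v S)) = rs (ksg a S) (vprod v S)" if "S \<in> Pow {..<?r}" for S
      proof -
        have "finite S" using that finite_subset by auto
        have "ksg (rs (a S) (vprod v S)) = rs (a S) (ksg (vprod v S))"
          by (simp add: ksg_def rs_def fun_eq_iff mult.left_commute)
        also have "\<dots> = rs (ksg a S) (vprod v S)"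
          unfolding ksg_vprod [OF v1 \<open>finite S\<close>] rs_simps(1) by (simp add: ksg_def mult.commute)
        finally show ?thesis .
      qed
      thus ?thesis unfolding kmap_def ksg_sum by (intro sum.cong refl) simp
    qed
    show "kaug (kmap ?r v a) = kaug a"
    proof -
      have vp: "vprod v S {} = (if S = {} then 1 else 0)" if "finite S" for S
        using that
      proof (induction S rule: finite_linorder_min_induct)
        case (insert b A)
        have "v b {} = 0" using v1 [of b] by (auto simp: degree_one_def)
        thus ?case using insert by (simp add: vprod_insert_min kmul_def)
      qed (simp add: kone_def)
      have "kmap ?r v a {} = (\<Sum>S\<in>Pow {..<?r}. a S * vprod v S {})"
        unfolding kmap_def fun_sum_apply rs_def ..
      also have "\<dots> = (\<Sum>S\<in>Pow {..<?r}. if S = {} then a {} else 0)"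
      proof (intro sum.cong refl)
        fix S assume "S \<in> Pow {..<?r}"
        hence "finite S" using finite_subset by auto
        thus "a S * vprod v S {} = (if S = {} then a {} else 0)" by (cases "S = {}") (simp_all add: vp kone_def)
      qed
      finally have "kmap ?r v a {} = (\<Sum>S\<in>Pow {..<?r}. if S = {} then a {} else 0)" .
      thus ?thesis by (simp add: kaug_def)
    qed
    have "kmap ?r v (kd ?r ((!) xs) a) - kd ?s ((!) ys) (kmap ?r v a) =
        kmap ?r v (kd ?r ((!) xs) a - kd ?r z a)"
    proof -
      have "kd ?s ((!) ys) (kmap ?r v a) = kmap ?r v (kd ?r z a)"
        by (rule kmap_kd [OF v1, symmetric]) (simp add: v_def z_def kd_lin_comb_vec)
      moreover have "kmap ?r v (p - q) = kmap ?r v p - kmap ?r v q" for p q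
        using kmap_add [of ?r v "p - q" q] by (metis diff_add_cancel add_diff_cancel_right')
      ultimately show ?thesis by metis
    qed
    also have "\<dots> \<in> kideal m I ?s"
    proof (rule kmap_kideal [OF Ii vC])
      have xp: "xs ! i \<in> polys m" if "i < ?r" for i
        using forms_polys [of "xs ! i" m 1] xf nth_mem [OF that] by blast
      have "ys ! j \<in> polys m" if "j < ?s" for j
        using forms_polys [of "ys ! j" m 1] yf nth_mem [OF that] by blast
      hence zp: "z i \<in> polys m" for i
        unfolding z_def by (intro polys_sum polys_mult polys_const) auto
      show "kd ?r ((!) xs) a - kd ?r z a \<in> kcarrier m ?r"
        using kd_kcarrier [OF xp a] kd_kcarrier [OF zp a] by (auto simp: kcarrier_def polys_diff)
      fix S
      have "(kd ?r ((!) xs) a - kd ?r z a) S = (\<Sum>i<?r. (xs ! i - z i) * contract i a S)"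
        by (simp add: kd_def left_diff_distrib sum_subtractf)
      also have "\<dots> \<in> I"
        using M kcarrierD(1) [OF contract_kcarrier [OF a]] by (intro ideal_sum [OF Ii] D(5)) (auto simp: z_def)
      finally show "(kd ?r ((!) xs) a - kd ?r z a) S \<in> I" .
    qed
    finally show "kmap ?r v (kd ?r ((!) xs) a) - kd ?s ((!) ys) (kmap ?r v a) \<in> kideal m I ?s" .
  qed
qed

section \<open>Reduction modulo one linear form\<close>

lemma lin_basis_iff:
  assumes "ideal I (poly_ring m)"
  shows "lin_basis m I xs \<longleftrightarrow> set xs \<subseteq> forms m 1 \<and>
    (\<forall>l\<in>forms m 1. \<exists>c. l - (\<Sum>i<length xs. const (c i) * xs ! i) \<in> I) \<and>
    (\<forall>c. (\<Sum>i<length xs. const (c i) * xs ! i) \<in> I \<longrightarrow> (\<forall>i<length xs. c i = 0))"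
proof -
  have sp: "l \<in> MP.span (I \<union> set xs)" if "l - (\<Sum>i<length xs. const (c i) * xs ! i) \<in> I" for l c
  proof -
    have "(l - (\<Sum>i<length xs. const (c i) * xs ! i)) + (\<Sum>i<length xs. mscale (c i) (xs ! i)) \<in> MP.span (I \<union> set xs)"
      using that by (intro MP.span_add MP.span_sum MP.span_scale MP.span_base) auto
    thus ?thesis by (simp add: mscale_def)
  qed
  show ?thesis (is "_ \<longleftrightarrow> ?R")
  proof
    assume xs: "lin_basis m I xs"
    show ?R using xs lin_basis_coords [OF assms xs] by (simp add: lin_basis_def)
  next
    assume R: ?R
    have "forms m 1 \<subseteq> MP.span (I \<union> set xs)"
    proof
      fix l :: "'a mpoly" assume "l \<in> forms m 1"
      then obtain c where "l - (\<Sum>i<length xs. const (c i) * xs ! i) \<in> I" using R by (elim conjE) (drule (1) bspec, elim exE)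
      thus "l \<in> MP.span (I \<union> set xs)" by (rule sp)
    qed
    thus "lin_basis m I xs" using R by (simp add: lin_basis_def)
  qed
qed

text \<open>
  A spanning list of minimal length is independent. One spanning list consists of the variables.
\<close>

lemma exists_lin_basis:
  assumes I: "ideal I (poly_ring m)"
  shows "\<exists>xs. lin_basis m I xs"
proof -
  define P where "P xs \<longleftrightarrow> set xs \<subseteq> forms m 1 \<and> forms m 1 \<subseteq> MP.span (I \<union> set xs)" for xs
  have "P (map var [0..<m])"
    unfolding P_def
  proof (intro conjI subsetI)
    show "x \<in> forms m 1" if "x \<in> set (map var [0..<m])" for x using that var_forms by auto
    fix l :: "'a mpoly" assume "l \<in> forms m 1"
    hence "l = (\<Sum>i<m. mscale (Poly_Mapping.lookup l (vmon i)) (var i))"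
      using linear_form_eq by (simp add: mscale_def)
    also have "\<dots> \<in> MP.span (I \<union> set (map var [0..<m]))"
      by (intro MP.span_sum MP.span_scale MP.span_base) auto
    finally show "l \<in> MP.span (I \<union> set (map var [0..<m]))" .
  qed
  then obtain xs where xs: "P xs" and min: "\<And>ys. P ys \<Longrightarrow> length xs \<le> length ys"
    using ex_has_least_nat [of P _ length] by blast
  have "c j = 0" if c: "(\<Sum>i<length xs. const (c i) * xs ! i) \<in> I" and j: "j < length xs" for c j
  proof (rule ccontr)
    assume nz: "c j \<noteq> 0"
    define zs where "zs = take j xs @ drop (Suc j) xs"
    let ?S = "MP.span (I \<union> set zs)"
    have zs: "set zs \<subseteq> set xs" by (auto simp: zs_def dest: in_set_takeD in_set_dropD)
    have mem: "xs ! i \<in> set zs" if "i < length xs" "i \<noteq> j" for i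
    proof (cases "i < j")
      case True thus ?thesis using j by (auto simp: zs_def in_set_conv_nth intro!: exI [of _ i])
    next
      case False
      hence 1: "xs ! i = drop (Suc j) xs ! (i - Suc j)" and 2: "i - Suc j < length (drop (Suc j) xs)"
        using that by auto
      from nth_mem [OF 2] show ?thesis unfolding 1 [symmetric] by (simp add: zs_def)
    qed
    have "(\<Sum>i<length xs. const (c i) * xs ! i) - (\<Sum>i\<in>{..<length xs} - {j}. mscale (c i) (xs ! i)) \<in> ?S"
      using c mem by (intro MP.span_diff MP.span_sum MP.span_scale MP.span_base) auto
    hence "mscale (c j) (xs ! j) \<in> ?S" using j by (simp add: sum.remove [of _ j] mscale_def)
    hence "mscale (inverse (c j)) (mscale (c j) (xs ! j)) \<in> ?S" by (rule MP.span_scale)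
    hence "xs ! j \<in> ?S" using nz by simp
    hence "xs ! i \<in> ?S" if "i < length xs" for i
      using mem [OF that] MP.span_base [of "xs ! i" "I \<union> set zs"] by (cases "i = j") auto
    hence "set xs \<subseteq> ?S" by (auto simp: in_set_conv_nth)
    hence "I \<union> set xs \<subseteq> ?S" using MP.span_superset [of "I \<union> set zs"] by blast
    hence "MP.span (I \<union> set xs) \<subseteq> ?S" by (intro MP.span_minimal) auto
    hence "P zs" using xs zs unfolding P_def by blast
    moreover have "length zs < length xs" using j by (simp add: zs_def)
    ultimately show False using min by fastforce
  qed
  hence "lin_basis m I xs" using xs by (simp add: P_def lin_basis_def)
  thus ?thesis by blast
qed

text \<open>
  The linear parts of elements of \<open>I + (f)\<close> are those of \<open>I\<close> and the multiples of \<open>f\<close>, hence the spanning. In a relation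
  modulo \<open>I\<close> the coefficients of \<open>ys\<close> vanish modulo \<open>I'\<close>; what remains is a multiple
  \<open>c f \<in> I\<close>, and \<open>c \<noteq> 0\<close> would put \<open>c\<close> in \<open>I\<close> by regularity, although \<open>I\<close> is proper.
\<close>

lemma lin_basis_append:
  assumes I: "graded_proper m I" and I': "graded_proper m I'" "I' = Idl\<^bsub>poly_ring m\<^esub> (I \<union> {f})"
    and f: "f \<in> forms m 1" and reg: "\<And>a. a \<in> polys m \<Longrightarrow> f * a \<in> I \<Longrightarrow> a \<in> I"
    and ys: "lin_basis m I' ys"
  shows "lin_basis m I (ys @ [f])"
proof -
  have Ii: "ideal I (poly_ring m)" "ideal I' (poly_ring m)" using I I' by (auto simp: graded_proper_def)
  note D = ideal_poly_ringD [OF Ii(1)] and D' = ideal_poly_ringD [OF Ii(2)]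
  have fp: "f \<in> polys m" "f \<in> graded_max_ideal m" using f forms_polys forms_graded_max by blast+
  have "I \<union> {f} \<subseteq> polys m" using D(1) fp by blast
  hence sub: "I \<union> {f} \<subseteq> I'" unfolding I'(2) by (rule genideal_self)
  let ?r = "length ys"
  have yf: "set ys \<subseteq> forms m 1" using ys by (simp add: lin_basis_def)
  show ?thesis
    unfolding lin_basis_def
  proof (intro conjI allI impI)
    show "set (ys @ [f]) \<subseteq> forms m 1" using yf f by simp
    let ?S = "MP.span (I \<union> set (ys @ [f]))"
    show "forms m 1 \<subseteq> ?S"
    proof
      fix l :: "'a mpoly" assume l: "l \<in> forms m 1"
      obtain c where c: "l - (\<Sum>i<?r. const (c i) * ys ! i) \<in> I'" using lin_basis_coords [OF Ii(2) ys l] by blast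
      let ?s = "\<Sum>i<?r. const (c i) * ys ! i"
      have s: "?s \<in> forms m 1" using yf by (intro forms_sum forms_const_mult) auto
      have "f \<in> homogeneous_elements m" using f by (auto simp: homogeneous_elements_def)
      hence "part 1 (l - ?s) \<in> MP.span (I \<union> ({f} \<inter> forms m 1))"
        using c fp(2) unfolding I'(2) by (intro part1_genideal [OF I]) auto
      hence "l - ?s \<in> MP.span (I \<union> {f})" using l s f by (simp add: part_diff part_forms)
      hence 1: "l - ?s \<in> ?S" using MP.span_mono [of "I \<union> {f}" "I \<union> set (ys @ [f])"] by auto
      have "(\<Sum>i<?r. mscale (c i) (ys ! i)) \<in> ?S"
        by (intro MP.span_sum MP.span_scale MP.span_base) auto
      hence "?s \<in> ?S" by (simp add: mscale_def)
      from MP.span_add [OF 1 this] show "l \<in> ?S" by simp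
    qed
  next
    fix c i assume c: "(\<Sum>i<length (ys @ [f]). const (c i) * (ys @ [f]) ! i) \<in> I" and i: "i < length (ys @ [f])"
    have "(\<Sum>i<length (ys @ [f]). const (c i) * (ys @ [f]) ! i) = (\<Sum>i<?r. const (c i) * ys ! i) + const (c ?r) * f"
      by (simp add: nth_append)
    with c have c': "(\<Sum>i<?r. const (c i) * ys ! i) + const (c ?r) * f \<in> I" by simp
    have "(\<Sum>i<?r. const (c i) * ys ! i) + const (c ?r) * f - const (c ?r) * f \<in> I'"
      using c' sub by (intro D'(7) D'(4) polys_const) auto
    hence "(\<Sum>i<?r. const (c i) * ys ! i) \<in> I'" by simp
    hence 0: "c i = 0" if "i < ?r" for i using ys that by (auto simp: lin_basis_def)
    have "c ?r = 0"
    proof (rule ccontr)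
      assume nz: "c ?r \<noteq> 0"
      have "f * const (c ?r) \<in> I" using c' 0 by (simp add: mult.commute)
      hence "const (c ?r) \<in> I" using reg polys_const by blast
      hence "Poly_Mapping.lookup (const (c ?r)) 0 = 0" using I by (auto simp: graded_proper_def graded_max_ideal_def)
      thus False using nz by simp
    qed
    thus "c i = 0" using 0 i by (cases "i = ?r") auto
  qed
qed

lemma golod_mod_regular_linear_form:
  assumes I: "graded_proper m I" and I': "graded_proper m I'" "I' = Idl\<^bsub>poly_ring m\<^esub> (I \<union> {f})"
    and f: "f \<in> forms m 1" and reg: "\<And>a. a \<in> polys m \<Longrightarrow> f * a \<in> I \<Longrightarrow> a \<in> I"
  shows "golod m I \<longleftrightarrow> golod m I'"
proof -
  have Ii: "ideal I' (poly_ring m)" using I' by (auto simp: graded_proper_def)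
  obtain ys where ys: "lin_basis m I' ys" using exists_lin_basis [OF Ii] by blast
  have ysf: "lin_basis m I (ys @ [f])" by (rule lin_basis_append [OF I I' f reg ys])
  have yM: "set ys \<subseteq> graded_max_ideal m" "f \<in> graded_max_ideal m"
    using ys f forms_graded_max by (auto simp: lin_basis_def)
  have "golod m I \<longleftrightarrow> koszul_massey_trivial m I (ys @ [f])"
    using golod_iff [OF I] koszul_basis_independent [OF I _ ysf] ysf by blast
  also have "\<dots> \<longleftrightarrow> koszul_massey_trivial m I' ys"
    by (rule koszul_mod_regular_element [OF I I' yM(2) reg yM(1)])
  also have "\<dots> \<longleftrightarrow> golod m I'"
    using golod_iff [OF I'(1)] koszul_basis_independent [OF I'(1) _ ys] ys by blast
  finally show ?thesis .
qed

section \<open>Graded surjections of polynomial rings\<close>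

locale graded_surjection =
  fixes m n :: nat and \<phi> :: "'k::field mpoly \<Rightarrow> 'k mpoly"
  assumes hom: "graded_alg_hom m n \<phi>" and surj: "\<phi> ` polys m = polys n"
begin

lemma \<phi>_polys: "p \<in> polys m \<Longrightarrow> \<phi> p \<in> polys n"
  using surj by blast

lemma \<phi>_add: "p \<in> polys m \<Longrightarrow> q \<in> polys m \<Longrightarrow> \<phi> (p + q) = \<phi> p + \<phi> q"
  and \<phi>_mult: "p \<in> polys m \<Longrightarrow> q \<in> polys m \<Longrightarrow> \<phi> (p * q) = \<phi> p * \<phi> q"
  using hom ring_hom_add [of \<phi> "poly_ring m" "poly_ring n" p q]
    ring_hom_mult [of \<phi> "poly_ring m" "poly_ring n" p q]
  by (auto simp: graded_alg_hom_def)

lemma \<phi>_const: "\<phi> (const c) = const c"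
  using hom by (simp add: graded_alg_hom_def)

lemma \<phi>_0: "\<phi> 0 = 0"
  using \<phi>_const [of 0] by simp

lemma \<phi>_forms: "p \<in> forms m e \<Longrightarrow> \<phi> p \<in> forms n e"
  using hom by (auto simp: graded_alg_hom_def)

lemma \<phi>_minus: "p \<in> polys m \<Longrightarrow> \<phi> (- p) = - \<phi> p"
  using \<phi>_add [of p "- p"] polys_minus [of p m] by (simp add: \<phi>_0 eq_neg_iff_add_eq_0 add.commute)

lemma \<phi>_diff: "p \<in> polys m \<Longrightarrow> q \<in> polys m \<Longrightarrow> \<phi> (p - q) = \<phi> p - \<phi> q"
  using \<phi>_add [of p "- q"] \<phi>_minus [of q] polys_minus [of q m] by simp

lemma \<phi>_sum: "(\<And>i. i \<in> A \<Longrightarrow> f i \<in> polys m) \<Longrightarrow> \<phi> (\<Sum>i\<in>A. f i) = (\<Sum>i\<in>A. \<phi> (f i))"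
  by (induction A rule: infinite_finite_induct) (auto simp: \<phi>_0 \<phi>_add polys_sum)

lemma \<phi>_sign: "p \<in> polys m \<Longrightarrow> \<phi> ((- 1) ^ k * p) = (- 1) ^ k * \<phi> p"
  by (cases "even k") (auto simp: \<phi>_minus)

lemma \<phi>_part: "p \<in> polys m \<Longrightarrow> part e (\<phi> p) = \<phi> (part e p)"
proof -
  assume p: "p \<in> polys m"
  let ?s = "\<lambda>k. Poly_Mapping.single k (Poly_Mapping.lookup p k)"
  let ?K = "Poly_Mapping.keys p"
  have s: "?s k \<in> polys m" "?s k \<in> forms m (mdeg k)" if "k \<in> ?K" for k
    using p that by (auto simp: polys_iff forms_def)
  have "part e (\<phi> p) = part e (\<Sum>k\<in>?K. \<phi> (?s k))"
    using sum_single [of p] \<phi>_sum [of ?K ?s] s by simp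
  also have "\<dots> = (\<Sum>k\<in>?K. if mdeg k = e then \<phi> (?s k) else 0)"
    unfolding part_sum using s by (intro sum.cong refl) (auto simp: part_forms [OF \<phi>_forms])
  also have "\<dots> = (\<Sum>k\<in>{k \<in> ?K. mdeg k = e}. \<phi> (?s k))"
    by (simp add: sum.inter_filter)
  also have "\<dots> = \<phi> (part e p)"
    unfolding part_def using s by (intro \<phi>_sum [symmetric]) auto
  finally show ?thesis .
qed

lemma \<phi>_lookup_0: "p \<in> polys m \<Longrightarrow> Poly_Mapping.lookup (\<phi> p) 0 = Poly_Mapping.lookup p 0"
  using \<phi>_part [of p 0] by (simp add: part_zero_eq \<phi>_const) (metis lookup_single_eq)

lemma \<phi>_forms_surj: "y \<in> forms n 1 \<Longrightarrow> \<exists>x\<in>forms m 1. \<phi> x = y"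
proof -
  assume y: "y \<in> forms n 1"
  then obtain p where p: "p \<in> polys m" "y = \<phi> p" using surj forms_polys by blast
  have "\<phi> (part 1 p) = y" using \<phi>_part [OF p(1), of 1] y p(2) by (simp add: part_forms)
  thus ?thesis using part_in_forms [OF p(1)] by blast
qed

abbreviation ker where "ker \<equiv> {p \<in> polys m. \<phi> p = 0}"

lemma ker_eq: "a_kernel (poly_ring m) (poly_ring n) \<phi> = ker"
  by (simp add: a_kernel_def kernel_def)

lemma ideal_preimage:
  assumes J: "ideal J (poly_ring n)"
  shows "ideal {p \<in> polys m. \<phi> p \<in> J} (poly_ring m)"
  using ideal_poly_ringD [OF J]
  by (intro ideal_poly_ringI) (auto simp: polys_closed \<phi>_0 \<phi>_add \<phi>_mult \<phi>_polys)

lemma ideal_ker: "ideal ker (poly_ring m)"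
proof -
  have "ideal {0} (poly_ring n)" by (rule ideal_poly_ringI) (auto simp: polys_0)
  from ideal_preimage [OF this] show ?thesis by simp
qed

text \<open>
  Linear forms \<open>l j\<close> over the variables of the target define a section \<open>\<sigma>\<close> of \<open>\<phi>\<close>. Modulo
  the linear forms in the kernel, every variable is congruent to a combination of the \<open>l j\<close>, hence every
  polynomial is congruent to a value \<open>\<sigma> q\<close>. If the polynomial lies in the kernel, then
  \<open>q = \<phi> (\<sigma> q) = 0\<close>.
\<close>

lemma ker_generated_by_linear_forms: "ker \<subseteq> Idl\<^bsub>poly_ring m\<^esub> (ker \<inter> forms m 1)"
proof -
  let ?L = "Idl\<^bsub>poly_ring m\<^esub> (ker \<inter> forms m 1)"
  have sub: "ker \<inter> forms m 1 \<subseteq> polys m" by blast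
  have L: "ideal ?L (poly_ring m)" by (rule genideal_ideal [OF sub])
  note D = ideal_poly_ringD [OF L]
  have Lker: "?L \<subseteq> ker" by (rule genideal_minimal [OF ideal_ker]) blast
  define l where "l j = (SOME x. x \<in> forms m 1 \<and> \<phi> x = var j)" for j
  have l: "l j \<in> forms m 1 \<and> \<phi> (l j) = var j" if j: "j < n" for j
  proof -
    have "\<exists>x. x \<in> forms m 1 \<and> \<phi> x = var j" using \<phi>_forms_surj [OF var_forms [OF j]] by blast
    from someI_ex [OF this] show ?thesis unfolding l_def .
  qed
  hence lp: "l j \<in> polys m" if "j < n" for j using that forms_polys by blast
  define mon where "mon k = (\<Prod>j<n. l j ^ Poly_Mapping.lookup k j)" for k :: "nat \<Rightarrow>\<^sub>0 nat"
  define \<sigma> where "\<sigma> q = (\<Sum>k\<in>Poly_Mapping.keys q. const (Poly_Mapping.lookup q k) * mon k)" for q :: "'k mpoly"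
  have pow: "p ^ e \<in> polys m" if "p \<in> polys m" for p :: "'k mpoly" and e
    using that by (induction e) (auto simp: polys_1 polys_mult)
  have prod: "(\<Prod>j\<in>A. g j) \<in> polys m" if "\<And>j. j \<in> A \<Longrightarrow> g j \<in> polys m" for A :: "nat set" and g :: "nat \<Rightarrow> 'k mpoly"
    using that by (induction A rule: infinite_finite_induct) (auto simp: polys_1 polys_mult)
  have monp: "mon k \<in> polys m" for k unfolding mon_def using lp by (intro prod pow) auto
  have \<sigma>p: "\<sigma> q \<in> polys m" for q unfolding \<sigma>_def by (intro polys_sum polys_mult polys_const monp)
  have \<sigma>_add: "\<sigma> (p + q) = \<sigma> p + \<sigma> q" for p q
    unfolding \<sigma>_def by (rule setsum_keys_plus_distrib) (auto simp: const_add distrib_right)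
  have \<sigma>_single: "\<sigma> (Poly_Mapping.single k c) = const c * mon k" for k c
    by (cases "c = 0") (auto simp: \<sigma>_def)
  have mon_vmon: "mon (vmon j + k) = l j * mon k" if "j < n" for j k
  proof -
    have "(\<Prod>i<n. l i ^ Poly_Mapping.lookup (vmon j) i) = (\<Prod>i<n. if i = j then l j else 1)"
      by (intro prod.cong refl) (auto simp: lookup_single when_def)
    thus ?thesis using that by (simp add: mon_def lookup_add power_add prod.distrib)
  qed
  have \<sigma>_var: "\<sigma> (Poly_Mapping.single (vmon j) b * q) = const b * l j * \<sigma> q" if "j < n" for j b q
  proof (induction q rule: mpoly_induct)
    case (1 k c)
    show ?case unfolding mult_single \<sigma>_single mon_vmon [OF that] by (simp only: const_mult mult_ac)
  next
    case 2 show ?case by (simp add: \<sigma>_def)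
  qed (simp add: distrib_left \<sigma>_add)
  have \<sigma>_sum: "\<sigma> (\<Sum>j\<in>A. g j) = (\<Sum>j\<in>A. \<sigma> (g j))" for A :: "nat set" and g
    by (induction A rule: infinite_finite_induct) (auto simp: \<sigma>_add, simp_all add: \<sigma>_def)
  let ?G = "{p \<in> polys m. \<exists>q\<in>polys n. p - \<sigma> q \<in> ?L}"
  have G_add: "p + p' \<in> ?G" if pp: "p \<in> ?G" "p' \<in> ?G" for p p'
  proof -
    obtain q q' where q: "p \<in> polys m" "p' \<in> polys m" "q \<in> polys n" "q' \<in> polys n" "p - \<sigma> q \<in> ?L" "p' - \<sigma> q' \<in> ?L"
      using pp by blast
    have "p + p' - \<sigma> (q + q') \<in> ?L" using D(3) [OF q(5, 6)] by (simp add: \<sigma>_add algebra_simps)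
    thus ?thesis using q polys_add by blast
  qed
  have G_const: "const c \<in> ?G" for c
  proof -
    have "const c - \<sigma> (const c) = 0" by (simp add: \<sigma>_single mon_def)
    hence "const c - \<sigma> (const c) \<in> ?L" using D(2) by simp
    thus ?thesis using polys_const by blast
  qed
  have G_var: "var i * p \<in> ?G" if i: "i < m" and p: "p \<in> ?G" for i p
  proof -
    obtain q where q: "p \<in> polys m" "q \<in> polys n" "p - \<sigma> q \<in> ?L" using p by blast
    have vi: "(var i :: 'k mpoly) \<in> forms m 1" "(var i :: 'k mpoly) \<in> polys m"
      using var_forms [OF i] forms_polys [OF var_forms [OF i]] by auto
    define b where "b j = Poly_Mapping.lookup (\<phi> (var i)) (vmon j)" for j
    let ?s = "\<Sum>j<n. const (b j) * l j"
    have s: "?s \<in> forms m 1" using l by (intro forms_sum forms_const_mult) auto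
    have "\<phi> ?s = (\<Sum>j<n. const (b j) * var j)"
      using l lp by (subst \<phi>_sum) (auto simp: \<phi>_mult \<phi>_const polys_const polys_mult intro!: sum.cong)
    also have "\<dots> = \<phi> (var i)" unfolding b_def by (rule linear_form_eq [symmetric, OF \<phi>_forms [OF vi(1)]])
    finally have "\<phi> (var i - ?s) = 0" using \<phi>_diff [OF vi(2) forms_polys [OF s]] by simp
    moreover have vs: "var i - ?s \<in> polys m" by (rule polys_diff [OF vi(2) forms_polys [OF s]])
    moreover have "var i - ?s \<in> forms m 1"
    proof -
      have "part 1 (var i - ?s) = var i - ?s" unfolding part_diff part_forms [OF vi(1)] part_forms [OF s] by simp
      thus ?thesis using part_in_forms [OF vs, of 1] by (simp only:)
    qed
    ultimately have "var i - ?s \<in> ?L" using genideal_self [OF sub] by blast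
    hence "var i * (p - \<sigma> q) + (var i - ?s) * \<sigma> q \<in> ?L"
      by (rule D(3) [OF D(4) [OF vi(2) q(3)] D(5) [OF _ \<sigma>p]])
    moreover have "var i * (p - \<sigma> q) + (var i - t) * \<sigma> q = var i * p - t * \<sigma> q" for t
      by (simp add: left_diff_distrib right_diff_distrib)
    moreover have "\<sigma> (\<Sum>j<n. Poly_Mapping.single (vmon j) (b j) * q) = ?s * \<sigma> q"
      unfolding \<sigma>_sum sum_distrib_right by (intro sum.cong refl) (simp only: \<sigma>_var lessThan_iff)
    ultimately have "var i * p - \<sigma> (\<Sum>j<n. Poly_Mapping.single (vmon j) (b j) * q) \<in> ?L"
      by (simp only:)
    moreover have "(\<Sum>j<n. Poly_Mapping.single (vmon j) (b j) * q) \<in> polys n"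
      using q(2) by (intro polys_sum polys_mult polys_single) auto
    ultimately show ?thesis using polys_mult [OF vi(2) q(1)] by blast
  qed
  have G_single: "Poly_Mapping.single k c \<in> ?G" if "Poly_Mapping.keys k \<subseteq> {..<m}" for k c
    using that
  proof (induction "mdeg k" arbitrary: k)
    case 0
    hence "k = 0" using mdeg_0_iff [of k] by simp
    thus ?case using G_const by simp
  next
    case (Suc e)
    have "k \<noteq> 0" using Suc.hyps(2) mdeg_0_iff [of k] by auto
    then obtain i where i: "i \<in> Poly_Mapping.keys k" by (metis keys_eq_empty equals0I)
    have eq: "vmon i + (k - vmon i) = k"
      using i by (intro poly_mapping_eqI) (auto simp: lookup_add lookup_minus lookup_single when_def in_keys_iff)
    have "mdeg k = mdeg (vmon i) + mdeg (k - vmon i)"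
      using mdeg_add [of "vmon i" "k - vmon i"] unfolding eq .
    hence "mdeg (k - vmon i) = e" using Suc.hyps(2) mdeg_vmon [of i] by linarith
    moreover have "Poly_Mapping.keys k = Poly_Mapping.keys (vmon i) \<union> Poly_Mapping.keys (k - vmon i)"
      using keys_add_nat [of "vmon i" "k - vmon i"] unfolding eq .
    hence "Poly_Mapping.keys (k - vmon i) \<subseteq> {..<m}" using Suc.prems by blast
    ultimately have "Poly_Mapping.single (k - vmon i) c \<in> ?G" by (rule Suc.hyps(1) [OF sym])
    moreover have "i < m" using i Suc.prems by blast
    ultimately have "var i * Poly_Mapping.single (k - vmon i) c \<in> ?G" by (rule G_var [rotated])
    thus ?case by (simp only: mult_single eq mult_1)
  qed
  have G_all: "p \<in> ?G" if p: "p \<in> polys m" for p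
  proof -
    have "(\<Sum>k\<in>A. Poly_Mapping.single k (Poly_Mapping.lookup p k)) \<in> ?G" if "A \<subseteq> Poly_Mapping.keys p" "finite A" for A
      using that(2, 1)
    proof (induction A rule: finite_induct)
      case empty show ?case unfolding sum.empty using G_const [of 0] by (simp only: single_zero)
    next
      case (insert k A)
      have "Poly_Mapping.single k (Poly_Mapping.lookup p k) \<in> ?G"
        using insert.prems p by (intro G_single) (auto simp: polys_iff)
      moreover have "(\<Sum>k\<in>A. Poly_Mapping.single k (Poly_Mapping.lookup p k)) \<in> ?G"
        using insert.prems by (intro insert.IH) blast
      ultimately show ?case unfolding sum.insert [OF insert.hyps(1, 2)] by (rule G_add)
    qed
    from this [OF order_refl finite_keys] show ?thesis unfolding sum_single [of p, symmetric] .
  qed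
  have \<phi>_mon: "\<phi> (mon k) = Poly_Mapping.single k 1" if "Poly_Mapping.keys k \<subseteq> {..<n}" for k
  proof -
    have \<phi>pow: "\<phi> (p ^ e) = \<phi> p ^ e" if "p \<in> polys m" for p e
      using that \<phi>_const [of 1] by (induction e) (auto simp: \<phi>_mult pow)
    have varpow: "var j ^ e = Poly_Mapping.single (Poly_Mapping.single j e) (1 :: 'k)" for j e
      by (induction e) (auto simp: mult_single single_add [symmetric])
    have "\<phi> (\<Prod>j\<in>A. l j ^ Poly_Mapping.lookup k j) =
        Poly_Mapping.single (\<Sum>j\<in>A. Poly_Mapping.single j (Poly_Mapping.lookup k j)) 1"
      if "finite A" "A \<subseteq> {..<n}" for A
      using that
    proof (induction A rule: finite_induct)
      case empty thus ?case using \<phi>_const [of 1] by simp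
    next
      case (insert j A)
      have jn: "j < n" using insert.prems by blast
      have p: "(\<Prod>j\<in>A. l j ^ Poly_Mapping.lookup k j) \<in> polys m" "l j ^ Poly_Mapping.lookup k j \<in> polys m"
        using insert.prems lp by (auto intro!: prod pow)
      have "\<phi> (l j ^ Poly_Mapping.lookup k j) = var j ^ Poly_Mapping.lookup k j"
        unfolding \<phi>pow [OF lp [OF jn]] using l [OF jn] by (simp only:)
      moreover have "\<phi> (\<Prod>j\<in>A. l j ^ Poly_Mapping.lookup k j) =
          Poly_Mapping.single (\<Sum>j\<in>A. Poly_Mapping.single j (Poly_Mapping.lookup k j)) 1"
        using insert.prems by (intro insert.IH) blast
      ultimately show ?case
        by (simp only: prod.insert [OF insert.hyps(1, 2)] sum.insert [OF insert.hyps(1, 2)]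
          \<phi>_mult [OF p(2, 1)] varpow mult_single mult_1)
    qed
    from this [of "{..<n}"] have "\<phi> (mon k) = Poly_Mapping.single (\<Sum>j<n. Poly_Mapping.single j (Poly_Mapping.lookup k j)) 1"
      by (simp add: mon_def)
    moreover have "(\<Sum>j<n. Poly_Mapping.single j (Poly_Mapping.lookup k j)) = k"
    proof (rule poly_mapping_eqI)
      fix i
      have "Poly_Mapping.lookup (\<Sum>j<n. Poly_Mapping.single j (Poly_Mapping.lookup k j)) i =
          (\<Sum>j<n. if j = i then Poly_Mapping.lookup k i else 0)"
        unfolding lookup_sum by (intro sum.cong) (auto simp: lookup_single when_def)
      thus "Poly_Mapping.lookup (\<Sum>j<n. Poly_Mapping.single j (Poly_Mapping.lookup k j)) i = Poly_Mapping.lookup k i"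
        using that by (auto simp: in_keys_iff subset_iff)
    qed
    ultimately show ?thesis by simp
  qed
  have \<phi>\<sigma>: "\<phi> (\<sigma> q) = q" if q: "q \<in> polys n" for q
  proof -
    have "\<phi> (\<sigma> q) = (\<Sum>k\<in>Poly_Mapping.keys q. \<phi> (const (Poly_Mapping.lookup q k) * mon k))"
      unfolding \<sigma>_def by (intro \<phi>_sum polys_mult polys_const monp)
    also have "\<dots> = (\<Sum>k\<in>Poly_Mapping.keys q. Poly_Mapping.single k (Poly_Mapping.lookup q k))"
    proof (intro sum.cong refl)
      fix k assume "k \<in> Poly_Mapping.keys q"
      hence kn: "Poly_Mapping.keys k \<subseteq> {..<n}" using q by (auto simp: polys_iff)
      show "\<phi> (const (Poly_Mapping.lookup q k) * mon k) = Poly_Mapping.single k (Poly_Mapping.lookup q k)"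
        unfolding \<phi>_mult [OF polys_const monp] \<phi>_const \<phi>_mon [OF kn] mult_single by simp
    qed
    finally show ?thesis unfolding sum_single [of q, symmetric] .
  qed
  show ?thesis
  proof
    fix p assume p: "p \<in> ker"
    then obtain q where q: "q \<in> polys n" "p - \<sigma> q \<in> ?L" using G_all [of p] by blast
    have "\<phi> p - \<phi> (\<sigma> q) = 0" using q(2) Lker p \<phi>_diff [of p "\<sigma> q"] \<sigma>p by auto
    hence "q = 0" using p \<phi>\<sigma> [OF q(1)] by simp
    thus "p \<in> ?L" using q(2) by (simp add: \<sigma>_def)
  qed
qed

text \<open>
  The linear elements of a generating set already generate the linear forms of the kernel
  (\<open>part1_genideal\<close>) and hence the kernel, so a minimal set contains no others.
\<close>

lemma min_gens_ker_linear:
  assumes "min_hom_gens (poly_ring m) (homogeneous_elements m) ker fs"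
  shows "set fs \<subseteq> forms m 1"
proof -
  have fs: "set fs \<subseteq> homogeneous_elements m" "Idl\<^bsub>poly_ring m\<^esub> (set fs) = ker"
    and min: "\<And>F. F \<subset> set fs \<Longrightarrow> Idl\<^bsub>poly_ring m\<^esub> F \<noteq> ker"
    using assms by (auto simp: min_hom_gens_def)
  have fp: "set fs \<subseteq> polys m" using fs(1) by (auto simp: homogeneous_elements_def forms_def)
  have fker: "set fs \<subseteq> ker" using genideal_self [OF fp] fs(2) by simp
  have fM: "set fs \<subseteq> graded_max_ideal m"
  proof
    fix f assume "f \<in> set fs"
    hence "f \<in> polys m" "\<phi> f = 0" using fker by auto
    thus "f \<in> graded_max_ideal m" using \<phi>_lookup_0 [of f] by (simp add: graded_max_ideal_def)
  qed
  have z: "graded_proper m {0}"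
    unfolding graded_proper_def by (auto simp: graded_max_ideal_def polys_0 intro!: ideal_poly_ringI)
  let ?L = "set fs \<inter> forms m 1"
  have Lp: "?L \<subseteq> polys m" using fp by blast
  let ?K = "Idl\<^bsub>poly_ring m\<^esub> ?L"
  have K: "ideal ?K (poly_ring m)" by (rule genideal_ideal [OF Lp])
  have "{0} \<union> ?L \<subseteq> ?K" using genideal_self [OF Lp] ideal_poly_ringD(2) [OF K] by blast
  note span = span_in_ideal [OF K this]
  have "ker \<inter> forms m 1 \<subseteq> ?K"
  proof
    fix p :: "'k mpoly" assume p: "p \<in> ker \<inter> forms m 1"
    have "{0} \<union> set fs \<subseteq> polys m" using fp polys_0 by blast
    note g = genideal_ideal [OF this] genideal_self [OF this]
    have "Idl\<^bsub>poly_ring m\<^esub> (set fs) \<subseteq> Idl\<^bsub>poly_ring m\<^esub> ({0} \<union> set fs)"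
      using g(2) by (intro genideal_minimal g(1)) auto
    hence "p \<in> Idl\<^bsub>poly_ring m\<^esub> ({0} \<union> set fs)" using p fs(2) by blast
    from part1_genideal [OF z fs(1) fM this] have "part 1 p \<in> ?K" using span by blast
    thus "p \<in> ?K" using p by (auto simp: part_forms)
  qed
  hence "Idl\<^bsub>poly_ring m\<^esub> (ker \<inter> forms m 1) \<subseteq> ?K" by (rule genideal_minimal [OF K])
  hence "ker \<subseteq> ?K" using ker_generated_by_linear_forms by blast
  moreover have "?K \<subseteq> ker" using fker by (intro genideal_minimal ideal_ker) blast
  ultimately have "?K = ker" by blast
  hence "\<not> ?L \<subset> set fs" using min by blast
  thus ?thesis by blast
qed

lemma graded_proper_image:
  assumes K: "graded_proper m K"
  shows "graded_proper n (\<phi> ` K)"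
proof -
  have Ki: "ideal K (poly_ring m)" "K \<subseteq> graded_max_ideal m" "\<And>p. p \<in> K \<Longrightarrow> part 1 p \<in> K"
    using K by (auto simp: graded_proper_def)
  note D = ideal_poly_ringD [OF Ki(1)]
  have Kp: "p \<in> polys m" if "p \<in> K" for p using D(1) that by blast
  have "ideal (\<phi> ` K) (poly_ring n)"
  proof (rule ideal_poly_ringI)
    show "\<phi> ` K \<subseteq> polys n" using Kp \<phi>_polys by blast
    show "0 \<in> \<phi> ` K" using D(2) \<phi>_0 by force
    show "a + b \<in> \<phi> ` K" if ab: "a \<in> \<phi> ` K" "b \<in> \<phi> ` K" for a b
    proof -
      obtain p q where "p \<in> K" "a = \<phi> p" "q \<in> K" "b = \<phi> q" using ab by blast
      thus ?thesis using D(3) Kp by (intro image_eqI [of _ _ "p + q"]) (auto simp: \<phi>_add)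
    qed
    show "r * a \<in> \<phi> ` K" if ra: "r \<in> polys n" "a \<in> \<phi> ` K" for r a
    proof -
      obtain p s where "p \<in> K" "a = \<phi> p" "s \<in> polys m" "r = \<phi> s" using ra surj by blast
      thus ?thesis using D(4) Kp by (intro image_eqI [of _ _ "s * p"]) (auto simp: \<phi>_mult)
    qed
  qed
  moreover have "\<phi> ` K \<subseteq> graded_max_ideal n"
    using Ki(2) by (auto simp: graded_max_ideal_def \<phi>_polys \<phi>_lookup_0)
  moreover have "part 1 (\<phi> p) \<in> \<phi> ` K" if "p \<in> K" for p
    using \<phi>_part [OF Kp [OF that]] Ki(3) [OF that] by simp
  ultimately show ?thesis by (auto simp: graded_proper_def)
qed

text \<open>
  Nothing is lost in the image of an ideal that contains the kernel.
\<close>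

lemma mem_image_iff:
  assumes K: "ideal K (poly_ring m)" "ker \<subseteq> K" and p: "p \<in> polys m"
  shows "\<phi> p \<in> \<phi> ` K \<longleftrightarrow> p \<in> K"
proof
  assume "\<phi> p \<in> \<phi> ` K"
  then obtain b where b: "b \<in> K" "\<phi> p = \<phi> b" by blast
  have "b \<in> polys m" using b ideal_poly_ringD(1) [OF K(1)] by blast
  hence "p - b \<in> ker" using b p by (simp add: \<phi>_diff polys_diff)
  hence "p - b \<in> K" using K(2) by blast
  from ideal_poly_ringD(3) [OF K(1) this b(1)] show "p \<in> K" by simp
qed auto

lemma lin_basis_image:
  assumes K: "graded_proper m K" "ker \<subseteq> K" and xs: "set xs \<subseteq> forms m 1"
  shows "lin_basis m K xs \<longleftrightarrow> lin_basis n (\<phi> ` K) (map \<phi> xs)"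
proof -
  have Ki: "ideal K (poly_ring m)" using K by (simp add: graded_proper_def)
  have Ji: "ideal (\<phi> ` K) (poly_ring n)" using graded_proper_image [OF K(1)] by (simp add: graded_proper_def)
  have xp: "xs ! i \<in> polys m" if "i < length xs" for i
    using forms_polys [of "xs ! i" m 1] xs nth_mem [OF that] by blast
  have sum: "(\<Sum>i<length xs. const (c i) * xs ! i) \<in> polys m" for c
    using xp by (intro polys_sum polys_mult polys_const) auto
  have \<phi>s: "(\<Sum>i<length (map \<phi> xs). const (c i) * map \<phi> xs ! i) = \<phi> (\<Sum>i<length xs. const (c i) * xs ! i)" for c
    using xp by (subst \<phi>_sum) (auto simp: \<phi>_mult polys_const \<phi>_const polys_mult intro!: sum.cong)
  have 1: "(\<Sum>i<length (map \<phi> xs). const (c i) * map \<phi> xs ! i) \<in> \<phi> ` K \<longleftrightarrow> (\<Sum>i<length xs. const (c i) * xs ! i) \<in> K" for c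
    unfolding \<phi>s by (rule mem_image_iff [OF Ki K(2) sum])
  have 2: "\<phi> l - (\<Sum>i<length (map \<phi> xs). const (c i) * map \<phi> xs ! i) \<in> \<phi> ` K \<longleftrightarrow> l - (\<Sum>i<length xs. const (c i) * xs ! i) \<in> K"
    if "l \<in> polys m" for l c
    using mem_image_iff [OF Ki K(2) polys_diff [OF that sum]] unfolding \<phi>s \<phi>_diff [OF that sum] .
  have im: "forms n 1 = \<phi> ` forms m 1" using \<phi>_forms_surj \<phi>_forms by blast
  have "(\<forall>l\<in>forms m 1. \<exists>c. l - (\<Sum>i<length xs. const (c i) * xs ! i) \<in> K) \<longleftrightarrow>
      (\<forall>l\<in>forms m 1. \<exists>c. \<phi> l - (\<Sum>i<length (map \<phi> xs). const (c i) * map \<phi> xs ! i) \<in> \<phi> ` K)"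
    by (rule ball_cong [OF refl], rule iff_exI, rule 2 [symmetric, OF forms_polys])
  also have "\<dots> \<longleftrightarrow> (\<forall>l\<in>forms n 1. \<exists>c. l - (\<Sum>i<length (map \<phi> xs). const (c i) * map \<phi> xs ! i) \<in> \<phi> ` K)"
    by (simp only: im ball_simps)
  finally have 3: "(\<forall>l\<in>forms m 1. \<exists>c. l - (\<Sum>i<length xs. const (c i) * xs ! i) \<in> K) \<longleftrightarrow>
    (\<forall>l\<in>forms n 1. \<exists>c. l - (\<Sum>i<length (map \<phi> xs). const (c i) * map \<phi> xs ! i) \<in> \<phi> ` K)" .
  have "set (map \<phi> xs) \<subseteq> forms n 1" using xs \<phi>_forms by auto
  thus ?thesis
    unfolding lin_basis_iff [OF Ki] lin_basis_iff [OF Ji] 1 3 using xs by simp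
qed

text \<open>
  Since \<open>K\<close> contains the kernel, \<open>\<phi>\<close> induces an isomorphism of the quotient rings and thus of
  the Koszul complexes over them.
\<close>

lemma koszul_image:
  assumes K: "graded_proper m K" "ker \<subseteq> K" and xs: "set xs \<subseteq> graded_max_ideal m"
  shows "koszul_massey_trivial m K xs \<longleftrightarrow> koszul_massey_trivial n (\<phi> ` K) (map \<phi> xs)"
proof -
  let ?r = "length xs" let ?J = "\<phi> ` K"
  have Ki: "ideal K (poly_ring m)" using K by (simp add: graded_proper_def)
  have J: "graded_proper n ?J" by (rule graded_proper_image [OF K(1)])
  have Ji: "ideal ?J (poly_ring n)" using J by (simp add: graded_proper_def)
  have xp: "xs ! i \<in> polys m" if "i < ?r" for i using nth_graded_max [OF xs that] by simp
  define \<pi> where "\<pi> a S = \<phi> (a S)" for a :: "nat set \<Rightarrow> 'k mpoly" and S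
  have contr: "contract i (\<pi> a) U = \<phi> (contract i a U)" if "a \<in> kcarrier m ?r" for i a U
    using that by (auto simp: contract_def \<pi>_def \<phi>_0 \<phi>_sign kcarrierD)
  have \<pi>C: "\<pi> a \<in> kcarrier n ?r" if "a \<in> kcarrier m ?r" for a
    using that by (auto simp: \<pi>_def kcarrier_def \<phi>_polys \<phi>_0)
  have \<pi>N: "\<pi> a \<in> kideal n ?J ?r \<longleftrightarrow> a \<in> kideal m K ?r" if "a \<in> kcarrier m ?r" for a
    using that \<pi>C [OF that] mem_image_iff [OF Ki K(2)] by (auto simp: kideal_def \<pi>_def kcarrierD)
  have len: "length (map \<phi> xs) = ?r" by simp
  show ?thesis
  proof (rule koszul_massey_trivial_transfer [where \<pi> = \<pi> and xs = xs and ys = "map \<phi> xs", OF K(1) xs J, unfolded len])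
    show "set (map \<phi> xs) \<subseteq> graded_max_ideal n"
      using xs by (auto simp: graded_max_ideal_def \<phi>_polys \<phi>_lookup_0)
  next
    fix a b :: "nat set \<Rightarrow> 'k mpoly" assume ab: "a \<in> kcarrier m ?r" "b \<in> kcarrier m ?r"
    show "\<pi> (a + b) = \<pi> a + \<pi> b" using ab by (auto simp: \<pi>_def fun_eq_iff \<phi>_add kcarrierD)
    show "\<pi> (kmul a b) = kmul (\<pi> a) (\<pi> b)"
      using ab by (auto simp: \<pi>_def fun_eq_iff kmul_def \<phi>_sum \<phi>_sign \<phi>_mult kcarrierD polys_sign polys_mult)
  next
    fix a :: "nat set \<Rightarrow> 'k mpoly" assume "a \<in> kideal m K ?r"
    thus "\<pi> a \<in> kideal n ?J ?r" using \<pi>N kidealD(1) by blast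
  next
    fix b :: "nat set \<Rightarrow> 'k mpoly" assume b: "b \<in> kcarrier n ?r"
    have "\<exists>p. p \<in> polys m \<and> \<phi> p = b S \<and> (b S = 0 \<longrightarrow> p = 0)" for S
    proof (cases "b S = 0")
      case True thus ?thesis by (intro exI [of _ 0]) (simp add: \<phi>_0 polys_0)
    next
      case False
      have "b S \<in> \<phi> ` polys m" using kcarrierD(1) [OF b, of S] surj by simp
      then obtain p where "b S = \<phi> p" "p \<in> polys m" by (elim imageE)
      thus ?thesis using False by (intro exI [of _ p]) simp
    qed
    then obtain a where a: "\<And>S. a S \<in> polys m \<and> \<phi> (a S) = b S \<and> (b S = 0 \<longrightarrow> a S = 0)" by metis
    have "a \<in> kcarrier m ?r"
    proof (rule kcarrierI)
      show "a S \<in> polys m" for S using a by blast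
      show "a S = 0" if "\<not> S \<subseteq> {..<?r}" for S using a kcarrierD(2) [OF b that] by blast
    qed
    thus "\<exists>a\<in>kcarrier m ?r. \<pi> a = b" using a by (auto simp: \<pi>_def fun_eq_iff)
  next
    fix a :: "nat set \<Rightarrow> 'k mpoly" assume a: "a \<in> kcarrier m ?r"
    show "\<pi> a \<in> kcarrier n ?r" by (rule \<pi>C [OF a])
    show "\<pi> (ksg a) = ksg (\<pi> a)" using a by (auto simp: \<pi>_def ksg_def fun_eq_iff \<phi>_sign kcarrierD)
    show "kaug (\<pi> a) = kaug a" using a by (simp add: kaug_def \<pi>_def \<phi>_lookup_0 kcarrierD)
    have "\<pi> (kd ?r ((!) xs) a) U = kd ?r ((!) (map \<phi> xs)) (\<pi> a) U" for U
    proof -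
      have "\<pi> (kd ?r ((!) xs) a) U = (\<Sum>i<?r. \<phi> (xs ! i * contract i a U))"
        unfolding \<pi>_def kd_def
        using xp kcarrierD(1) [OF contract_kcarrier [OF a]] by (intro \<phi>_sum polys_mult) auto
      also have "\<dots> = kd ?r ((!) (map \<phi> xs)) (\<pi> a) U"
        unfolding kd_def using xp kcarrierD(1) [OF contract_kcarrier [OF a]]
        by (intro sum.cong refl) (auto simp: \<phi>_mult contr [OF a])
      finally show ?thesis .
    qed
    hence "\<pi> (kd ?r ((!) xs) a) - kd ?r ((!) (map \<phi> xs)) (\<pi> a) = 0" by (simp add: fun_eq_iff)
    thus "\<pi> (kd ?r ((!) xs) a) - kd ?r ((!) (map \<phi> xs)) (\<pi> a) \<in> kideal n ?J ?r"
      using kcarrier_0 ideal_poly_ringD(2) [OF Ji] by (simp add: kideal_def)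
  next
    fix a :: "nat set \<Rightarrow> 'k mpoly" assume a: "a \<in> kcarrier m ?r" and \<pi>a: "\<pi> a \<in> kideal n ?J ?r"
    have "a - kd ?r ((!) xs) 0 \<in> kideal m K ?r" using \<pi>N [OF a] \<pi>a by simp
    moreover have "\<pi> 0 \<in> kideal n ?J ?r"
      using \<pi>N [OF kcarrier_0] kcarrier_0 ideal_poly_ringD(2) [OF Ki] by (simp add: kideal_def)
    ultimately show "\<exists>y\<in>kcarrier m ?r. \<pi> y \<in> kideal n ?J ?r \<and> a - kd ?r ((!) xs) y \<in> kideal m K ?r"
      using kcarrier_0 by blast
  qed
qed

lemma golod_image:
  assumes K: "graded_proper m K" "ker \<subseteq> K"
  shows "golod m K \<longleftrightarrow> golod n (\<phi> ` K)"
proof -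
  have J: "graded_proper n (\<phi> ` K)" by (rule graded_proper_image [OF K(1)])
  have *: "lin_basis m K xs \<and> koszul_massey_trivial m K xs \<longleftrightarrow>
      lin_basis n (\<phi> ` K) (map \<phi> xs) \<and> koszul_massey_trivial n (\<phi> ` K) (map \<phi> xs)"
    if "set xs \<subseteq> forms m 1" for xs
  proof -
    have "set xs \<subseteq> graded_max_ideal m" using that forms_graded_max by blast
    thus ?thesis using lin_basis_image [OF K that] koszul_image [OF K] by simp
  qed
  show ?thesis
    unfolding golod_iff [OF K(1)] golod_iff [OF J]
  proof
    assume "\<exists>xs. lin_basis m K xs \<and> koszul_massey_trivial m K xs"
    then obtain xs where xs: "lin_basis m K xs" "koszul_massey_trivial m K xs" by blast
    have "set xs \<subseteq> forms m 1" using xs(1) unfolding lin_basis_def by blast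
    thus "\<exists>ys. lin_basis n (\<phi> ` K) ys \<and> koszul_massey_trivial n (\<phi> ` K) ys"
      using * [of xs] xs by (intro exI [of _ "map \<phi> xs"]) simp
  next
    assume "\<exists>ys. lin_basis n (\<phi> ` K) ys \<and> koszul_massey_trivial n (\<phi> ` K) ys"
    then obtain ys where ys: "lin_basis n (\<phi> ` K) ys" "koszul_massey_trivial n (\<phi> ` K) ys" by blast
    have "\<forall>y\<in>set ys. \<exists>x. x \<in> forms m 1 \<and> \<phi> x = y"
    proof
      fix y assume "y \<in> set ys"
      hence "y \<in> forms n 1" using ys(1) unfolding lin_basis_def by blast
      thus "\<exists>x. x \<in> forms m 1 \<and> \<phi> x = y" using \<phi>_forms_surj by blast
    qed
    from bchoice [OF this] obtain g where g: "\<forall>y\<in>set ys. g y \<in> forms m 1 \<and> \<phi> (g y) = y" by (elim exE)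
    have "map \<phi> (map g ys) = ys" using g by (auto intro!: nth_equalityI)
    moreover have "set (map g ys) \<subseteq> forms m 1" using g by auto
    ultimately show "\<exists>xs. lin_basis m K xs \<and> koszul_massey_trivial m K xs" using * [of "map g ys"] ys by (intro exI [of _ "map g ys"]) simp
  qed
qed

end

lemma genideal_genideal_Un:
  assumes "A \<subseteq> polys m" "B \<subseteq> polys m"
  shows "Idl\<^bsub>poly_ring m\<^esub> (Idl\<^bsub>poly_ring m\<^esub> A \<union> B) = Idl\<^bsub>poly_ring m\<^esub> (A \<union> B)"
proof -
  have AB: "A \<union> B \<subseteq> polys m" using assms by blast
  have IA: "ideal (Idl\<^bsub>poly_ring m\<^esub> A) (poly_ring m)" by (rule genideal_ideal [OF assms(1)])
  have IB: "Idl\<^bsub>poly_ring m\<^esub> A \<union> B \<subseteq> polys m" using ideal_poly_ringD(1) [OF IA] assms by blast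
  note g = genideal_self [OF AB] genideal_self [OF IB] genideal_self [OF assms(1)]
  have "Idl\<^bsub>poly_ring m\<^esub> A \<subseteq> Idl\<^bsub>poly_ring m\<^esub> (A \<union> B)" using g by (intro genideal_minimal genideal_ideal AB) blast
  thus ?thesis
    using g by (intro equalityI genideal_minimal genideal_ideal AB IB) blast+
qed

text \<open>
  The ideals \<open>J i\<close> adjoin the first \<open>i\<close> generators of the kernel to \<open>I\<close>. Each step is a reduction modulo a
  regular linear form, and the last ideal contains the kernel and has the same image as \<open>I\<close>. All
  of them are proper, because a regular sequence does not generate the unit ideal.
\<close>

theorem theorem3p5:
  fixes m n :: nat
    and \<phi> :: "'k::field mpoly \<Rightarrow> 'k mpoly"
    and I :: "'k mpoly set"
  assumes "graded_alg_hom m n \<phi>"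
    and "\<phi> ` carrier (poly_ring m) = carrier (poly_ring n)"
    and "complete_intersection (poly_ring m :: 'k mpoly ring) (a_kernel (poly_ring m) (poly_ring n) \<phi>)"
    and "homogeneous_ideal m I"
    and "I \<noteq> carrier (poly_ring m)"
    and "regular_ideal_on_quotient m (a_kernel (poly_ring m) (poly_ring n) \<phi>) I"
  shows "golod m I \<longleftrightarrow> golod n (\<phi> ` I)"
proof -
  interpret graded_surjection m n \<phi> using assms(1, 2) by unfold_locales
  let ?q = "\<lambda>p. I +>\<^bsub>poly_ring m\<^esub> p" let ?Q = "poly_ring m Quot I"
  have I: "graded_proper m I" by (rule graded_properI [OF assms(4, 5)])
  hence Ii: "ideal I (poly_ring m)" by (simp add: graded_proper_def)
  have Ip: "I \<subseteq> polys m" by (rule ideal_poly_ringD(1) [OF Ii])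
  obtain fs where gens: "min_hom_gens (poly_ring m) (homogeneous_elements m) ker fs"
    and reg: "regular_sequence ?Q (map ?q fs)"
    using assms(6) unfolding regular_ideal_on_quotient_def ker_eq by blast
  have ff: "set fs \<subseteq> forms m 1" by (rule min_gens_ker_linear [OF gens])
  have fp: "set fs \<subseteq> polys m" using ff forms_polys by blast
  define J where "J i = Idl\<^bsub>poly_ring m\<^esub> (I \<union> set (take i fs))" for i
  have tp: "set (take i fs) \<subseteq> polys m" for i using fp set_take_subset [of i fs] by (rule order_trans [rotated])
  have Up: "I \<union> set (take i fs) \<subseteq> polys m" for i using Ip tp by blast
  have Jid: "ideal (J i) (poly_ring m)" for i unfolding J_def by (rule genideal_ideal [OF Up])
  have J_mono: "J i \<subseteq> J (length fs)" for i
    using genideal_self [OF Up [of "length fs"]] set_take_subset [of i fs] unfolding J_def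
    by (intro genideal_minimal genideal_ideal Up) auto
  have J_proper: "J (length fs) \<noteq> polys m"
  proof
    assume eq: "J (length fs) = polys m"
    have "?q p \<in> Idl\<^bsub>?Q\<^esub> (?q ` set fs)" if "p \<in> polys m" for p
      using quot_genideal [OF Ii fp that] that eq by (simp add: J_def)
    hence "carrier ?Q \<subseteq> Idl\<^bsub>?Q\<^esub> (?q ` set fs)" by (auto simp: quot_carrier [OF Ii])
    moreover have "Idl\<^bsub>?Q\<^esub> (?q ` set fs) \<subseteq> carrier ?Q"
    proof -
      interpret h: ring_hom_ring "poly_ring m" ?Q ?q by (rule quot_hom [OF Ii])
      have "?q ` set fs \<subseteq> carrier ?Q" using fp by (auto simp: quot_carrier [OF Ii])
      from ideal.axioms(1) [OF h.S.genideal_ideal [OF this]] show ?thesis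
        by (rule additive_subgroup.a_subset)
    qed
    ultimately show False using reg by (auto simp: regular_sequence_def)
  qed
  have J_graded: "graded_proper m (J i)" for i
  proof (rule graded_properI)
    obtain F where F: "F \<subseteq> homogeneous_elements m" "I = Idl\<^bsub>poly_ring m\<^esub> F"
      using assms(4) by (auto simp: homogeneous_ideal_def)
    have Fp: "F \<subseteq> polys m" using F(1) by (auto simp: homogeneous_elements_def forms_def)
    have "J i = Idl\<^bsub>poly_ring m\<^esub> (F \<union> set (take i fs))"
      unfolding J_def F(2) by (rule genideal_genideal_Un [OF Fp tp])
    moreover have "set (take i fs) \<subseteq> homogeneous_elements m"
      using ff set_take_subset [of i fs] by (auto simp: homogeneous_elements_def)
    ultimately show "homogeneous_ideal m (J i)"
      using F(1) unfolding homogeneous_ideal_def by blast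
    show "J i \<noteq> polys m" using J_mono [of i] J_proper ideal_poly_ringD(1) [OF Jid] by blast
  qed
  have step: "golod m (J i) \<longleftrightarrow> golod m (J (Suc i))" if i: "i < length fs" for i
  proof (rule golod_mod_regular_linear_form [OF J_graded J_graded])
    show "fs ! i \<in> forms m 1" using ff i by auto
    have "{fs ! i} \<subseteq> polys m" using fp i by auto
    from genideal_genideal_Un [OF Up [of i] this]
    show "J (Suc i) = Idl\<^bsub>poly_ring m\<^esub> (J i \<union> {fs ! i})"
      unfolding J_def using i by (simp add: take_Suc_conv_app_nth Un_assoc)
    fix a :: "'k mpoly" assume a: "a \<in> polys m" "fs ! i * a \<in> J i"
    have fi: "fs ! i \<in> polys m" using fp i by auto
    have set: "set (take i (map ?q fs)) = ?q ` set (take i fs)" by (simp add: take_map)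
    have "?q (fs ! i * a) \<in> Idl\<^bsub>?Q\<^esub> (set (take i (map ?q fs)))"
      using quot_genideal [OF Ii tp polys_mult [OF fi a(1)]] a(2) unfolding set J_def by blast
    hence "map ?q fs ! i \<otimes>\<^bsub>?Q\<^esub> ?q a \<in> Idl\<^bsub>?Q\<^esub> (set (take i (map ?q fs)))"
      using i by (simp add: quot_simps(2) [OF Ii fi a(1)])
    hence "?q a \<in> Idl\<^bsub>?Q\<^esub> (set (take i (map ?q fs)))"
      using reg i a(1) unfolding regular_sequence_def by (simp add: quot_carrier [OF Ii])
    thus "a \<in> J i" using quot_genideal [OF Ii tp a(1)] unfolding set J_def by blast
  qed
  have "golod m (J 0) \<longleftrightarrow> golod m (J i)" if "i \<le> length fs" for i
    using that by (induction i) (auto simp: step)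
  hence "golod m (J 0) \<longleftrightarrow> golod m (J (length fs))" by blast
  moreover have "J 0 = I"
    using genideal_minimal [OF Ii, of I] genideal_self [OF Ip] unfolding J_def by auto
  moreover have ker_J: "ker \<subseteq> J (length fs)"
  proof -
    have "Idl\<^bsub>poly_ring m\<^esub> (set fs) = ker" using gens by (simp add: min_hom_gens_def)
    moreover have "Idl\<^bsub>poly_ring m\<^esub> (set fs) \<subseteq> J (length fs)"
      using genideal_self [OF Up [of "length fs"]] unfolding J_def
      by (intro genideal_minimal genideal_ideal Up) auto
    ultimately show ?thesis by simp
  qed
  moreover have "\<phi> ` J (length fs) = \<phi> ` I"
  proof
    show "\<phi> ` I \<subseteq> \<phi> ` J (length fs)"
      using genideal_self [OF Up [of "length fs"]] unfolding J_def by blast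
    have Im: "ideal (\<phi> ` I) (poly_ring n)" using graded_proper_image [OF I] by (simp add: graded_proper_def)
    have "set fs \<subseteq> ker" using gens genideal_self [OF fp] by (simp add: min_hom_gens_def)
    hence "I \<union> set (take (length fs) fs) \<subseteq> {p \<in> polys m. \<phi> p \<in> \<phi> ` I}"
      using Ip ideal_poly_ringD(2) [OF Im] by auto
    hence "J (length fs) \<subseteq> {p \<in> polys m. \<phi> p \<in> \<phi> ` I}"
      unfolding J_def by (rule genideal_minimal [OF ideal_preimage [OF Im]])
    thus "\<phi> ` J (length fs) \<subseteq> \<phi> ` I" by blast
  qed
  ultimately show ?thesis using golod_image [OF J_graded ker_J] by simp
qed

end
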